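(* Let $d \ge 2$. There exists a constant $\widetilde{C} > 0$ such that, for every $u \in C_c^\infty(\mathbb{R}^d)$ and every $1/2 \le s < 1$, $$\|u\|_{L^{\frac{d}{d-s}}(\mathbb{R}^d)} \leq \widetilde{C}\,(1-s)\, \|\nabla^s u\|_{L^1(\mathbb{R}^d)}.$$ (The constant $\widetilde C$ depends neither on $u$ nor on $s$.)
   Context: For $0<s<1$ and $u \in C_c^\infty(\mathbb{R}^d)$, the Riesz fractional gradient of order $s$ is the vector-valued function $$\nabla^s u(x) = \int_{\mathbb{R}^d} (u(x) - u(y)) \frac{x-y}{|x-y|^{d+s+1}} \, dy, \qquad x \in \mathbb{R}^d$$ (no normalizing constant is included). *)

theory Defs
  imports "HOL-Analysis.Analysis"
begin

text \<open>
  \<open>ck k f\<close>: \<open>f\<close> is of class \<open>C\<close>-\<open>k\<close> on the whole space. A function is of class \<open>C\<close>-\<open>(k+1)\<close> iff it is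
  (Frechet) differentiable and all its directional derivatives are of class \<open>C\<close>-\<open>k\<close>.
\<close>

primrec ck :: "nat \<Rightarrow> ('a::euclidean_space \<Rightarrow> real) \<Rightarrow> bool" where
  "ck 0 f \<longleftrightarrow> continuous_on UNIV f"
| "ck (Suc k) f \<longleftrightarrow>
     f differentiable_on UNIV \<and> (\<forall>v. ck k (\<lambda>x. frechet_derivative f (at x) v))"

definition test_functions :: "('a::euclidean_space \<Rightarrow> real) set" where
  "test_functions = {u. (\<forall>k. ck k u) \<and> compact (closure (support_on UNIV u))}"

text \<open>
  The integrand vanishes at \<open>y = x\<close>, because division by zero yields zero. For test functions
  and \<open>0 < s < 1\<close> the integral converges absolutely, so the Bochner integral is the
  integral meant, and not the default value \<open>0\<close> for non-integrable functions.
\<close>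

definition riesz_grad :: "real \<Rightarrow> ('a::euclidean_space \<Rightarrow> real) \<Rightarrow> 'a \<Rightarrow> 'a" where
  "riesz_grad s u x =
     (\<integral>y. ((u x - u y) / norm (x - y) powr (real DIM('a) + s + 1)) *\<^sub>R (x - y) \<partial>lborel)"

text \<open>
  The \<open>L\<close>-\<open>p\<close> norm for \<open>1 \<le> p < \<infinity>\<close> with respect to Lebesgue measure, with value \<open>\<infinity>\<close> if the
  \<open>p\<close>-th power of the norm is not integrable. The case distinction is needed since
  \<open>ennreal\<close> has no real powers.
\<close>

definition lp_norm ::
    "real \<Rightarrow> ('a::euclidean_space \<Rightarrow> 'b::real_normed_vector) \<Rightarrow> ennreal" where
  "lp_norm p f =
     (let I = (\<integral>\<^sup>+x. ennreal (norm (f x) powr p) \<partial>lborel)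
      in if I = \<infinity> then \<infinity> else ennreal (enn2real I powr (1 / p)))"

end

theory Submission
  imports Defs "HOL-Probability.Distributions"
begin

text \<open>
  Write \<open>s = 1 - 2\<beta>\<close>, let \<open>P\<^sub>t\<close> be the heat semigroup, and put
  \<open>v = \<integral>\<^sub>0\<^sup>\<infinity> t\<^bsup>\<beta>-1\<^esup> P\<^sub>t u dt\<close>, a Riesz potential of \<open>u\<close> of order \<open>2\<beta>\<close>.
  Subordination to the Gaussian gives \<open>\<nabla>v = c \<nabla>\<^sup>s u\<close> with \<open>c\<close> bounded in \<open>\<beta>\<close>, and the semigroup law gives
  \<open>\<bar>u\<bar> \<le> \<beta>\<^sup>2 \<integral>\<^sub>0\<^sup>\<infinity> \<tau>\<^bsup>-\<beta>-1\<^esup> \<bar>v - P\<^sub>\<tau> v\<bar> d\<tau>\<close>. Cut \<open>v\<close> into dyadic layers \<open>w = \<phi>\<^sub>a(v)\<close>, whose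
  gradients have essentially disjoint supports. For one layer, with \<open>A = \<parallel>\<nabla>w\<parallel>\<^sub>1\<close>, \<open>0 \<le> w \<le> \<Lambda>\<close> and support of
  measure \<open>m\<close>, one has \<open>\<parallel>w - P\<^sub>\<tau> w\<parallel>\<^sub>1 \<le> C \<surd>\<tau> A\<close> and \<open>\<parallel>w - P\<^sub>\<tau> w\<parallel>\<^sub>p \<le> 2 \<Lambda> m\<^bsup>1/p\<^esup>\<close>; interpolating the first bound
  with \<open>\<parallel>w - P\<^sub>\<tau> w\<parallel>\<^sub>\<infinity> \<le> \<Lambda>\<close> and splitting the \<open>\<tau>\<close>-integral at \<open>\<tau> = m\<^bsup>2/d\<^esup>\<close> yields
  \<open>C \<beta>\<^sup>-\<^sup>1 (A + \<Lambda> m\<^bsup>1-1/d\<^esup>)\<close> in \<open>L\<^sup>p\<close>. The last term is controlled by the gradient of the layer two levels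
  below, by a weak-type Sobolev inequality. Summing the layers gives \<open>\<parallel>u\<parallel>\<^sub>p \<le> C \<beta> \<parallel>\<nabla>v\<parallel>\<^sub>1\<close>, and \<open>2\<beta> = 1 - s\<close>.
\<close>

section \<open>The Gaussian kernel\<close>

text \<open>The endpoint L^1 is the obstacle. A potential of order s takes L^1 only to weak L^p with
  p = d/(d-s), so size estimates on kernels cannot suffice; what helps is that the integrable field
  is a gradient, so that cutting \<open>v\<close> by height cuts its gradient without loss
  (truncation in the manner of Maz'ya). On a single layer, height times a power of the measure of
  the support is a strong norm, and there the weak-type inequality is enough. The factor 1-s comes
  from counting \<beta> = (1-s)/2: the inversion formula gives \<beta>^2, the reciprocal of a lower
  bound for the mass of its kernel, while the energy of the layers costs 1/\<beta>, the integral of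
  t^(-\<beta>-1) over large t. All other constants are uniform because s \<ge> 1/2 keeps \<beta>
  \<le> 1/4. In place of L^p norms of time integrals, everything is tested against |u|^(p-1)
  (\<open>heat_energy\<close>): Tonelli then replaces Minkowski's inequality, layers can be added
  and passed to the limit by Fatou's lemma, and the finite positive factor ||u||_p^(p-1) cancels at
  the end.\<close>

lemma lborel_reflect_translate:
  fixes t :: "'a::euclidean_space"
  assumes "\<bar>c\<bar> = 1"
  shows "distr lborel borel (\<lambda>x. t + c *\<^sub>R x) = lborel"
proof -
  have "c \<noteq> 0" using assms by auto
  from lborel_affine[OF this, of t] assms show ?thesis by (simp add: density_1)
qed

lemma nn_integral_reflect_translate:
  fixes t :: "'a::euclidean_space"
  assumes [measurable]: "f \<in> borel_measurable borel" and "\<bar>c\<bar> = 1"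
  shows "(\<integral>\<^sup>+x. f (t + c *\<^sub>R x) \<partial>lborel) = (\<integral>\<^sup>+x. f x \<partial>lborel)"
  by (subst (2) lborel_reflect_translate[OF assms(2), of t, symmetric]) (simp add: nn_integral_distr)

lemma integral_reflect_translate:
  fixes t :: "'a::euclidean_space" and f :: "'a \<Rightarrow> 'b::{banach, second_countable_topology}"
  assumes [measurable]: "f \<in> borel_measurable borel" and "\<bar>c\<bar> = 1"
  shows "(\<integral>x. f (t + c *\<^sub>R x) \<partial>lborel) = (\<integral>x. f x \<partial>lborel)"
  by (subst (2) lborel_reflect_translate[OF assms(2), of t, symmetric]) (simp add: integral_distr)

lemmas nn_integral_translate = nn_integral_reflect_translate[where c=1, simplified]
lemmas integral_translate = integral_reflect_translate[where c=1, simplified]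

section \<open>Fubini and Tonelli for products of Lebesgue measures\<close>

lemma integrable_lborel_pairI:
  fixes f :: "'a::euclidean_space \<Rightarrow> 'b::euclidean_space \<Rightarrow> 'c::{banach, second_countable_topology}"
  assumes [measurable]: "case_prod f \<in> borel_measurable (borel \<Otimes>\<^sub>M borel)"
    and "(\<integral>\<^sup>+x. \<integral>\<^sup>+y. ennreal (norm (f x y)) \<partial>lborel \<partial>lborel) < \<infinity>"
  shows "integrable (lborel \<Otimes>\<^sub>M lborel) (case_prod f)"
proof (rule integrableI_bounded)
  have "(\<integral>\<^sup>+x. \<integral>\<^sup>+y. ennreal (norm (case_prod f (x,y))) \<partial>lborel \<partial>lborel)
    = (\<integral>\<^sup>+z. ennreal (norm (case_prod f z)) \<partial>(lborel \<Otimes>\<^sub>M lborel))"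
    by (rule lborel.nn_integral_fst) measurable
  then show "(\<integral>\<^sup>+z. ennreal (norm (case_prod f z)) \<partial>(lborel \<Otimes>\<^sub>M lborel)) < \<infinity>"
    using assms(2) by simp
qed measurable

lemma lborel_Fubini:
  fixes f :: "'a::euclidean_space \<Rightarrow> 'b::euclidean_space \<Rightarrow> 'c::{banach, second_countable_topology}"
  assumes "case_prod f \<in> borel_measurable (borel \<Otimes>\<^sub>M borel)"
    and "(\<integral>\<^sup>+x. \<integral>\<^sup>+y. ennreal (norm (f x y)) \<partial>lborel \<partial>lborel) < \<infinity>"
  shows "(\<integral>x. \<integral>y. f x y \<partial>lborel \<partial>lborel) = (\<integral>y. \<integral>x. f x y \<partial>lborel \<partial>lborel)"
  by (rule lborel_pair.Fubini_integral[symmetric]) (rule integrable_lborel_pairI[OF assms])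

lemma lborel_Tonelli:
  fixes f :: "'a::euclidean_space \<Rightarrow> 'b::euclidean_space \<Rightarrow> ennreal"
  assumes "case_prod f \<in> borel_measurable (borel \<Otimes>\<^sub>M borel)"
  shows "(\<integral>\<^sup>+x. \<integral>\<^sup>+y. f x y \<partial>lborel \<partial>lborel) = (\<integral>\<^sup>+y. \<integral>\<^sup>+x. f x y \<partial>lborel \<partial>lborel)"
  by (rule lborel_pair.Fubini'[symmetric]) (use assms in simp)

text \<open>The density of the normal law with covariance t times the identity, that is, the heat
  kernel of half the Laplacian. With variance t rather than 2t the coordinate factors are exactly
  \<open>normal_density 0 (sqrt t)\<close>.\<close>

definition gauss :: "real \<Rightarrow> 'a::euclidean_space \<Rightarrow> real" where
  "gauss t z = (2 * pi * t) powr (- real DIM('a) / 2) * exp (- (norm z)\<^sup>2 / (2 * t))"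

lemma gauss_nonneg [simp]: "0 \<le> gauss t z"
  by (simp add: gauss_def)

lemma gauss_measurable [measurable]:
  "case_prod gauss \<in> borel_measurable (borel \<Otimes>\<^sub>M borel)"
  unfolding gauss_def by measurable

lemma gauss_minus [simp]: "gauss t (- z) = gauss t z"
  by (simp add: gauss_def)

lemma gauss_le:
  fixes z :: "'a::euclidean_space"
  assumes "t > 0"
  shows "gauss t z \<le> t powr (- real DIM('a) / 2)"
proof -
  have "(2 * pi * t) powr (- real DIM('a) / 2) \<le> t powr (- real DIM('a) / 2)"
    using assms pi_gt3 by (intro powr_mono2') auto
  moreover have "exp (- (norm z)\<^sup>2 / (2 * t)) \<le> 1" using assms by auto
  ultimately show ?thesis unfolding gauss_def
    by (metis exp_ge_zero mult_mono mult.right_neutral powr_ge_zero)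
qed

lemma norm_sq_eq_sum: "(norm z)\<^sup>2 = (\<Sum>b\<in>Basis. (z \<bullet> b)\<^sup>2)" for z :: "'a::euclidean_space"
  by (subst power2_norm_eq_inner, subst euclidean_inner) (simp add: power2_eq_square)

text \<open>Through this product the mass, the second moment and the convolution law all reduce to
  one-dimensional facts about \<open>normal_density\<close>.\<close>

lemma gauss_eq_prod:
  fixes z :: "'a::euclidean_space"
  assumes "t > 0"
  shows "gauss t z = (\<Prod>b\<in>Basis. normal_density 0 (sqrt t) (z \<bullet> b))"
proof -
  have "(\<Prod>b\<in>(Basis::'a set). normal_density 0 (sqrt t) (z \<bullet> b))
     = (1 / sqrt (2 * pi * t)) ^ DIM('a) * exp (\<Sum>b\<in>(Basis::'a set). - (z \<bullet> b)\<^sup>2 / (2 * t))"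
    using assms by (simp add: normal_density_def exp_sum prod.distrib power_one_over prod_dividef)
  also have "(\<Sum>b\<in>(Basis::'a set). - (z \<bullet> b)\<^sup>2 / (2 * t)) = - (norm z)\<^sup>2 / (2 * t)"
    by (simp add: norm_sq_eq_sum sum_negf sum_divide_distrib)
  also have "(1 / sqrt (2 * pi * t)) ^ DIM('a) = (2 * pi * t) powr (- real DIM('a) / 2)"
  proof -
    have "1 / sqrt (2 * pi * t) = (2 * pi * t) powr (-1/2)"
      using assms by (simp add: powr_half_sqrt powr_minus_divide)
    then show ?thesis using assms by (simp add: powr_power)
  qed
  finally show ?thesis by (simp add: gauss_def)
qed

lemma nn_integral_normal_density: 
  assumes "t > 0"
  shows "(\<integral>\<^sup>+x. ennreal (normal_density 0 (sqrt t) x) \<partial>lborel) = 1"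
  using assms by (subst nn_integral_eq_integral) auto

lemma nn_integral_gauss:
  assumes "t > 0"
  shows "(\<integral>\<^sup>+z. ennreal (gauss t (z::'a::euclidean_space)) \<partial>lborel) = 1"
proof -
  have "(\<integral>\<^sup>+z. ennreal (gauss t (z::'a)) \<partial>lborel)
     = (\<integral>\<^sup>+z. (\<Prod>b\<in>Basis. ennreal (normal_density 0 (sqrt t) ((z::'a) \<bullet> b))) \<partial>lborel)"
    using assms by (simp add: gauss_eq_prod prod_ennreal)
  also have "\<dots> = 1"
    using assms by (subst nn_integral_lborel_prod) (auto simp: nn_integral_normal_density)
  finally show ?thesis .
qed

lemma gauss_integrable [intro!]: "t > 0 \<Longrightarrow> integrable lborel (gauss t)"
  by (rule integrableI_bounded) (auto simp: nn_integral_gauss)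

lemma integral_gauss: "t > 0 \<Longrightarrow> (\<integral>z. gauss t z \<partial>lborel) = 1"
  by (rule integral_eq_nn_integral[THEN trans]) (auto simp: nn_integral_gauss)

lemma nn_integral_gauss_sq:
  assumes t: "t > 0"
  shows "(\<integral>\<^sup>+z. ennreal (gauss t (z::'a::euclidean_space) * (norm z)\<^sup>2) \<partial>lborel) = ennreal (real DIM('a) * t)"
proof -
  have sq: "(\<integral>\<^sup>+x. ennreal (normal_density 0 (sqrt t) x * x\<^sup>2) \<partial>lborel) = ennreal t"
  proof -
    have "has_bochner_integral lborel (\<lambda>x. normal_density 0 (sqrt t) x * x\<^sup>2) t"
      using normal_moment_even[of "sqrt t" 0 1] t by simp
    then show ?thesis
      using t by (subst nn_integral_eq_integral) (auto simp: has_bochner_integral_iff)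
  qed
  have "(\<integral>\<^sup>+z. ennreal (gauss t (z::'a) * (norm z)\<^sup>2) \<partial>lborel)
     = (\<integral>\<^sup>+z. (\<Sum>i\<in>Basis. ennreal (gauss t (z::'a) * (z \<bullet> i)\<^sup>2)) \<partial>lborel)"
    by (intro nn_integral_cong, subst sum_ennreal) (auto simp: norm_sq_eq_sum sum_distrib_left)
  also have "\<dots> = (\<Sum>i\<in>Basis. \<integral>\<^sup>+z. ennreal (gauss t (z::'a) * (z \<bullet> i)\<^sup>2) \<partial>lborel)"
    by (rule nn_integral_sum) simp
  also have "\<dots> = (\<Sum>i\<in>(Basis::'a set). ennreal t)"
  proof (rule sum.cong[OF refl])
    fix i :: 'a assume i: "i \<in> Basis"
    \<comment> \<open>Placing the square in the factor of the coordinate i alone keeps the integrand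
      a product over the basis.\<close>
    define f where "f b x = normal_density 0 (sqrt t) x * (if b = i then x\<^sup>2 else 1)" for b :: 'a and x :: real
    have "(\<integral>\<^sup>+z. ennreal (gauss t (z::'a) * (z \<bullet> i)\<^sup>2) \<partial>lborel)
      = (\<integral>\<^sup>+z. (\<Prod>b\<in>Basis. ennreal (f b ((z::'a) \<bullet> b))) \<partial>lborel)"
      using i t by (simp add: gauss_eq_prod prod_ennreal f_def prod.distrib prod.delta')
    also have "\<dots> = (\<Prod>b\<in>Basis. (\<integral>\<^sup>+x. ennreal (f b x) \<partial>lborel))"
      by (rule nn_integral_lborel_prod) (auto simp: f_def)
    also have "\<dots> = (\<Prod>b\<in>Basis. if b = i then ennreal t else 1)"
      by (rule prod.cong) (auto simp: f_def sq nn_integral_normal_density t)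
    also have "\<dots> = ennreal t" using i by (simp add: prod.delta')
    finally show "(\<integral>\<^sup>+z. ennreal (gauss t (z::'a) * (z \<bullet> i)\<^sup>2) \<partial>lborel) = ennreal t" .
  qed
  also have "\<dots> = ennreal (real DIM('a) * t)"
    using t by (simp add: ennreal_mult' ennreal_of_nat_eq_real_of_nat)
  finally show ?thesis .
qed

text \<open>Weighting |z| \<le> |z|^2 / sqrt t + sqrt t makes both terms scale like sqrt t, so the
  first moment follows from the second moment d * t and the mass 1; hence the constant d +
  1.\<close>

lemma nn_integral_gauss_norm:
  assumes t: "t > 0"
  shows "(\<integral>\<^sup>+z. ennreal (gauss t (z::'a::euclidean_space) * norm z) \<partial>lborel) \<le> ennreal ((DIM('a) + 1) * sqrt t)"
proof -
  have *: "norm z \<le> (norm z)\<^sup>2 / sqrt t + sqrt t" for z :: 'a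
  proof -
    have "0 \<le> (norm z - sqrt t)\<^sup>2" by simp
    then have "2 * (norm z * sqrt t) \<le> (norm z)\<^sup>2 + t" using t by (simp add: power2_diff)
    moreover have "0 \<le> norm z * sqrt t" using t by simp
    ultimately have "norm z * sqrt t \<le> (norm z)\<^sup>2 + t" by linarith
    then show ?thesis using t by (simp add: field_simps)
  qed
  have "(\<integral>\<^sup>+z. ennreal (gauss t (z::'a) * norm z) \<partial>lborel)
     \<le> (\<integral>\<^sup>+z. ennreal (1 / sqrt t) * ennreal (gauss t (z::'a) * (norm z)\<^sup>2) + ennreal (sqrt t) * ennreal (gauss t z) \<partial>lborel)"
  proof (rule nn_integral_mono)
    fix z :: 'a
    have "gauss t z * norm z \<le> gauss t z * ((norm z)\<^sup>2 / sqrt t + sqrt t)"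
      by (intro mult_left_mono * gauss_nonneg)
    also have "\<dots> = 1 / sqrt t * (gauss t z * (norm z)\<^sup>2) + sqrt t * gauss t z" by (simp add: field_simps)
    finally have "ennreal (gauss t z * norm z) \<le> ennreal \<dots>" by (rule ennreal_leI)
    also have "\<dots> = ennreal (1 / sqrt t) * ennreal (gauss t z * (norm z)\<^sup>2) + ennreal (sqrt t) * ennreal (gauss t z)"
      using t by (subst ennreal_plus) (simp_all only: ennreal_mult'[symmetric] gauss_nonneg real_sqrt_ge_zero less_imp_le
          zero_le_power2 mult_nonneg_nonneg divide_nonneg_nonneg zero_le_one)
    finally show "ennreal (gauss t z * norm z) \<le> ennreal (1 / sqrt t) * ennreal (gauss t z * (norm z)\<^sup>2) + ennreal (sqrt t) * ennreal (gauss t z)" .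
  qed
  also have "\<dots> = ennreal (1 / sqrt t) * ennreal (real DIM('a) * t) + ennreal (sqrt t)"
    using t by (simp add: nn_integral_add nn_integral_cmult nn_integral_gauss nn_integral_gauss_sq)
  also have "\<dots> = ennreal ((DIM('a) + 1) * sqrt t)"
    using t by (simp add: ennreal_mult[symmetric] ennreal_plus[symmetric] field_simps real_sqrt_mult_self
       del: ennreal_plus)
  finally show ?thesis .
qed

lemma gauss_convolution:
  fixes x :: "'a::euclidean_space"
  assumes s: "s > 0" and t: "t > 0"
  shows "(\<integral>\<^sup>+y. ennreal (gauss s (x - y) * gauss t y) \<partial>lborel) = ennreal (gauss (s + t) x)"
proof -
  have "(\<integral>\<^sup>+y. ennreal (gauss s (x - y) * gauss t y) \<partial>lborel)
    = (\<integral>\<^sup>+y. (\<Prod>b\<in>Basis. ennreal (normal_density 0 (sqrt s) (x \<bullet> b - y \<bullet> b) * normal_density 0 (sqrt t) (y \<bullet> b))) \<partial>lborel)"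
    using s t by (simp add: gauss_eq_prod prod_ennreal prod.distrib inner_diff_left)
  also have "\<dots> = (\<Prod>b\<in>Basis. (\<integral>\<^sup>+y. ennreal (normal_density 0 (sqrt s) (x \<bullet> b - y) * normal_density 0 (sqrt t) y) \<partial>lborel))"
    by (rule nn_integral_lborel_prod[where f="\<lambda>b y. normal_density 0 (sqrt s) (x \<bullet> b - y) * normal_density 0 (sqrt t) y"]) auto
  also have "\<dots> = (\<Prod>b\<in>Basis. ennreal (normal_density 0 (sqrt (s + t)) (x \<bullet> b)))"
    using conv_normal_density_zero_mean[of "sqrt s" "sqrt t"] s t by (simp add: fun_eq_iff)
  also have "\<dots> = ennreal (gauss (s + t) x)"
    using s t by (simp add: gauss_eq_prod prod_ennreal)
  finally show ?thesis .
qed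

definition heat :: "real \<Rightarrow> ('a::euclidean_space \<Rightarrow> real) \<Rightarrow> 'a \<Rightarrow> real" where
  "heat t f x = (\<integral>z. gauss t z * f (x + z) \<partial>lborel)"

section \<open>The heat semigroup\<close>

lemma nn_integral_gauss_shift:
  fixes x :: "'a::euclidean_space"
  assumes "t > 0"
  shows "(\<integral>\<^sup>+y. ennreal (gauss t (y - x)) \<partial>lborel) = 1"
  using nn_integral_translate[of "\<lambda>z. ennreal (gauss t z)" "-x"] nn_integral_gauss[OF assms, where 'a='a] by simp

lemma heat_integrable:
  fixes x :: "'a::euclidean_space"
  assumes [measurable]: "f \<in> borel_measurable borel" and "\<And>x. \<bar>f x\<bar> \<le> M" and t: "t > 0"
  shows "integrable lborel (\<lambda>z. gauss t z * f (x + z))"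
proof (rule Bochner_Integration.integrable_bound)
  show "integrable lborel (\<lambda>z::'a. M * gauss t z)" using t by auto
  show "AE z in lborel. norm (gauss t z * f (x + z)) \<le> norm (M * gauss t z)"
  proof (rule AE_I2)
    fix z :: 'a
    have "\<bar>f (x + z)\<bar> \<le> \<bar>M\<bar>" using assms(2)[of "x+z"] by linarith
    then show "norm (gauss t z * f (x + z)) \<le> norm (M * gauss t z)"
      by (simp add: abs_mult mult.commute[of "\<bar>M\<bar>"] mult_left_mono)
  qed
qed measurable

lemma heat_bound:
  fixes x :: "'a::euclidean_space"
  assumes [measurable]: "f \<in> borel_measurable borel" and b: "\<And>x. \<bar>f x\<bar> \<le> M" and t: "t > 0"
  shows "\<bar>heat t f x\<bar> \<le> M"
proof -
  have "\<bar>heat t f x\<bar> \<le> (\<integral>z. M * gauss t (z::'a) \<partial>lborel)"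
    unfolding heat_def
  proof (rule order_trans[OF integral_abs_bound], rule Bochner_Integration.integral_mono)
    show "integrable lborel (\<lambda>z. \<bar>gauss t z * f (x + z)\<bar>)"
      by (intro integrable_abs heat_integrable[where M=M] b t) measurable
    show "integrable lborel (\<lambda>z::'a. M * gauss t z)" using t by auto
    show "\<bar>gauss t z * f (x + z)\<bar> \<le> M * gauss t z" for z
      using b[of "x+z"] by (simp add: abs_mult mult.commute[of M] mult_left_mono)
  qed
  also have "\<dots> = M" using t by (simp add: integral_gauss)
  finally show ?thesis .
qed

lemma heat_nonneg: "(\<And>x. 0 \<le> f x) \<Longrightarrow> 0 \<le> heat t f x"
  unfolding heat_def by (rule integral_nonneg_AE) auto

lemma heat_minus: "heat t (\<lambda>x. - f x) x = - heat t f x"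
  unfolding heat_def by simp

lemma heat_diff:
  assumes [measurable]: "f \<in> borel_measurable borel" "g \<in> borel_measurable borel"
    and "\<And>x. \<bar>f x\<bar> \<le> M" "\<And>x. \<bar>g x\<bar> \<le> N" "t > 0"
  shows "heat t (\<lambda>x. f x - g x) x = heat t f x - heat t g x"
  unfolding heat_def
  by (subst Bochner_Integration.integral_diff[symmetric])
     (auto intro!: heat_integrable[where f=f and M=M] heat_integrable[where f=g and M=N] assms simp: right_diff_distrib)

lemma heat_sum:
  assumes "\<And>i. i \<in> I \<Longrightarrow> f i \<in> borel_measurable borel"
    and "\<And>i x. i \<in> I \<Longrightarrow> \<bar>f i x\<bar> \<le> M i" "t > 0"
  shows "heat t (\<lambda>x. \<Sum>i\<in>I. f i x) x = (\<Sum>i\<in>I. heat t (f i) x)"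
  unfolding heat_def
  by (subst Bochner_Integration.integral_sum[symmetric])
     (auto intro!: heat_integrable[where M="M _"] assms simp: sum_distrib_left)

lemma heat_measurable2 [measurable]:
  assumes [measurable]: "f \<in> borel_measurable borel"
  shows "(\<lambda>(t, x). heat t f (x::'a::euclidean_space)) \<in> borel_measurable (borel \<Otimes>\<^sub>M borel)"
  unfolding heat_def by measurable

lemma heat_measurable [measurable]:
  assumes [measurable]: "f \<in> borel_measurable borel"
  shows "heat t f \<in> borel_measurable borel"
  unfolding heat_def[abs_def] by measurable

lemma heat_eq:
  fixes x :: "'a::euclidean_space"
  assumes [measurable]: "f \<in> borel_measurable borel"
  shows "heat t f x = (\<integral>y. gauss t (y - x) * f y \<partial>lborel)"
  using integral_translate[of "\<lambda>y. gauss t (y - x) * f y" x] by (simp add: heat_def)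

lemma heat_heat:
  fixes x :: "'a::euclidean_space"
  assumes [measurable]: "f \<in> borel_measurable borel" and b: "\<And>x. \<bar>f x\<bar> \<le> M" and s: "s > 0" and t: "t > 0"
  shows "heat s (heat t f) x = heat (s + t) f x"
proof -
  have M: "M \<ge> 0" using b[of 0] by linarith
  have conv: "(\<integral>y. gauss s (y - x) * gauss t (z - y) \<partial>lborel) = gauss (s + t) (z - x)" for z
  proof -
    have "(\<integral>\<^sup>+y. ennreal (gauss s (y - x) * gauss t (z - y)) \<partial>lborel)
      = (\<integral>\<^sup>+y. ennreal (gauss t ((z - x) - y) * gauss s y) \<partial>lborel)"
      by (subst nn_integral_translate[of _ x, symmetric]) (auto simp: algebra_simps)
    also have "\<dots> = ennreal (gauss (s + t) (z - x))"
      using gauss_convolution[OF t s] by (simp add: add.commute)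
    finally show ?thesis
      by (subst integral_eq_nn_integral) auto
  qed
  have "heat s (heat t f) x = (\<integral>y. gauss s (y - x) * (\<integral>z. gauss t (z - y) * f z \<partial>lborel) \<partial>lborel)"
    by (simp add: heat_eq)
  also have "\<dots> = (\<integral>y. \<integral>z. gauss s (y - x) * (gauss t (z - y) * f z) \<partial>lborel \<partial>lborel)"
    by simp
  also have "\<dots> = (\<integral>z. \<integral>y. gauss s (y - x) * (gauss t (z - y) * f z) \<partial>lborel \<partial>lborel)"
  proof (rule lborel_Fubini)
    have "(\<integral>\<^sup>+ y. \<integral>\<^sup>+ z. ennreal (norm (gauss s (y - x) * (gauss t (z - y) * f z))) \<partial>lborel \<partial>lborel)
      \<le> (\<integral>\<^sup>+ y. \<integral>\<^sup>+ z. ennreal M * ennreal (gauss s (y - x)) * ennreal (gauss t (z - y)) \<partial>lborel \<partial>lborel)"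
    proof (intro nn_integral_mono)
      fix y z
      have "norm (gauss s (y - x) * (gauss t (z - y) * f z)) = \<bar>f z\<bar> * (gauss s (y - x) * gauss t (z - y))"
        by (simp add: abs_mult mult_ac)
      also have "\<dots> \<le> M * (gauss s (y - x) * gauss t (z - y))"
        by (intro mult_right_mono b) auto
      finally show "ennreal (norm (gauss s (y - x) * (gauss t (z - y) * f z))) \<le> ennreal M * ennreal (gauss s (y - x)) * ennreal (gauss t (z - y))"
        using M by (simp add: ennreal_mult'[symmetric] mult.assoc ennreal_leI)
    qed
    also have "\<dots> = ennreal M"
      using s t by (simp add: nn_integral_cmult nn_integral_gauss_shift)
    finally show "(\<integral>\<^sup>+ y. \<integral>\<^sup>+ z. ennreal (norm (gauss s (y - x) * (gauss t (z - y) * f z))) \<partial>lborel \<partial>lborel) < \<infinity>"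
      by (simp add: le_less_trans)
  qed measurable
  also have "\<dots> = (\<integral>z. (\<integral>y. gauss s (y - x) * gauss t (z - y) \<partial>lborel) * f z \<partial>lborel)"
    by (simp add: mult.assoc[symmetric])
  also have "\<dots> = heat (s + t) f x" by (simp add: conv heat_eq)
  finally show ?thesis .
qed

text \<open>No integrability is assumed: where the Bochner integral does not exist its default value
  0 satisfies the bound as well.\<close>

lemma heat_abs_le_nn:
  fixes x :: "'a::euclidean_space"
  assumes [measurable]: "f \<in> borel_measurable borel"
  shows "ennreal \<bar>heat t f x\<bar> \<le> (\<integral>\<^sup>+z. ennreal (gauss t z) * ennreal \<bar>f (x + z)\<bar> \<partial>lborel)"
proof -
  have "ennreal \<bar>heat t f x\<bar> \<le> (\<integral>\<^sup>+z. ennreal (norm (gauss t z * f (x + z))) \<partial>lborel)"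
  proof (cases "integrable lborel (\<lambda>z. gauss t z * f (x + z))")
    case True
    then show ?thesis unfolding heat_def using integral_norm_bound_ennreal by force
  next
    case False
    then show ?thesis by (simp add: heat_def not_integrable_integral_eq)
  qed
  then show ?thesis by (simp add: abs_mult ennreal_mult')
qed

lemma heat_sup_L1:
  fixes x :: "'a::euclidean_space"
  assumes [measurable]: "f \<in> borel_measurable borel" and t: "t > 0"
  shows "ennreal \<bar>heat t f x\<bar> \<le> ennreal (t powr (- real DIM('a) / 2)) * (\<integral>\<^sup>+y. ennreal \<bar>f y\<bar> \<partial>lborel)"
proof -
  have "ennreal \<bar>heat t f x\<bar> \<le> (\<integral>\<^sup>+z. ennreal (gauss t z) * ennreal \<bar>f (x + z)\<bar> \<partial>lborel)"
    by (rule heat_abs_le_nn) fact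
  also have "\<dots> \<le> (\<integral>\<^sup>+z. ennreal (t powr (- real DIM('a) / 2)) * ennreal \<bar>f (x + z)\<bar> \<partial>lborel)"
    by (intro nn_integral_mono mult_right_mono ennreal_leI gauss_le t) auto
  also have "\<dots> = ennreal (t powr (- real DIM('a) / 2)) * (\<integral>\<^sup>+z. ennreal \<bar>f (x + z)\<bar> \<partial>lborel)"
    by (rule nn_integral_cmult) measurable
  also have "(\<integral>\<^sup>+z. ennreal \<bar>f (x + z)\<bar> \<partial>lborel) = (\<integral>\<^sup>+y. ennreal \<bar>f y\<bar> \<partial>lborel)"
    by (rule nn_integral_translate) measurable
  finally show ?thesis .
qed

section \<open>Differences between a function and its heat evolution\<close>

lemma heat_diff_eq:
  fixes x :: "'a::euclidean_space"
  assumes [measurable]: "w \<in> borel_measurable borel" and b: "\<And>x. \<bar>w x\<bar> \<le> M" and t: "t > 0"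
  shows "heat t w x - w x = (\<integral>z. gauss t z * (w (x + z) - w x) \<partial>lborel)"
proof -
  have "(\<integral>z. gauss t z * (w (x + z) - w x) \<partial>lborel) = (\<integral>z. gauss t z * w (x + z) - gauss t z * w x \<partial>lborel)"
    by (simp add: algebra_simps)
  also have "\<dots> = heat t w x - w x"
    using t by (subst Bochner_Integration.integral_diff) (auto intro!: heat_integrable[where M=M] b simp: heat_def integral_gauss)
  finally show ?thesis by simp
qed

lemma heat_diff_le_nn:
  fixes x :: "'a::euclidean_space"
  assumes [measurable]: "w \<in> borel_measurable borel" and b: "\<And>x. \<bar>w x\<bar> \<le> M" and t: "t > 0"
  shows "ennreal \<bar>w x - heat t w x\<bar> \<le> (\<integral>\<^sup>+z. ennreal (gauss t z) * ennreal \<bar>w (x + z) - w x\<bar> \<partial>lborel)"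
proof -
  have int: "integrable lborel (\<lambda>z. gauss t z * (w (x + z) - w x))"
    unfolding right_diff_distrib using t
    by (intro Bochner_Integration.integrable_diff heat_integrable[where M=M] b integrable_mult_left gauss_integrable) auto
  have "ennreal \<bar>w x - heat t w x\<bar> = ennreal (norm (\<integral>z. gauss t z * (w (x + z) - w x) \<partial>lborel))"
    by (subst heat_diff_eq[symmetric, where M=M]) (auto simp: b t abs_minus_commute)
  also have "\<dots> \<le> (\<integral>\<^sup>+z. ennreal (norm (gauss t z * (w (x + z) - w x))) \<partial>lborel)"
    by (rule integral_norm_bound_ennreal[OF int])
  finally show ?thesis by (simp add: abs_mult ennreal_mult')
qed

text \<open>\<open>w - heat t w\<close> is a Gaussian average of translation differences, and the
  first moment of the Gaussian is at most (d+1) sqrt t. The hypothesis on translations stands for a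
  total gradient of size A; in this form it passes directly from
  \<open>layer_translation\<close>.\<close>

lemma heat_diff_L1:
  fixes w :: "'a::euclidean_space \<Rightarrow> real"
  assumes [measurable]: "w \<in> borel_measurable borel" and b: "\<And>x. \<bar>w x\<bar> \<le> M" and t: "t > 0"
    and A: "A \<ge> 0" "\<And>h. (\<integral>\<^sup>+x. ennreal \<bar>w (x + h) - w x\<bar> \<partial>lborel) \<le> ennreal (norm h * A)"
  shows "(\<integral>\<^sup>+x. ennreal \<bar>w x - heat t w x\<bar> \<partial>lborel) \<le> ennreal ((real DIM('a) + 1) * sqrt t * A)"
proof -
  have "(\<integral>\<^sup>+x. ennreal \<bar>w x - heat t w x\<bar> \<partial>lborel)
     \<le> (\<integral>\<^sup>+x. \<integral>\<^sup>+z. ennreal (gauss t z) * ennreal \<bar>w (x + z) - w x\<bar> \<partial>lborel \<partial>lborel)"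
    by (intro nn_integral_mono heat_diff_le_nn[where M=M] b t) measurable
  also have "\<dots> = (\<integral>\<^sup>+z. \<integral>\<^sup>+x. ennreal (gauss t z) * ennreal \<bar>w (x + z) - w x\<bar> \<partial>lborel \<partial>lborel)"
    by (rule lborel_Tonelli) measurable
  also have "\<dots> = (\<integral>\<^sup>+z. ennreal (gauss t z) * (\<integral>\<^sup>+x. ennreal \<bar>w (x + z) - w x\<bar> \<partial>lborel) \<partial>lborel)"
    by (intro nn_integral_cong nn_integral_cmult) measurable
  also have "\<dots> \<le> (\<integral>\<^sup>+z. ennreal A * ennreal (gauss t z * norm (z::'a)) \<partial>lborel)"
  proof (rule nn_integral_mono)
    fix z :: 'a
    have "ennreal (gauss t z) * (\<integral>\<^sup>+x. ennreal \<bar>w (x + z) - w x\<bar> \<partial>lborel) \<le> ennreal (gauss t z) * ennreal (norm z * A)"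
      by (intro mult_left_mono A) auto
    then show "ennreal (gauss t z) * (\<integral>\<^sup>+x. ennreal \<bar>w (x + z) - w x\<bar> \<partial>lborel) \<le> ennreal A * ennreal (gauss t z * norm z)"
      using A(1) by (simp add: ennreal_mult' mult_ac)
  qed
  also have "\<dots> = ennreal A * (\<integral>\<^sup>+z. ennreal (gauss t z * norm (z::'a)) \<partial>lborel)"
    by (rule nn_integral_cmult) measurable
  also have "\<dots> \<le> ennreal A * ennreal ((DIM('a) + 1) * sqrt t)"
    by (intro mult_left_mono nn_integral_gauss_norm t) auto
  also have "\<dots> = ennreal ((real DIM('a) + 1) * sqrt t * A)"
    using A(1) by (simp add: ennreal_mult'[symmetric] mult_ac add.commute)
  finally show ?thesis .
qed

text \<open>Since \<open>P\<^sub>4\<^sub>t w - P\<^sub>t w = P\<^sub>t (P\<^sub>3\<^sub>t w - w)\<close> has sup norm at most \<open>C t\<^bsup>(1-d)/2\<^esup> A\<close>, the bound telescopes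
  along \<open>t, 4t, 16t, \<dots>\<close>; this is where \<open>d \<ge> 2\<close> enters.\<close>

lemma heat_decay:
  fixes w :: "'a::euclidean_space \<Rightarrow> real"
  assumes [measurable]: "w \<in> borel_measurable borel" and b: "\<And>x. \<bar>w x\<bar> \<le> M" and t: "t > 0"
    and fin: "(\<integral>\<^sup>+x. ennreal \<bar>w x\<bar> \<partial>lborel) < \<infinity>"
    and A: "A \<ge> 0" "\<And>h. (\<integral>\<^sup>+x. ennreal \<bar>w (x + h) - w x\<bar> \<partial>lborel) \<le> ennreal (norm h * A)"
    and d: "DIM('a) \<ge> 2"
  shows "\<bar>heat t w x\<bar> \<le> 4 * (real DIM('a) + 1) * t powr ((1 - real DIM('a)) / 2) * A"
proof -
  define d where "d = real DIM('a)"
  have d2: "d \<ge> 2" using d unfolding d_def by simp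
  define K where "K = 2 * (d + 1) * t powr ((1 - d) / 2) * A"
  have K: "K \<ge> 0" using A(1) d2 by (simp add: K_def)
  have step: "\<bar>heat s w x - heat (4 * s) w x\<bar> \<le> 2 * (d + 1) * s powr ((1 - d) / 2) * A" if s: "s > 0" for s
  proof -
    define g where "g = (\<lambda>x. w x - heat (3 * s) w x)"
    have g[measurable]: "g \<in> borel_measurable borel" unfolding g_def by measurable
    have "heat s w x - heat (4 * s) w x = heat s w x - heat s (heat (3 * s) w) x"
      using s by (subst heat_heat[where M=M]) (auto simp: b)
    also have "\<dots> = heat s g x"
      unfolding g_def using s by (subst heat_diff[where M=M and N=M]) (auto intro!: heat_bound b)
    finally have "ennreal \<bar>heat s w x - heat (4 * s) w x\<bar> = ennreal \<bar>heat s g x\<bar>" by simp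
    also have "\<dots> \<le> ennreal (s powr (- d / 2)) * (\<integral>\<^sup>+y. ennreal \<bar>g y\<bar> \<partial>lborel)"
      unfolding d_def by (rule heat_sup_L1) (auto simp: s)
    also have "\<dots> \<le> ennreal (s powr (- d / 2)) * ennreal ((d + 1) * sqrt (3 * s) * A)"
      unfolding d_def g_def using s by (intro mult_left_mono heat_diff_L1[where M=M] b A) auto
    also have "\<dots> = ennreal (s powr (- d / 2) * ((d + 1) * sqrt (3 * s) * A))"
      using d2 s A(1) by (subst ennreal_mult'[symmetric]) auto
    finally have "\<bar>heat s w x - heat (4 * s) w x\<bar> \<le> s powr (- d / 2) * ((d + 1) * sqrt (3 * s) * A)"
      using d2 s A(1) by (subst (asm) ennreal_le_iff) auto
    also have "sqrt (3 * s) \<le> 2 * s powr (1/2)"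
    proof -
      have "sqrt (3 * s) \<le> sqrt (4 * s)" using s by simp
      also have "\<dots> = 2 * sqrt s" by (simp add: real_sqrt_mult)
      finally show ?thesis using s by (simp add: powr_half_sqrt)
    qed
    then have "s powr (- d / 2) * ((d + 1) * sqrt (3 * s) * A) \<le> s powr (- d / 2) * ((d + 1) * (2 * s powr (1/2)) * A)"
      using d2 A(1) by (intro mult_left_mono mult_right_mono) auto
    also have "\<dots> = 2 * (d + 1) * (s powr (- d / 2) * s powr (1/2)) * A" by simp
    also have "s powr (- d / 2) * s powr (1/2) = s powr ((1 - d) / 2)"
      by (simp add: powr_add[symmetric] field_simps)
    finally show ?thesis .
  qed
  have iter: "\<bar>heat t w x\<bar> \<le> \<bar>heat (4 ^ n * t) w x\<bar> + K * (\<Sum>j<n. (1/2) ^ j)" for n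
  proof (induction n)
    case (Suc n)
    have "\<bar>heat (4 ^ n * t) w x\<bar> \<le> \<bar>heat (4 ^ Suc n * t) w x\<bar> + 2 * (d + 1) * (4 ^ n * t) powr ((1 - d) / 2) * A"
      using step[of "4 ^ n * t"] t by (simp add: mult.assoc)
    also have "(4 ^ n * t) powr ((1 - d) / 2) \<le> t powr ((1 - d) / 2) * (1/2) ^ n"
    proof -
      have "(4 ^ n) powr ((1 - d) / 2) \<le> (4 ^ n) powr (- 1 / 2)"
        using d2 by (intro powr_mono) auto
      also have "\<dots> = (4 powr (- 1 / 2)) ^ n"
        by (simp add: powr_realpow[symmetric] powr_powr mult.commute)
      also have "(4::real) powr (- 1 / 2) = 1/2"
        by (simp add: powr_minus_divide powr_half_sqrt)
      finally show ?thesis using t by (simp add: powr_mult mult.commute mult_left_mono)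
    qed
    then have "2 * (d + 1) * (4 ^ n * t) powr ((1 - d) / 2) * A \<le> K * (1/2) ^ n"
    proof -
      assume *: "(4 ^ n * t) powr ((1 - d) / 2) \<le> t powr ((1 - d) / 2) * (1/2) ^ n"
      have "(2 * (d + 1)) * (4 ^ n * t) powr ((1 - d) / 2) * A \<le> (2 * (d + 1)) * (t powr ((1 - d) / 2) * (1/2) ^ n) * A"
        using d2 A(1) by (intro mult_right_mono mult_left_mono *) auto
      then show ?thesis by (simp add: K_def mult_ac)
    qed
    finally show ?case using Suc by (simp add: distrib_left)
  qed simp
  have bound: "\<bar>heat t w x\<bar> \<le> \<bar>heat (4 ^ n * t) w x\<bar> + 2 * K" for n
  proof -
    have "(\<Sum>j<n. (1/2::real) ^ j) \<le> 2" by (simp add: sum_gp_strict)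
    then have "K * (\<Sum>j<n. (1/2) ^ j) \<le> K * 2" using K by (intro mult_left_mono)
    then show ?thesis using iter[of n] by linarith
  qed
  define I where "I = enn2real (\<integral>\<^sup>+x. ennreal \<bar>w x\<bar> \<partial>lborel)"
  have I: "(\<integral>\<^sup>+x. ennreal \<bar>w x\<bar> \<partial>lborel) = ennreal I" "I \<ge> 0" using fin by (auto simp: I_def)
  \<comment> \<open>The L^1 norm of \<open>w\<close> enters only qualitatively: it sends the end
    term of the telescoped sum to zero, and the limit leaves a bound in terms of A.\<close>
  have "(\<lambda>n. (4 ^ n * t) powr (- d / 2) * I + 2 * K) \<longlonglongrightarrow> 0 * I + 2 * K"
  proof (intro tendsto_intros)
    have "filterlim (\<lambda>n. 4 ^ n * t) at_top sequentially"
      using t by (intro filterlim_at_top_mult_tendsto_pos[OF tendsto_const]) (auto intro!: filterlim_at_infinity_imp_filterlim_at_top filterlim_realpow_sequentially_gt1)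
    then show "(\<lambda>n. (4 ^ n * t) powr (- d / 2)) \<longlonglongrightarrow> 0"
      using d2 by (intro tendsto_neg_powr) auto
  qed
  moreover have "\<bar>heat t w x\<bar> \<le> (4 ^ n * t) powr (- d / 2) * I + 2 * K" for n
  proof -
    have "ennreal \<bar>heat (4 ^ n * t) w x\<bar> \<le> ennreal ((4 ^ n * t) powr (- d / 2)) * ennreal I"
      unfolding d_def I(1)[symmetric] using t by (intro heat_sup_L1) auto
    then have "\<bar>heat (4 ^ n * t) w x\<bar> \<le> (4 ^ n * t) powr (- d / 2) * I"
      using I(2) by (simp add: ennreal_mult'[symmetric])
    then show ?thesis using bound[of n] by linarith
  qed
  ultimately have "\<bar>heat t w x\<bar> \<le> 0 * I + 2 * K"
    by (intro LIMSEQ_le_const) auto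
  moreover have "2 * K = 4 * (d + 1) * t powr ((1 - d) / 2) * A" by (simp add: K_def)
  ultimately show ?thesis by (simp add: d_def)
qed

text \<open>On E the value \<mu> is at most |w - P_t w| plus the sup bound of
  \<open>heat_decay\<close> for P_t w. Integration over E bounds \<mu> * m by the L^1 estimate of
  the difference plus m times the sup bound; the constant 5 is 1 from the first and 4 from the
  second.\<close>

lemma weak_sobolev:
  fixes w :: "'a::euclidean_space \<Rightarrow> real"
  assumes w [measurable]: "w \<in> borel_measurable borel" and b: "\<And>x. \<bar>w x\<bar> \<le> M"
    and fin: "(\<integral>\<^sup>+x. ennreal \<bar>w x\<bar> \<partial>lborel) < \<infinity>"
    and A: "A \<ge> 0" "\<And>h. (\<integral>\<^sup>+x. ennreal \<bar>w (x + h) - w x\<bar> \<partial>lborel) \<le> ennreal (norm h * A)"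
    and d: "DIM('a) \<ge> 2"
    and E [measurable]: "E \<in> sets borel" and m: "emeasure lborel E = ennreal m" "m > 0"
    and mu: "\<And>x. x \<in> E \<Longrightarrow> \<mu> \<le> w x" "\<mu> \<ge> 0"
  shows "\<mu> * m powr (1 - 1 / real DIM('a)) \<le> 5 * (real DIM('a) + 1) * A"
proof -
  define d where "d = real DIM('a)"
  have d2: "d \<ge> 2" using d unfolding d_def by simp
  \<comment> \<open>This time balances the two contributions: both sqrt t and m * t^((1-d)/2) become
    m^(1/d).\<close>
  define t where "t = m powr (2 / d)"
  have t: "t > 0" using m by (simp add: t_def)
  define B where "B = 4 * (d + 1) * t powr ((1 - d) / 2) * A"
  have B: "B \<ge> 0" using d2 A(1) by (simp add: B_def)
  have "ennreal (\<mu> * m) = (\<integral>\<^sup>+x. ennreal \<mu> * indicator E x \<partial>lborel)"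
    using m mu(2) by (simp add: nn_integral_cmult_indicator ennreal_mult')
  also have "\<dots> \<le> (\<integral>\<^sup>+x. ennreal \<bar>w x - heat t w x\<bar> + ennreal B * indicator E x \<partial>lborel)"
  proof (rule nn_integral_mono)
    fix x
    show "ennreal \<mu> * indicator E x \<le> ennreal \<bar>w x - heat t w x\<bar> + ennreal B * indicator E x"
    proof (cases "x \<in> E")
      case True
      have "\<bar>heat t w x\<bar> \<le> B"
        unfolding B_def d_def by (rule heat_decay[OF w b t fin A d])
      then have "\<mu> \<le> \<bar>w x - heat t w x\<bar> + B" using mu(1)[OF True] by linarith
      then show ?thesis using True B by (simp add: ennreal_plus[symmetric] ennreal_leI del: ennreal_plus)
    qed simp
  qed
  also have "\<dots> = (\<integral>\<^sup>+x. ennreal \<bar>w x - heat t w x\<bar> \<partial>lborel) + ennreal B * ennreal m"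
    using m by (subst nn_integral_add) (auto simp: nn_integral_cmult_indicator)
  also have "\<dots> \<le> ennreal ((d + 1) * sqrt t * A) + ennreal B * ennreal m"
    unfolding d_def by (intro add_right_mono heat_diff_L1[OF w b t A])
  also have "\<dots> = ennreal ((d + 1) * sqrt t * A + B * m)"
    using B m d2 A(1) t by (simp add: ennreal_mult'[symmetric] ennreal_plus[symmetric] del: ennreal_plus)
  finally have "\<mu> * m \<le> (d + 1) * sqrt t * A + B * m"
    using B m d2 A(1) t by (subst (asm) ennreal_le_iff) auto
  also have "sqrt t = m powr (1 / d)"
    using m by (simp add: t_def powr_half_sqrt[symmetric] powr_powr)
  also have "B * m = 4 * (d + 1) * m powr (1 / d) * A"
  proof -
    have "t powr ((1 - d) / 2) * m = m powr ((1 - d) / d) * m powr 1"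
    proof -
      have "2 / d * ((1 - d) / 2) = (1 - d) / d" using d2 by (simp add: divide_simps)
      then show ?thesis using m by (simp only: t_def powr_powr) simp
    qed
    also have "\<dots> = m powr ((1 - d) / d + 1)" by (rule powr_add[symmetric])
    also have "(1 - d) / d + 1 = 1 / d" using d2 by (simp add: divide_simps)
    finally show ?thesis by (simp add: B_def mult_ac)
  qed
  finally have *: "\<mu> * m \<le> 5 * (d + 1) * A * m powr (1 / d)" by (simp add: algebra_simps)
  have "\<mu> * m powr (1 - 1 / d) = \<mu> * m * m powr (- 1 / d)"
    using m by (simp add: powr_diff powr_minus_divide field_simps)
  also have "\<dots> \<le> 5 * (d + 1) * A * m powr (1 / d) * m powr (- 1 / d)"
    by (intro mult_right_mono *) auto
  also have "\<dots> = 5 * (d + 1) * A"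
    using m by (simp add: mult.assoc powr_add[symmetric])
  finally show ?thesis by (simp add: d_def)
qed

section \<open>Integral inequalities\<close>

text \<open>Hoelder's inequality with exponents p/(p-1) and p, in the shape used for testing against
  a power of f. Real upper bounds U and B replace the norms, so no \<open>ennreal\<close> roots
  occur. It is Young's inequality for f/U and g/B, integrated; B = 0 is split off because of the
  division.\<close>

lemma nn_integral_Hoelder:
  fixes f g :: "'a \<Rightarrow> real"
  assumes [measurable]: "f \<in> borel_measurable M" "g \<in> borel_measurable M"
    and nn: "\<And>x. 0 \<le> f x" "\<And>x. 0 \<le> g x" and p: "p > 1" and U: "U > 0" and B: "B \<ge> 0"
    and f: "(\<integral>\<^sup>+x. ennreal (f x powr p) \<partial>M) \<le> ennreal (U powr p)"
    and g: "(\<integral>\<^sup>+x. ennreal (g x powr p) \<partial>M) \<le> ennreal (B powr p)"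
  shows "(\<integral>\<^sup>+x. ennreal (f x powr (p - 1) * g x) \<partial>M) \<le> ennreal (U powr (p - 1) * B)"
proof (cases "B = 0")
  case True
  then have "(\<integral>\<^sup>+x. ennreal (g x powr p) \<partial>M) = 0" using g p by simp
  then have "AE x in M. ennreal (g x powr p) = 0" by (subst (asm) nn_integral_0_iff_AE) auto
  then have "AE x in M. g x = 0" 
    by eventually_elim (metis ennreal_eq_0_iff powr_gt_zero not_less)
  then have "(\<integral>\<^sup>+x. ennreal (f x powr (p - 1) * g x) \<partial>M) = (\<integral>\<^sup>+x. 0 \<partial>M)"
    by (intro nn_integral_cong_AE) auto
  then show ?thesis by simp
next
  case False
  then have B: "B > 0" using B by simp
  define c where "c = U powr (p - 1) * B"
  have c: "c > 0" using U B by (simp add: c_def)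
  \<comment> \<open>These are the coefficients of Young's inequality after undoing the normalisation
    by U and B; they satisfy a1 * U^p + a2 * B^p = c.\<close>
  define a1 a2 where "a1 = c * (1 - 1 / p) / U powr p" and "a2 = c / p / B powr p"
  have a: "a1 \<ge> 0" "a2 \<ge> 0" using c p by (auto simp: a1_def a2_def)
  have pt: "f x powr (p - 1) * g x \<le> a1 * f x powr p + a2 * g x powr p" for x
  proof -
    define a b where "a = (f x / U) powr (p - 1)" and "b = g x / B"
    have q: "p / (p - 1) > 1" "1 / (p / (p - 1)) + 1 / p = 1" using p by (auto simp: field_simps)
    have "a * b \<le> a powr (p / (p - 1)) / (p / (p - 1)) + b powr p / p"
      using q p U B nn by (intro Youngs_inequality) (auto simp: a_def b_def)
    also have "a powr (p / (p - 1)) = (f x / U) powr p"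
      using p by (simp add: a_def powr_powr)
    finally have *: "a * b \<le> (f x / U) powr p / (p / (p - 1)) + (g x / B) powr p / p"
      by (simp add: b_def)
    have "f x powr (p - 1) * g x = c * (a * b)"
      using U B nn by (simp add: a_def b_def c_def powr_divide)
    also have "\<dots> \<le> c * ((f x / U) powr p / (p / (p - 1)) + (g x / B) powr p / p)"
      using c by (intro mult_left_mono *) auto
    also have "\<dots> = a1 * f x powr p + a2 * g x powr p"
      using U B nn p by (simp add: a1_def a2_def powr_divide field_simps)
    finally show ?thesis .
  qed
  have "(\<integral>\<^sup>+x. ennreal (f x powr (p - 1) * g x) \<partial>M)
     \<le> (\<integral>\<^sup>+x. ennreal a1 * ennreal (f x powr p) + ennreal a2 * ennreal (g x powr p) \<partial>M)"
    using a by (intro nn_integral_mono) (simp add: ennreal_mult'[symmetric] ennreal_plus[symmetric] pt ennreal_leI del: ennreal_plus)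
  also have "\<dots> = ennreal a1 * (\<integral>\<^sup>+x. ennreal (f x powr p) \<partial>M) + ennreal a2 * (\<integral>\<^sup>+x. ennreal (g x powr p) \<partial>M)"
    by (simp add: nn_integral_add nn_integral_cmult)
  also have "\<dots> \<le> ennreal a1 * ennreal (U powr p) + ennreal a2 * ennreal (B powr p)"
    by (intro add_mono mult_left_mono f g) auto
  also have "\<dots> = ennreal (a1 * U powr p + a2 * B powr p)"
    using a by (simp add: ennreal_mult'[symmetric] ennreal_plus[symmetric] del: ennreal_plus)
  also have "a1 * U powr p + a2 * B powr p = c"
    using U B p by (simp add: a1_def a2_def field_simps)
  finally show ?thesis by (simp add: c_def)
qed

text \<open>The half-open interval is chosen so that, together with the one in
  \<open>nn_integral_powr_inf\<close>, it partitions the positive half-line at c.\<close>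

lemma nn_integral_powr_0:
  assumes a: "a > 0" and c: "c > 0"
  shows "(\<integral>\<^sup>+t. ennreal (t powr (a - 1)) * indicator {0<..c} t \<partial>lborel) = ennreal (c powr a / a)"
proof -
  have "((\<lambda>t. t powr (a - 1)) has_integral (c powr (a - 1 + 1) / (a - 1 + 1))) {0..c}"
    using a c by (intro has_integral_powr_from_0) auto
  then have "(\<integral>\<^sup>+t. ennreal (t powr (a - 1)) * indicator {0..c} t \<partial>lborel) = ennreal (c powr a / a)"
    by (intro nn_integral_has_integral_lebesgue') auto
  moreover have "(\<integral>\<^sup>+t. ennreal (t powr (a - 1)) * indicator {0<..c} t \<partial>lborel) = (\<integral>\<^sup>+t. ennreal (t powr (a - 1)) * indicator {0..c} t \<partial>lborel)"
    using c by (intro nn_integral_cong) (auto simp: indicator_def)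
  ultimately show ?thesis by simp
qed

lemma nn_integral_powr_inf:
  assumes b: "b > 0" and c: "c > 0"
  shows "(\<integral>\<^sup>+t. ennreal (t powr (- b - 1)) * indicator {c<..} t \<partial>lborel) = ennreal (c powr (- b) / b)"
proof -
  have "((\<lambda>t. t powr (- b - 1)) has_integral (- (c powr (- b - 1 + 1)) / (- b - 1 + 1))) {c..}"
    using b c by (intro has_integral_powr_to_inf) auto
  then have "(\<integral>\<^sup>+t. ennreal (t powr (- b - 1)) * indicator {c..} t \<partial>lborel) = ennreal (c powr (- b) / b)"
    using b by (intro nn_integral_has_integral_lebesgue') auto
  moreover have "(\<integral>\<^sup>+t. ennreal (t powr (- b - 1)) * indicator {c<..} t \<partial>lborel) = (\<integral>\<^sup>+t. ennreal (t powr (- b - 1)) * indicator {c..} t \<partial>lborel)"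
    by (intro nn_integral_cong_AE, rule AE_mp[OF AE_lborel_singleton[of c]]) (auto simp: indicator_def)
  ultimately show ?thesis by simp
qed

section \<open>Weighted heat differences\<close>

text \<open>P_t w is an average of translates of w, so a weighted bound uniform over all translates
  survives the averaging. This takes the place of Minkowski's integral inequality.\<close>

lemma nn_integral_weighted_heat_le:
  fixes w :: "'a::euclidean_space \<Rightarrow> real"
  assumes [measurable]: "w \<in> borel_measurable borel" "f \<in> borel_measurable borel"
    and t: "t > 0" and nn: "\<And>x. 0 \<le> f x"
    and N: "\<And>z. (\<integral>\<^sup>+x. ennreal (f x * \<bar>w (x + z)\<bar>) \<partial>lborel) \<le> N"
  shows "(\<integral>\<^sup>+x. ennreal (f x * \<bar>heat t w x\<bar>) \<partial>lborel) \<le> N"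
proof -
  have "(\<integral>\<^sup>+x. ennreal (f x * \<bar>heat t w x\<bar>) \<partial>lborel)
    \<le> (\<integral>\<^sup>+x. \<integral>\<^sup>+z. ennreal (gauss t z) * ennreal (f x * \<bar>w (x + z)\<bar>) \<partial>lborel \<partial>lborel)"
  proof (rule nn_integral_mono)
    fix x
    have "ennreal (f x * \<bar>heat t w x\<bar>) = ennreal (f x) * ennreal \<bar>heat t w x\<bar>"
      using nn by (simp add: ennreal_mult')
    also have "\<dots> \<le> ennreal (f x) * (\<integral>\<^sup>+z. ennreal (gauss t z) * ennreal \<bar>w (x + z)\<bar> \<partial>lborel)"
      by (intro mult_left_mono heat_abs_le_nn) auto
    also have "\<dots> = (\<integral>\<^sup>+z. ennreal (f x) * (ennreal (gauss t z) * ennreal \<bar>w (x + z)\<bar>) \<partial>lborel)"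
      by (rule nn_integral_cmult[symmetric]) measurable
    also have "\<dots> = (\<integral>\<^sup>+z. ennreal (gauss t z) * ennreal (f x * \<bar>w (x + z)\<bar>) \<partial>lborel)"
      using nn by (simp add: ennreal_mult' mult_ac)
    finally show "ennreal (f x * \<bar>heat t w x\<bar>) \<le> \<dots>" .
  qed
  also have "\<dots> = (\<integral>\<^sup>+z. \<integral>\<^sup>+x. ennreal (gauss t z) * ennreal (f x * \<bar>w (x + z)\<bar>) \<partial>lborel \<partial>lborel)"
    by (rule lborel_Tonelli) measurable
  also have "\<dots> = (\<integral>\<^sup>+z. ennreal (gauss t z) * (\<integral>\<^sup>+x. ennreal (f x * \<bar>w (x + z)\<bar>) \<partial>lborel) \<partial>lborel)"
    by (intro nn_integral_cong nn_integral_cmult) measurable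
  also have "\<dots> \<le> (\<integral>\<^sup>+z. ennreal (gauss t (z::'a)) * N \<partial>lborel)"
    by (intro nn_integral_mono mult_left_mono N) auto
  also have "\<dots> = N"
    using t by (simp add: nn_integral_multc nn_integral_gauss)
  finally show ?thesis .
qed

text \<open>Both w and P_t w take values in [0, \<Lambda>], hence g = |w - P_t w| is at most
  \<Lambda> and g^p \<le> \<Lambda>^(p-1) * g. This interpolates \<open>heat_diff_L1\<close> with
  the sup bound; Hoelder's inequality then pairs g with f^(p-1).\<close>

lemma heat_weighted_bound_small:
  fixes w :: "'a::euclidean_space \<Rightarrow> real"
  assumes w[measurable]: "w \<in> borel_measurable borel" and f[measurable]: "f \<in> borel_measurable borel"
    and t: "t > 0" and nn: "\<And>x. 0 \<le> f x" and lam: "\<And>x. 0 \<le> w x" "\<And>x. w x \<le> \<Lambda>" "\<Lambda> > 0"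
    and A: "A \<ge> 0" "\<And>h. (\<integral>\<^sup>+x. ennreal \<bar>w (x + h) - w x\<bar> \<partial>lborel) \<le> ennreal (norm h * A)"
    and p: "p > 1" and U: "U > 0" "(\<integral>\<^sup>+x. ennreal (f x powr p) \<partial>lborel) \<le> ennreal (U powr p)"
  shows "(\<integral>\<^sup>+x. ennreal (f x powr (p - 1) * \<bar>w x - heat t w x\<bar>) \<partial>lborel)
    \<le> ennreal (U powr (p - 1) * (\<Lambda> powr (1 - 1 / p) * ((real DIM('a) + 1) * sqrt t * A) powr (1 / p)))"
proof (rule nn_integral_Hoelder[OF _ _ nn _ p U(1) _ U(2)])
  define D where "D = (real DIM('a) + 1) * sqrt t * A"
  have D: "D \<ge> 0" using t A(1) by (simp add: D_def)
  have b: "\<bar>w x\<bar> \<le> \<Lambda>" for x using lam(1)[of x] lam(2)[of x] by simp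
  have g: "\<bar>w x - heat t w x\<bar> \<le> \<Lambda>" for x
    using heat_bound[OF w b t, of x] heat_nonneg[where f=w and t=t and x=x, OF lam(1)] lam(1)[of x] lam(2)[of x] by (simp add: abs_le_iff)
  have "(\<integral>\<^sup>+x. ennreal (\<bar>w x - heat t w x\<bar> powr p) \<partial>lborel) \<le> (\<integral>\<^sup>+x. ennreal (\<Lambda> powr (p - 1)) * ennreal \<bar>w x - heat t w x\<bar> \<partial>lborel)"
  proof (rule nn_integral_mono)
    fix x
    let ?g = "\<bar>w x - heat t w x\<bar>"
    have "?g powr p = ?g powr (p - 1) * ?g"
      by (cases "?g = 0") (auto simp: powr_diff)
    also have "\<dots> \<le> \<Lambda> powr (p - 1) * ?g"
      using p by (intro mult_right_mono powr_mono2 g) auto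
    finally show "ennreal (?g powr p) \<le> ennreal (\<Lambda> powr (p - 1)) * ennreal ?g"
      by (simp add: ennreal_mult'[symmetric] ennreal_leI)
  qed
  also have "\<dots> = ennreal (\<Lambda> powr (p - 1)) * (\<integral>\<^sup>+x. ennreal \<bar>w x - heat t w x\<bar> \<partial>lborel)"
    by (rule nn_integral_cmult) measurable
  also have "\<dots> \<le> ennreal (\<Lambda> powr (p - 1)) * ennreal D"
    unfolding D_def by (intro mult_left_mono heat_diff_L1[OF w b t A]) auto
  also have "\<dots> = ennreal ((\<Lambda> powr (1 - 1 / p) * D powr (1 / p)) powr p)"
  proof -
    have "(1 - 1 / p) * p = p - 1" "1 / p * p = 1" using p by (auto simp: field_simps)
    then show ?thesis using D p by (simp add: powr_mult powr_powr ennreal_mult')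
  qed
  finally show "(\<integral>\<^sup>+x. ennreal (\<bar>w x - heat t w x\<bar> powr p) \<partial>lborel)
     \<le> ennreal ((\<Lambda> powr (1 - 1 / p) * ((real DIM('a) + 1) * sqrt t * A) powr (1 / p)) powr p)"
    by (simp add: D_def)
qed auto

text \<open>For large t the cancellation in w - P_t w is given up: each of the two terms is bounded
  separately through the size \<Lambda> of w and the measure m of its support, which accounts for
  the factor 2.\<close>

lemma heat_weighted_bound_large:
  fixes w :: "'a::euclidean_space \<Rightarrow> real"
  assumes w[measurable]: "w \<in> borel_measurable borel" and f[measurable]: "f \<in> borel_measurable borel"
    and t: "t > 0" and nn: "\<And>x. 0 \<le> f x" and lam: "\<And>x. 0 \<le> w x" "\<And>x. w x \<le> \<Lambda>" "\<Lambda> > 0"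
    and D[measurable]: "D \<in> sets borel" and m: "emeasure lborel D = ennreal m" "m > 0" and wD: "\<And>x. x \<notin> D \<Longrightarrow> w x = 0"
    and p: "p > 1" and U: "U > 0" "(\<integral>\<^sup>+x. ennreal (f x powr p) \<partial>lborel) \<le> ennreal (U powr p)"
  shows "(\<integral>\<^sup>+x. ennreal (f x powr (p - 1) * \<bar>w x - heat t w x\<bar>) \<partial>lborel)
    \<le> ennreal (U powr (p - 1) * (2 * \<Lambda> * m powr (1 / p)))"
proof -
  have wp: "(\<integral>\<^sup>+x. ennreal (w (x + z) powr p) \<partial>lborel) \<le> ennreal ((\<Lambda> * m powr (1 / p)) powr p)" for z
  proof -
    have "(\<integral>\<^sup>+x. ennreal (w (x + z) powr p) \<partial>lborel) = (\<integral>\<^sup>+x. ennreal (w x powr p) \<partial>lborel)"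
      using nn_integral_translate[of "\<lambda>x. ennreal (w x powr p)" z] by (simp add: add.commute)
    also have "\<dots> \<le> (\<integral>\<^sup>+x. ennreal (\<Lambda> powr p) * indicator D x \<partial>lborel)"
    proof (rule nn_integral_mono)
      fix x show "ennreal (w x powr p) \<le> ennreal (\<Lambda> powr p) * indicator D x"
        using lam wD[of x] p by (cases "x \<in> D") (auto intro!: ennreal_leI powr_mono2)
    qed
    also have "\<dots> = ennreal (\<Lambda> powr p * m)"
      using m by (simp add: nn_integral_cmult_indicator ennreal_mult')
    also have "\<Lambda> powr p * m = (\<Lambda> * m powr (1 / p)) powr p"
      using p m lam(3) by (simp add: powr_mult powr_powr)
    finally show ?thesis .
  qed
  define N where "N = U powr (p - 1) * (\<Lambda> * m powr (1 / p))"
  have N: "N \<ge> 0" using lam(3) by (simp add: N_def)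
  have fw: "(\<integral>\<^sup>+x. ennreal (f x powr (p - 1) * \<bar>w (x + z)\<bar>) \<partial>lborel) \<le> ennreal N" for z
    unfolding N_def
    by (rule nn_integral_Hoelder[OF _ _ nn _ p U(1) _ U(2)]) (use wp[of z] lam in auto)
  have "(\<integral>\<^sup>+x. ennreal (f x powr (p - 1) * \<bar>w x - heat t w x\<bar>) \<partial>lborel)
    \<le> (\<integral>\<^sup>+x. ennreal (f x powr (p - 1) * \<bar>w x\<bar>) + ennreal (f x powr (p - 1) * \<bar>heat t w x\<bar>) \<partial>lborel)"
  proof (rule nn_integral_mono)
    fix x
    have "f x powr (p - 1) * \<bar>w x - heat t w x\<bar> \<le> f x powr (p - 1) * (\<bar>w x\<bar> + \<bar>heat t w x\<bar>)"
      by (intro mult_left_mono) auto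
    then show "ennreal (f x powr (p - 1) * \<bar>w x - heat t w x\<bar>) \<le> ennreal (f x powr (p - 1) * \<bar>w x\<bar>) + ennreal (f x powr (p - 1) * \<bar>heat t w x\<bar>)"
      by (simp add: ennreal_plus[symmetric] distrib_left ennreal_leI del: ennreal_plus)
  qed
  also have "\<dots> = (\<integral>\<^sup>+x. ennreal (f x powr (p - 1) * \<bar>w x\<bar>) \<partial>lborel) + (\<integral>\<^sup>+x. ennreal (f x powr (p - 1) * \<bar>heat t w x\<bar>) \<partial>lborel)"
    by (rule nn_integral_add) measurable
  also have "\<dots> \<le> ennreal N + ennreal N"
    using fw[of 0] by (intro add_mono nn_integral_weighted_heat_le[OF w _ t _ fw]) auto
  also have "\<dots> = ennreal (U powr (p - 1) * (2 * \<Lambda> * m powr (1 / p)))"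
    using N by (simp add: ennreal_plus[symmetric] N_def mult_ac del: ennreal_plus)
  finally show ?thesis .
qed

text \<open>The estimate for small t gains t^(1/(2p)), which beats the weight t^(-\<beta>-1) at 0
  with a margin a that stays away from zero; the estimate for large t is constant in t and
  integrates to T^(-\<beta>)/\<beta>. Thus only the tail forces the factor 1/\<beta>.\<close>

lemma heat_weighted_integral_bound:
  fixes w :: "'a::euclidean_space \<Rightarrow> real"
  assumes w[measurable]: "w \<in> borel_measurable borel" and f[measurable]: "f \<in> borel_measurable borel"
    and nn: "\<And>x. 0 \<le> f x" and lam: "\<And>x. 0 \<le> w x" "\<And>x. w x \<le> \<Lambda>" "\<Lambda> > 0"
    and A: "A \<ge> 0" "\<And>h. (\<integral>\<^sup>+x. ennreal \<bar>w (x + h) - w x\<bar> \<partial>lborel) \<le> ennreal (norm h * A)"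
    and D[measurable]: "D \<in> sets borel" and m: "emeasure lborel D = ennreal m" "m > 0" and wD: "\<And>x. x \<notin> D \<Longrightarrow> w x = 0"
    and d: "DIM('a) \<ge> 2" and be: "0 < \<beta>" "\<beta> \<le> 1/4"
    and p: "p = real DIM('a) / (real DIM('a) - 1 + 2 * \<beta>)"
    and U: "U > 0" "(\<integral>\<^sup>+x. ennreal (f x powr p) \<partial>lborel) \<le> ennreal (U powr p)"
  shows "(\<integral>\<^sup>+t. ennreal (t powr (- \<beta> - 1)) * indicator {0<..} t * (\<integral>\<^sup>+x. ennreal (f x powr (p - 1) * \<bar>w x - heat t w x\<bar>) \<partial>lborel) \<partial>lborel)
    \<le> ennreal (U powr (p - 1) * (2 * (real DIM('a) + 1) / \<beta> * (A + \<Lambda> * m powr (1 - 1 / real DIM('a)))))"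
proof -
  define d where "d = real DIM('a)"
  have d2: "d \<ge> 2" using d unfolding d_def by simp
  have p': "p = d / (d - 1 + 2 * \<beta>)" using p by (simp add: d_def)
  have p1: "p > 1" using d2 be by (simp add: p' field_simps)
  have ip: "1 / p = (d - 1 + 2 * \<beta>) / d" using d2 be by (simp add: p')
  \<comment> \<open>With this splitting time both parts depend on \<Lambda> and m only through the
    quantity Y = \<Lambda> * m^(1-1/d), which scales like A.\<close>
  define T where "T = m powr (2 / d)"
  have T: "T > 0" using m by (simp add: T_def)
  define a where "a = 1 / (2 * p) - \<beta>"
  have a_eq: "a = (d - 1) * (1 - 2 * \<beta>) / (2 * d)"
  proof -
    have "1 / (2 * p) = (1 / p) / 2" by simp
    then show ?thesis unfolding a_def ip using d2 by (simp add: field_simps)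
  qed
  \<comment> \<open>The margin is uniform: d - 1 \<ge> d/2 because d \<ge> 2, and 1 - 2\<beta> \<ge>
    1/2 because \<beta> \<le> 1/4.\<close>
  have a8: "a \<ge> 1 / 8"
  proof -
    have "(d / 2) * (1 / 2) \<le> (d - 1) * (1 - 2 * \<beta>)" using d2 be by (intro mult_mono) auto
    then show ?thesis using d2 by (simp add: a_eq field_simps)
  qed
  define Q where "Q = U powr (p - 1)"
  define c1 where "c1 = Q * (\<Lambda> powr (1 - 1 / p) * ((d + 1) * A) powr (1 / p))"
  define c2 where "c2 = Q * (2 * \<Lambda> * m powr (1 / p))"
  have c: "c1 \<ge> 0" "c2 \<ge> 0" using lam(3) by (auto simp: c1_def c2_def Q_def)
  let ?J = "\<lambda>t. \<integral>\<^sup>+x. ennreal (f x powr (p - 1) * \<bar>w x - heat t w x\<bar>) \<partial>lborel"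
  have J1: "?J t \<le> ennreal (c1 * t powr (1 / (2 * p)))" if t: "t > 0" for t
  proof -
    have "?J t \<le> ennreal (Q * (\<Lambda> powr (1 - 1 / p) * ((d + 1) * sqrt t * A) powr (1 / p)))"
      unfolding Q_def d_def by (rule heat_weighted_bound_small[OF w f t nn lam A p1 U])
    also have "((d + 1) * sqrt t * A) powr (1 / p) = ((d + 1) * A) powr (1 / p) * t powr (1 / (2 * p))"
      using t A(1) d2 by (simp add: powr_half_sqrt[symmetric] powr_mult powr_powr)
    finally show ?thesis by (simp add: c1_def mult_ac)
  qed
  have J2: "?J t \<le> ennreal c2" if t: "t > 0" for t
    unfolding c2_def Q_def by (rule heat_weighted_bound_large[OF w f t nn lam D m wD p1 U])
  have "(\<integral>\<^sup>+t. ennreal (t powr (- \<beta> - 1)) * indicator {0<..} t * ?J t \<partial>lborel)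
    \<le> (\<integral>\<^sup>+t. ennreal c1 * (ennreal (t powr (a - 1)) * indicator {0<..T} t) + ennreal c2 * (ennreal (t powr (- \<beta> - 1)) * indicator {T<..} t) \<partial>lborel)"
  proof (rule nn_integral_mono)
    fix t :: real
    consider "t \<le> 0" | "0 < t" "t \<le> T" | "T < t" by linarith
    then show "ennreal (t powr (- \<beta> - 1)) * indicator {0<..} t * ?J t \<le>
      ennreal c1 * (ennreal (t powr (a - 1)) * indicator {0<..T} t) + ennreal c2 * (ennreal (t powr (- \<beta> - 1)) * indicator {T<..} t)"
    proof cases
      case 2
      have "ennreal (t powr (- \<beta> - 1)) * ?J t \<le> ennreal (t powr (- \<beta> - 1)) * ennreal (c1 * t powr (1 / (2 * p)))"
        by (intro mult_left_mono J1 2) auto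
      also have "\<dots> = ennreal (c1 * (t powr (- \<beta> - 1) * t powr (1 / (2 * p))))"
        by (simp add: ennreal_mult'[symmetric] mult_ac)
      also have "t powr (- \<beta> - 1) * t powr (1 / (2 * p)) = t powr (- \<beta> - 1 + 1 / (2 * p))"
        by (rule powr_add[symmetric])
      also have "- \<beta> - 1 + 1 / (2 * p) = a - 1" by (simp add: a_def)
      finally show ?thesis using 2 c by (simp add: ennreal_mult')
    next
      case 3
      have "ennreal (t powr (- \<beta> - 1)) * ?J t \<le> ennreal (t powr (- \<beta> - 1)) * ennreal c2"
        using 3 T by (intro mult_left_mono J2) auto
      then show ?thesis using 3 T by (simp add: mult.commute)
    qed simp
  qed
  also have "\<dots> = ennreal c1 * ennreal (T powr a / a) + ennreal c2 * ennreal (T powr (- \<beta>) / \<beta>)"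
  proof -
    have "a > 0" using a8 by simp
    then show ?thesis
      using T be by (subst nn_integral_add) (auto simp: nn_integral_cmult nn_integral_powr_0 nn_integral_powr_inf)
  qed
  also have "\<dots> = ennreal (c1 * (T powr a / a) + c2 * (T powr (- \<beta>) / \<beta>))"
    using c a8 be by (simp add: ennreal_mult'[symmetric] ennreal_plus[symmetric] del: ennreal_plus)
  also have "\<dots> \<le> ennreal (Q * (2 * (d + 1) / \<beta> * (A + \<Lambda> * m powr (1 - 1 / d))))"
  proof (rule ennreal_leI)
    define Y where "Y = \<Lambda> * m powr (1 - 1 / d)"
    have Y: "Y > 0" using lam(3) m by (simp add: Y_def)
    define X where "X = (d + 1) * A"
    have X: "X \<ge> 0" using A(1) d2 by (simp add: X_def)
    have e1: "1 - 1 / p = (1 - 2 * \<beta>) / d" using d2 by (simp add: ip field_simps)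
    have "T powr a = (m powr (1 - 1 / d)) powr (1 - 1 / p)"
    proof -
      have "2 / d * a = (1 - 1 / d) * (1 - 1 / p)"
        unfolding e1 a_eq using d2 by (simp add: field_simps)
      then show ?thesis by (simp add: T_def powr_powr)
    qed
    then have "c1 * T powr a = Q * (Y powr (1 - 1 / p) * X powr (1 / p))"
      using lam(3) by (simp add: c1_def Y_def X_def powr_mult mult_ac)
    also have "\<dots> \<le> Q * (X + Y)"
    proof (rule mult_left_mono)
      \<comment> \<open>The two exponents add up to 1, so replacing both bases by X + Y turns the
        geometric mean into X + Y.\<close>
      have "Y powr (1 - 1 / p) * X powr (1 / p) \<le> (X + Y) powr (1 - 1 / p) * (X + Y) powr (1 / p)"
        using X Y p1 by (intro mult_mono powr_mono2) auto
      also have "\<dots> = X + Y" using X Y by (simp add: powr_add[symmetric])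
      finally show "Y powr (1 - 1 / p) * X powr (1 / p) \<le> X + Y" .
    qed (simp add: Q_def)
    finally have *: "c1 * T powr a \<le> Q * (X + Y)" .
    \<comment> \<open>The first part has no factor 1/\<beta>; since \<beta> \<le> 1/4, its constant
      8 is absorbed into 2/\<beta> to give both parts the same form.\<close>
    have ia: "1 / a \<le> 2 / \<beta>"
    proof -
      have "1 / a \<le> 8" using a8 by (simp add: field_simps)
      also have "8 \<le> 2 / \<beta>" using be by (simp add: field_simps)
      finally show ?thesis .
    qed
    have "c1 * (T powr a / a) = (c1 * T powr a) * (1 / a)" by simp
    also have "\<dots> \<le> (Q * (X + Y)) * (2 / \<beta>)"
      using X Y a8 be by (intro mult_mono * ia) (auto simp: Q_def)
    finally have 1: "c1 * (T powr a / a) \<le> (Q * (X + Y)) * (2 / \<beta>)" .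
    have "m powr (1 / p) * T powr (- \<beta>) = m powr (1 / p + 2 / d * (- \<beta>))"
      by (simp add: T_def powr_powr powr_add[symmetric])
    also have "1 / p + 2 / d * (- \<beta>) = 1 - 1 / d"
      unfolding ip using d2 by (simp add: field_simps)
    finally have 2: "c2 * (T powr (- \<beta>) / \<beta>) = Q * Y * (2 / \<beta>)"
      by (simp add: c2_def Y_def)
    have "c1 * (T powr a / a) + c2 * (T powr (- \<beta>) / \<beta>) \<le> Q * (2 / \<beta>) * (X + 2 * Y)"
    proof -
      have "c1 * (T powr a / a) + c2 * (T powr (- \<beta>) / \<beta>) \<le> (Q * (X + Y)) * (2 / \<beta>) + Q * Y * (2 / \<beta>)"
        using 1 2 by linarith
      also have "\<dots> = Q * (2 / \<beta>) * (X + 2 * Y)" by (simp only: ring_distribs mult_ac) simp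
      finally show ?thesis .
    qed
    also have "\<dots> \<le> Q * (2 / \<beta>) * ((d + 1) * (A + Y))"
    proof (rule mult_left_mono)
      have "2 * Y \<le> (d + 1) * Y" using d2 Y by (intro mult_right_mono) auto
      then show "X + 2 * Y \<le> (d + 1) * (A + Y)" by (simp add: X_def algebra_simps)
    qed (use be in \<open>simp add: Q_def\<close>)
    also have "\<dots> = Q * (2 * (d + 1) / \<beta> * (A + Y))" by simp
    finally show "c1 * (T powr a / a) + c2 * (T powr (- \<beta>) / \<beta>) \<le> Q * (2 * (d + 1) / \<beta> * (A + \<Lambda> * m powr (1 - 1 / d)))"
      unfolding Y_def .
  qed
  finally show ?thesis by (simp add: Q_def d_def)
qed

section \<open>Dyadic layers\<close>

text \<open>The layer at level \<open>a\<close> is a continuously differentiable truncation: constant outside \<open>[a, 4a]\<close>, with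
  derivatives at the levels \<open>a = \<epsilon> 2\<^sup>j\<close> forming a partition of unity on the positive half-line.\<close>

definition trunc_prim :: "real \<Rightarrow> real" where
  "trunc_prim t = ((max 0 (t - 1))\<^sup>2 - (max 0 (t - 2))\<^sup>2) / 2"

definition trunc_cut :: "real \<Rightarrow> real" where
  "trunc_cut t = max 0 (t - 1) - max 0 (t - 2)"

text \<open>The function a * \<open>trunc_prim\<close> (t / a) is the positive part of t smoothed at
  scale a; a layer is the difference of two such functions at consecutive dyadic scales, so sums of
  layers telescope. Continuous differentiability gives the chain rule for layers of v at every
  point, without exceptional level sets.\<close>

definition layer :: "real \<Rightarrow> real \<Rightarrow> real" where
  "layer a t = a * trunc_prim (t / a) - 2 * a * trunc_prim (t / (2 * a))"

definition layer_deriv :: "real \<Rightarrow> real \<Rightarrow> real" where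
  "layer_deriv a t = trunc_cut (t / a) - trunc_cut (t / (2 * a))"

lemma DERIV_max_0_sq: "((\<lambda>t. (max 0 t)\<^sup>2) has_real_derivative 2 * max 0 t) (at t)"
proof -
  consider "t < 0" | "t > 0" | "t = 0" by linarith
  then show ?thesis
  proof cases
    case 1
    have "((\<lambda>t. 0::real) has_real_derivative 0) (at t)" by simp
    then have "((\<lambda>t. (max 0 t)\<^sup>2) has_real_derivative 0) (at t)"
      by (rule has_field_derivative_transform_within_open[of _ _ _ "{..<0}"]) (use 1 in auto)
    then show ?thesis using 1 by simp
  next
    case 2
    have "((\<lambda>t::real. t\<^sup>2) has_real_derivative 2 * t) (at t)" by (auto intro!: derivative_eq_intros)
    then have "((\<lambda>t. (max 0 t)\<^sup>2) has_real_derivative 2 * t) (at t)"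
      by (rule has_field_derivative_transform_within_open[of _ _ _ "{0<..}"]) (use 2 in auto)
    then show ?thesis using 2 by simp
  next
    case 3
    have "isCont (\<lambda>z::real. max 0 z) 0" by (intro continuous_intros)
    \<comment> \<open>At the kink \<open>max 0 z\<close> is itself a Caratheodory slope, since (max
      0 z)^2 = max 0 z * z.\<close>
    then have "\<exists>g. (\<forall>z. (max 0 z)\<^sup>2 - (max 0 0)\<^sup>2 = g z * (z - 0)) \<and> isCont g 0 \<and> g 0 = (0::real)"
      by (intro exI[of _ "\<lambda>z. max 0 z"]) (auto simp: max_def power2_eq_square)
    then show ?thesis unfolding 3 by (simp add: CARAT_DERIV)
  qed
qed

lemma DERIV_trunc_prim:
  "(trunc_prim has_real_derivative trunc_cut t) (at t)"
proof -
  have sh: "((\<lambda>t. (max 0 (t - c))\<^sup>2) has_real_derivative 2 * max 0 (t - c)) (at t)" for c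
    using DERIV_max_0_sq[of "t - c"] DERIV_shift[of "\<lambda>t. (max 0 t)\<^sup>2" _ t "- c"] by simp
  have "((\<lambda>t. ((max 0 (t - 1))\<^sup>2 - (max 0 (t - 2))\<^sup>2) / 2) has_real_derivative
     (2 * max 0 (t - 1) - 2 * max 0 (t - 2)) / 2) (at t)"
    by (rule DERIV_cdivide[OF DERIV_diff[OF sh sh]])
  moreover have "(2 * max 0 (t - 1) - 2 * max 0 (t - 2)) / 2 = max 0 (t - 1) - max 0 (t - 2)" by simp
  ultimately show ?thesis unfolding trunc_prim_def[abs_def] trunc_cut_def by (simp only:)
qed

lemma DERIV_layer:
  assumes "a > 0"
  shows "(layer a has_real_derivative layer_deriv a t) (at t)"
proof -
  have "((\<lambda>t. a * trunc_prim (t / a) - 2 * a * trunc_prim (t / (2 * a))) has_real_derivative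
     a * (trunc_cut (t / a) * (1 / a)) - 2 * a * (trunc_cut (t / (2 * a)) * (1 / (2 * a)))) (at t)"
    by (intro DERIV_diff DERIV_cmult DERIV_chain'[where g=trunc_prim, OF _ DERIV_trunc_prim] DERIV_cdivide DERIV_ident)
  then show ?thesis using assms by (simp add: layer_def[abs_def] layer_deriv_def)
qed

lemma layer_deriv_cont: "continuous_on UNIV (layer_deriv a)"
  unfolding layer_deriv_def trunc_cut_def by (cases "a = 0") (auto intro!: continuous_intros)

lemma layer_cont: "continuous_on UNIV (layer a)"
  unfolding layer_def trunc_prim_def by (cases "a = 0") (auto intro!: continuous_intros)

lemma layer_measurable [measurable]: "layer a \<in> borel_measurable borel"
  by (rule borel_measurable_continuous_onI[OF layer_cont])

lemma layer_deriv_measurable [measurable]: "layer_deriv a \<in> borel_measurable borel"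
  by (rule borel_measurable_continuous_onI[OF layer_deriv_cont])

section \<open>Bounds, plateau and telescoping of the layers\<close>

lemma trunc_prim_eq:
  "trunc_prim t = (if t \<le> 1 then 0 else if t \<le> 2 then (t - 1)\<^sup>2 / 2 else t - 3/2)"
  by (auto simp: trunc_prim_def max_def power2_eq_square field_simps)

lemma trunc_prim_diff_bounds:
  "0 \<le> trunc_prim r - 2 * trunc_prim (r / 2)" "trunc_prim r - 2 * trunc_prim (r / 2) \<le> 3/2"
proof -
  consider "r \<le> 1" | "1 < r" "r \<le> 2" | "2 < r" "r \<le> 4" | "4 < r" by linarith
  then have "0 \<le> trunc_prim r - 2 * trunc_prim (r / 2) \<and> trunc_prim r - 2 * trunc_prim (r / 2) \<le> 3/2"
  proof cases
    case 2
    have "(r - 1)\<^sup>2 \<le> 1\<^sup>2" using 2 by (intro power_mono) auto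
    then show ?thesis using 2 by (simp add: trunc_prim_eq)
  next
    case 3
    \<comment> \<open>Completing the square shows both bounds at once: on this range the subtracted
      term lies between 0 and 1.\<close>
    have "trunc_prim r - 2 * trunc_prim (r / 2) = 3/2 - (4 - r)\<^sup>2 / 4"
      using 3 by (simp add: trunc_prim_eq power2_eq_square field_simps)
    moreover have "(4 - r)\<^sup>2 \<le> 2\<^sup>2" using 3 by (intro power_mono) auto
    ultimately show ?thesis by simp
  qed (auto simp: trunc_prim_eq)
  then show "0 \<le> trunc_prim r - 2 * trunc_prim (r / 2)" "trunc_prim r - 2 * trunc_prim (r / 2) \<le> 3/2" by auto
qed

lemma layer_scaled: "layer a t = a * (trunc_prim (t / a) - 2 * trunc_prim (t / a / 2))"
  by (simp add: layer_def algebra_simps)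

lemma layer_nonneg: "a > 0 \<Longrightarrow> 0 \<le> layer a t"
  using trunc_prim_diff_bounds(1)[of "t / a"] by (simp add: layer_scaled)

lemma layer_le: "a > 0 \<Longrightarrow> layer a t \<le> 3/2 * a"
  using trunc_prim_diff_bounds(2)[of "t / a"] mult_left_mono[of _ _ a] by (fastforce simp: layer_scaled)

lemma layer_eq_0: "a > 0 \<Longrightarrow> t \<le> a \<Longrightarrow> layer a t = 0"
  by (simp add: layer_def trunc_prim_eq field_simps)

text \<open>Since the plateau begins at 4 * a, the layer at level a/4 has its full height wherever v
  > a. This fixes the shift by two dyadic levels in \<open>layer_level_bound\<close>.\<close>

lemma layer_top: "a > 0 \<Longrightarrow> 4 * a \<le> t \<Longrightarrow> layer a t = 3/2 * a"
  by (auto simp: layer_def trunc_prim_eq field_simps)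

lemma trunc_cut_bounds: "0 \<le> trunc_cut t" "trunc_cut t \<le> 1"
  by (auto simp: trunc_cut_def max_def)

lemma layer_deriv_nonneg: "a > 0 \<Longrightarrow> 0 \<le> layer_deriv a t"
proof -
  assume a: "a > 0"
  have "trunc_cut (r / 2) \<le> trunc_cut r" for r by (auto simp: trunc_cut_def max_def field_simps)
  from this[of "t / a"] show ?thesis by (simp add: layer_deriv_def mult.commute)
qed

lemma layer_deriv_le: "layer_deriv a t \<le> 1"
  using trunc_cut_bounds[of "t / a"] trunc_cut_bounds[of "t / (2 * a)"] by (simp add: layer_deriv_def)

lemma sum_layer:
  "(\<Sum>j<J. layer (e * 2 ^ j) t) = e * trunc_prim (t / e) - e * 2 ^ J * trunc_prim (t / (e * 2 ^ J))"
  by (induction J) (auto simp: layer_def algebra_simps)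

text \<open>The sum telescopes to a difference of two cuts with values in [0, 1]. This is the
  quantitative form of the gradients of the layers being essentially disjoint.\<close>

lemma sum_layer_deriv_le: "(\<Sum>j<J. layer_deriv (e * 2 ^ j) t) \<le> 1"
proof -
  have "(\<Sum>j<J. layer_deriv (e * 2 ^ j) t) = trunc_cut (t / e) - trunc_cut (t / (e * 2 ^ J))"
    by (induction J) (auto simp: layer_deriv_def algebra_simps)
  then show ?thesis using trunc_cut_bounds[of "t / e"] trunc_cut_bounds[of "t / (e * 2 ^ J)"] by linarith
qed

text \<open>The upper bound makes the partial sums of layers of v uniformly bounded by a bound of v,
  as \<open>heat_energy_Fatou\<close> requires.\<close>

lemma sum_layer_bounds:
  assumes "e > 0"
  shows "0 \<le> (\<Sum>j<J. layer (e * 2 ^ j) t)" "(\<Sum>j<J. layer (e * 2 ^ j) t) \<le> \<bar>t\<bar>"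
proof -
  show "0 \<le> (\<Sum>j<J. layer (e * 2 ^ j) t)" using assms by (intro sum_nonneg layer_nonneg) auto
  have p: "0 \<le> trunc_prim r" "trunc_prim r \<le> \<bar>r\<bar>" for r
  proof -
    show "0 \<le> trunc_prim r" by (auto simp: trunc_prim_eq)
    have "r > 1 \<Longrightarrow> r \<le> 2 \<Longrightarrow> (r - 1)\<^sup>2 \<le> 1\<^sup>2" by (intro power_mono) auto
    then show "trunc_prim r \<le> \<bar>r\<bar>" by (auto simp: trunc_prim_eq)
  qed
  have "e * trunc_prim (t / e) \<le> e * \<bar>t / e\<bar>" using assms by (intro mult_left_mono p) auto
  also have "\<dots> = \<bar>t\<bar>" using assms by simp
  finally have "e * trunc_prim (t / e) \<le> \<bar>t\<bar>" .
  moreover have "0 \<le> e * 2 ^ J * trunc_prim (t / (e * 2 ^ J))" using assms p by (intro mult_nonneg_nonneg) auto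
  ultimately show "(\<Sum>j<J. layer (e * 2 ^ j) t) \<le> \<bar>t\<bar>" unfolding sum_layer by linarith
qed

text \<open>The sum over levels starting at 2^(-N) collapses to two smoothed positive parts. The one
  at scale 2^(-N) differs from \<open>max 0 t\<close> by at most 3/2 * 2^(-N); the one at scale 2^N
  vanishes as soon as 2^N \<ge> t.\<close>

lemma sum_layer_tendsto:
  "(\<lambda>N. \<Sum>j<2 * N. layer ((1/2) ^ N * 2 ^ j) t) \<longlonglongrightarrow> max 0 t"
proof -
  have e: "(1/2::real) ^ N * 2 ^ (2 * N) = 2 ^ N" for N
  proof -
    have "(1/2::real) ^ N * 2 ^ (2 * N) = ((1/2) ^ N * 2 ^ N) * 2 ^ N"
      by (simp only: mult_2 power_add mult.assoc)
    also have "(1/2::real) ^ N * 2 ^ N = 1"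
      by (simp only: power_mult_distrib[symmetric]) simp
    finally show ?thesis by simp
  qed
  have "(\<lambda>N. (1/2) ^ N * trunc_prim (t / (1/2) ^ N)) \<longlonglongrightarrow> max 0 t"
  proof (rule Lim_transform)
    show "(\<lambda>N::nat. max 0 t) \<longlonglongrightarrow> max 0 t" by simp
    have b: "\<bar>trunc_prim r - max 0 r\<bar> \<le> 3/2" for r
    proof -
      consider "r \<le> 1" | "1 < r" "r \<le> 2" | "2 < r" by linarith
      then show ?thesis
      proof cases
        case 2
        have "(2 - r)\<^sup>2 \<le> 1" "0 \<le> (2 - r)\<^sup>2" using 2 power_mono[of "2 - r" 1 2] by auto
        moreover have "trunc_prim r - max 0 r = (2 - r)\<^sup>2 / 2 - 3/2"
          using 2 by (simp add: trunc_prim_eq power2_eq_square field_simps)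
        ultimately show ?thesis by simp
      qed (auto simp: trunc_prim_eq max_def)
    qed
    have approx: "norm (e * trunc_prim (t / e) - max 0 t) \<le> 3/2 * e" if e: "e > 0" for e
    proof -
      have "max 0 (t / e) = max 0 t / e" using e by (auto simp: max_def field_simps)
      then have "e * trunc_prim (t / e) - max 0 t = e * (trunc_prim (t / e) - max 0 (t / e))"
        using e by (simp add: right_diff_distrib)
      then have "norm (e * trunc_prim (t / e) - max 0 t) = e * \<bar>trunc_prim (t / e) - max 0 (t / e)\<bar>"
        using e by (simp only: real_norm_def abs_mult abs_of_pos)
      also have "\<dots> \<le> e * (3/2)" using e by (intro mult_left_mono b) auto
      finally show ?thesis by (simp add: mult.commute)
    qed
    have "norm ((1/2) ^ N * trunc_prim (t / (1/2) ^ N) - max 0 t) \<le> 3/2 * (1/2) ^ N" for N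
      by (rule approx) simp
    then have ev: "\<forall>\<^sub>F N in sequentially. norm ((1/2) ^ N * trunc_prim (t / (1/2) ^ N) - max 0 t) \<le> 3/2 * (1/2) ^ N"
      by (rule always_eventually[OF allI])
    have "(\<lambda>N. (1/2::real) ^ N) \<longlonglongrightarrow> 0" by (rule LIMSEQ_power_zero) simp
    then have "(\<lambda>N. 3/2 * (1/2::real) ^ N) \<longlonglongrightarrow> 0" by (rule tendsto_mult_right_zero)
    with ev show "(\<lambda>N. (1/2) ^ N * trunc_prim (t / (1/2) ^ N) - max 0 t) \<longlonglongrightarrow> 0"
      by (rule Lim_null_comparison)
  qed
  moreover have "(\<lambda>N. 2 ^ N * trunc_prim (t / 2 ^ N)) \<longlonglongrightarrow> 0"
  proof (rule tendsto_eventually)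
    obtain N0 where N0: "t < 2 ^ N0" using real_arch_pow[of 2 t] by auto
    have "2 ^ N * trunc_prim (t / 2 ^ N) = 0" if "N \<ge> N0" for N
    proof -
      have "t < 2 ^ N" using N0 that power_increasing[OF that, of "2::real"] by linarith
      then have "t / 2 ^ N \<le> 1" by (simp add: divide_le_eq)
      then show ?thesis by (simp only: trunc_prim_eq if_True mult_zero_right)
    qed
    then show "\<forall>\<^sub>F N in sequentially. 2 ^ N * trunc_prim (t / 2 ^ N) = 0"
      unfolding eventually_sequentially by blast
  qed
  ultimately have "(\<lambda>N. (1/2) ^ N * trunc_prim (t / (1/2) ^ N) - 2 ^ N * trunc_prim (t / 2 ^ N)) \<longlonglongrightarrow> max 0 t - 0"
    by (rule tendsto_diff)
  then show ?thesis by (simp only: sum_layer e diff_zero)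
qed

text \<open>The layer of v is continuously differentiable with gradient
  \<open>layer_deriv a (v x)\<close> times V x. The increment is the integral of this gradient along
  the segment from x to x + h; after Tonelli, translation invariance makes every point of the
  segment contribute the same amount.\<close>

lemma layer_translation_L1:
  fixes v :: "'a::euclidean_space \<Rightarrow> real"
  assumes v: "\<And>x. (v has_derivative (\<lambda>h. V x \<bullet> h)) (at x)" and V: "continuous_on UNIV V" and a: "a > 0"
  shows "(\<integral>\<^sup>+x. ennreal \<bar>layer a (v (x + h)) - layer a (v x)\<bar> \<partial>lborel)
    \<le> ennreal (norm h) * (\<integral>\<^sup>+x. ennreal (layer_deriv a (v x) * norm (V x)) \<partial>lborel)"
proof -
  have vc: "continuous_on UNIV v"
    using v by (intro continuous_at_imp_continuous_on) (auto dest: has_derivative_continuous)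
  have [measurable]: "v \<in> borel_measurable borel" "V \<in> borel_measurable borel"
    using vc V by (auto intro: borel_measurable_continuous_onI)
  have "ennreal \<bar>layer a (v (x + h)) - layer a (v x)\<bar>
     \<le> (\<integral>\<^sup>+s. ennreal (norm h) * (indicator {0..1} s * ennreal (layer_deriv a (v (x + s *\<^sub>R h)) * norm (V (x + s *\<^sub>R h)))) \<partial>lborel)" for x
  proof -
    let ?g = "\<lambda>s. layer_deriv a (v (x + s *\<^sub>R h)) * (V (x + s *\<^sub>R h) \<bullet> h)"
    have gc: "continuous_on {0..1} ?g"
      by (intro continuous_intros continuous_on_compose2[OF layer_deriv_cont] continuous_on_compose2[OF vc]
            continuous_on_compose2[OF V]) auto
    have "(\<integral>s. indicator {0..1} s *\<^sub>R ?g s \<partial>lborel) = layer a (v (x + 1 *\<^sub>R h)) - layer a (v (x + 0 *\<^sub>R h))"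
    proof (rule integral_FTC_atLeastAtMost)
      fix s :: real
      have "((\<lambda>s. x + s *\<^sub>R h) has_derivative (\<lambda>s. s *\<^sub>R h)) (at s)"
        by (auto intro!: derivative_eq_intros)
      from has_derivative_compose[OF this v] 
      have "((\<lambda>s. v (x + s *\<^sub>R h)) has_real_derivative (V (x + s *\<^sub>R h) \<bullet> h)) (at s)"
        by (simp add: has_field_derivative_def mult.commute[of _ "_ \<bullet> _"] fun_eq_iff)
      from DERIV_chain'[OF this DERIV_layer[OF a]]
      have "((\<lambda>s. layer a (v (x + s *\<^sub>R h))) has_real_derivative ?g s) (at s)" by simp
      then show "((\<lambda>s. layer a (v (x + s *\<^sub>R h))) has_vector_derivative ?g s) (at s within {0..1})"
        by (simp add: has_real_derivative_iff_has_vector_derivative has_vector_derivative_at_within)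
    qed (use gc in auto)
    then have "ennreal \<bar>layer a (v (x + h)) - layer a (v x)\<bar> = ennreal (norm (\<integral>s. indicator {0..1} s *\<^sub>R ?g s \<partial>lborel))"
      by simp
    also have "\<dots> \<le> (\<integral>\<^sup>+s. ennreal (norm (indicator {0..1} s *\<^sub>R ?g s)) \<partial>lborel)"
      by (rule integral_norm_bound_ennreal) (use borel_integrable_atLeastAtMost'[OF gc] in \<open>simp add: set_integrable_def\<close>)
    also have "\<dots> \<le> (\<integral>\<^sup>+s. ennreal (norm h) * (indicator {0..1} s * ennreal (layer_deriv a (v (x + s *\<^sub>R h)) * norm (V (x + s *\<^sub>R h)))) \<partial>lborel)"
    proof (rule nn_integral_mono)
      fix s :: real
      have "norm (?g s) \<le> norm h * (layer_deriv a (v (x + s *\<^sub>R h)) * norm (V (x + s *\<^sub>R h)))"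
        using layer_deriv_nonneg[OF a] Cauchy_Schwarz_ineq2[of "V (x + s *\<^sub>R h)" h]
        by (simp add: abs_mult mult.left_commute[of "norm h"] mult.commute[of "norm h"] mult.assoc mult_left_mono)
      then show "ennreal (norm (indicator {0..1} s *\<^sub>R ?g s)) \<le> ennreal (norm h) * (indicator {0..1} s * ennreal (layer_deriv a (v (x + s *\<^sub>R h)) * norm (V (x + s *\<^sub>R h))))"
        by (auto simp: indicator_def ennreal_mult'[symmetric] intro!: ennreal_leI)
    qed
    finally show ?thesis .
  qed
  then have "(\<integral>\<^sup>+x. ennreal \<bar>layer a (v (x + h)) - layer a (v x)\<bar> \<partial>lborel)
     \<le> (\<integral>\<^sup>+x. \<integral>\<^sup>+s. ennreal (norm h) * (indicator {0..1} s * ennreal (layer_deriv a (v (x + s *\<^sub>R h)) * norm (V (x + s *\<^sub>R h)))) \<partial>lborel \<partial>lborel)"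
    by (intro nn_integral_mono)
  also have "\<dots> = (\<integral>\<^sup>+s. \<integral>\<^sup>+x. ennreal (norm h) * (indicator {0..1} s * ennreal (layer_deriv a (v (x + s *\<^sub>R h)) * norm (V (x + s *\<^sub>R h)))) \<partial>lborel \<partial>lborel)"
    by (rule lborel_Tonelli) measurable
  also have "\<dots> = (\<integral>\<^sup>+(s::real). ennreal (norm h) * (indicator {0..1} s * (\<integral>\<^sup>+x. ennreal (layer_deriv a (v x) * norm (V x)) \<partial>lborel)) \<partial>lborel)"
  proof (rule nn_integral_cong)
    fix s :: real
    have "(\<integral>\<^sup>+x. ennreal (layer_deriv a (v (x + s *\<^sub>R h)) * norm (V (x + s *\<^sub>R h))) \<partial>lborel) = (\<integral>\<^sup>+x. ennreal (layer_deriv a (v x) * norm (V x)) \<partial>lborel)"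
      using nn_integral_translate[of "\<lambda>x. ennreal (layer_deriv a (v x) * norm (V x))" "s *\<^sub>R h"] by (simp add: add.commute)
    then show "(\<integral>\<^sup>+x. ennreal (norm h) * (indicator {0..1} s * ennreal (layer_deriv a (v (x + s *\<^sub>R h)) * norm (V (x + s *\<^sub>R h)))) \<partial>lborel) = ennreal (norm h) * (indicator {0..1} s * (\<integral>\<^sup>+x. ennreal (layer_deriv a (v x) * norm (V x)) \<partial>lborel))"
      by (simp add: nn_integral_cmult)
  qed
  also have "\<dots> = ennreal (norm h) * (\<integral>\<^sup>+x. ennreal (layer_deriv a (v x) * norm (V x)) \<partial>lborel)"
    by (simp add: nn_integral_cmult nn_integral_multc)
  finally show ?thesis .
qed

section \<open>Energy of the layers\<close>

text \<open>A pairing of the weight F, later a power of |u|, with the heat differences of w. Taking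
  absolute values inside makes it subadditive in w and lower semicontinuous under bounded pointwise
  convergence.\<close>

definition heat_energy :: "real \<Rightarrow> ('a::euclidean_space \<Rightarrow> real) \<Rightarrow> ('a \<Rightarrow> real) \<Rightarrow> ennreal" where
  "heat_energy \<beta> F w = (\<integral>\<^sup>+t. ennreal (t powr (- \<beta> - 1)) * indicator {0<..} t *
     (\<integral>\<^sup>+x. ennreal (F x * \<bar>w x - heat t w x\<bar>) \<partial>lborel) \<partial>lborel)"

lemma heat_energy_sum_le:
  assumes I: "finite I" and [measurable]: "F \<in> borel_measurable borel" and wm: "\<And>i. i \<in> I \<Longrightarrow> w i \<in> borel_measurable borel"
    and b: "\<And>i x. i \<in> I \<Longrightarrow> \<bar>w i x\<bar> \<le> M i" and F: "\<And>x. 0 \<le> F x"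
  shows "heat_energy \<beta> F (\<lambda>x. \<Sum>i\<in>I. w i x) \<le> (\<Sum>i\<in>I. heat_energy \<beta> F (w i))"
proof -
  have "heat_energy \<beta> F (\<lambda>x. \<Sum>i\<in>I. w i x) \<le> (\<integral>\<^sup>+t. (\<Sum>i\<in>I. ennreal (t powr (- \<beta> - 1)) * indicator {0<..} t *
     (\<integral>\<^sup>+x. ennreal (F x * \<bar>w i x - heat t (w i) x\<bar>) \<partial>lborel)) \<partial>lborel)"
    unfolding heat_energy_def
  proof (rule nn_integral_mono)
    fix t :: real
    show "ennreal (t powr (- \<beta> - 1)) * indicator {0<..} t *
         (\<integral>\<^sup>+ x. ennreal (F x * \<bar>(\<Sum>i\<in>I. w i x) - heat t (\<lambda>x. \<Sum>i\<in>I. w i x) x\<bar>) \<partial>lborel)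
         \<le> (\<Sum>i\<in>I. ennreal (t powr (- \<beta> - 1)) * indicator {0<..} t * (\<integral>\<^sup>+ x. ennreal (F x * \<bar>w i x - heat t (w i) x\<bar>) \<partial>lborel))"
    proof (cases "t > 0")
      case True
      have "(\<integral>\<^sup>+ x. ennreal (F x * \<bar>(\<Sum>i\<in>I. w i x) - heat t (\<lambda>x. \<Sum>i\<in>I. w i x) x\<bar>) \<partial>lborel)
        \<le> (\<integral>\<^sup>+ x. (\<Sum>i\<in>I. ennreal (F x * \<bar>w i x - heat t (w i) x\<bar>)) \<partial>lborel)"
      proof (rule nn_integral_mono)
        fix x
        have "\<bar>(\<Sum>i\<in>I. w i x) - heat t (\<lambda>x. \<Sum>i\<in>I. w i x) x\<bar> = \<bar>\<Sum>i\<in>I. w i x - heat t (w i) x\<bar>"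
          using heat_sum[of I w M t x, OF wm b True] by (simp add: sum_subtractf)
        also have "\<dots> \<le> (\<Sum>i\<in>I. \<bar>w i x - heat t (w i) x\<bar>)" by (rule sum_abs)
        finally have "F x * \<bar>(\<Sum>i\<in>I. w i x) - heat t (\<lambda>x. \<Sum>i\<in>I. w i x) x\<bar> \<le> (\<Sum>i\<in>I. F x * \<bar>w i x - heat t (w i) x\<bar>)"
          using F by (simp add: sum_distrib_left[symmetric] mult_left_mono)
        then show "ennreal (F x * \<bar>(\<Sum>i\<in>I. w i x) - heat t (\<lambda>x. \<Sum>i\<in>I. w i x) x\<bar>) \<le> (\<Sum>i\<in>I. ennreal (F x * \<bar>w i x - heat t (w i) x\<bar>))"
          using F by (subst sum_ennreal) (auto intro: ennreal_leI)
      qed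
      also have "\<dots> = (\<Sum>i\<in>I. \<integral>\<^sup>+ x. ennreal (F x * \<bar>w i x - heat t (w i) x\<bar>) \<partial>lborel)"
      proof (rule nn_integral_sum)
        fix i assume "i \<in> I"
        then have [measurable]: "w i \<in> borel_measurable borel" by (rule wm)
        show "(\<lambda>x. ennreal (F x * \<bar>w i x - heat t (w i) x\<bar>)) \<in> borel_measurable lborel" by measurable
      qed
      finally show ?thesis using True by (simp add: sum_distrib_left[symmetric] mult_left_mono)
    qed simp
  qed
  also have "\<dots> = (\<Sum>i\<in>I. heat_energy \<beta> F (w i))"
    unfolding heat_energy_def
  proof (rule nn_integral_sum)
    fix i assume "i \<in> I"
    then have [measurable]: "w i \<in> borel_measurable borel" by (rule wm)
    show "(\<lambda>t. ennreal (t powr (- \<beta> - 1)) * indicator {0<..} t *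
       (\<integral>\<^sup>+x. ennreal (F x * \<bar>w i x - heat t (w i) x\<bar>) \<partial>lborel)) \<in> borel_measurable lborel" by measurable
  qed
  finally show ?thesis .
qed

lemma heat_energy_minus: "heat_energy \<beta> F (\<lambda>x. - w x) = heat_energy \<beta> F w"
  by (simp add: heat_energy_def heat_minus abs_minus_commute)

text \<open>Dominated convergence with the Gaussian as majorant carries the pointwise limit through
  P_t; Fatou's lemma is then applied in x and again in t.\<close>

lemma heat_energy_Fatou:
  fixes w :: "nat \<Rightarrow> 'a::euclidean_space \<Rightarrow> real"
  assumes F[measurable]: "F \<in> borel_measurable borel" and wm[measurable]: "\<And>n. w n \<in> borel_measurable borel"
    and b: "\<And>n x. \<bar>w n x\<bar> \<le> M" and lim: "\<And>x. (\<lambda>n. w n x) \<longlonglongrightarrow> w0 x"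
    and K: "\<And>n. heat_energy \<beta> F (w n) \<le> K"
  shows "heat_energy \<beta> F w0 \<le> K"
proof -
  have w0[measurable]: "w0 \<in> borel_measurable borel"
    by (rule borel_measurable_LIMSEQ_real[OF lim wm])
  have hl: "(\<lambda>n. heat t (w n) x) \<longlonglongrightarrow> heat t w0 x" if t: "t > 0" for t x
    unfolding heat_def
  proof (rule integral_dominated_convergence[where w="\<lambda>z. M * gauss t z"])
    show "integrable lborel (\<lambda>z::'a. M * gauss t z)" using t by auto
    show "AE z in lborel. (\<lambda>n. gauss t z * w n (x + z)) \<longlonglongrightarrow> gauss t z * w0 (x + z)"
      by (intro AE_I2 tendsto_intros lim)
    show "AE z in lborel. norm (gauss t z * w n (x + z)) \<le> M * gauss t z" for n
      using b[of n] by (intro AE_I2) (simp add: abs_mult mult.commute[of M] mult_left_mono)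
  qed measurable
  let ?J = "\<lambda>w t. \<integral>\<^sup>+x. ennreal (F x * \<bar>w x - heat t w x\<bar>) \<partial>lborel"
  \<comment> \<open>The time weight is carried along as the factor k, so that no constant has to be
    pulled out of a liminf in \<open>ennreal\<close>.\<close>
  have inner: "ennreal k * ?J w0 t \<le> liminf (\<lambda>n. ennreal k * ?J (w n) t)" if t: "t > 0" and k: "k \<ge> 0" for t k
  proof -
    have J: "ennreal k * ?J u t = (\<integral>\<^sup>+x. ennreal (k * (F x * \<bar>u x - heat t u x\<bar>)) \<partial>lborel)"
      if [measurable]: "u \<in> borel_measurable borel" for u
      using k by (simp add: nn_integral_cmult[symmetric] ennreal_mult')
    have "ennreal k * ?J w0 t = (\<integral>\<^sup>+x. liminf (\<lambda>n. ennreal (k * (F x * \<bar>w n x - heat t (w n) x\<bar>))) \<partial>lborel)"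
      unfolding J[OF w0]
    proof (rule nn_integral_cong)
      fix x
      have "(\<lambda>n. ennreal (k * (F x * \<bar>w n x - heat t (w n) x\<bar>))) \<longlonglongrightarrow> ennreal (k * (F x * \<bar>w0 x - heat t w0 x\<bar>))"
        by (intro tendsto_ennrealI tendsto_intros lim hl t)
      then show "ennreal (k * (F x * \<bar>w0 x - heat t w0 x\<bar>)) = liminf (\<lambda>n. ennreal (k * (F x * \<bar>w n x - heat t (w n) x\<bar>)))"
        by (intro lim_imp_Liminf[symmetric]) auto
    qed
    also have "\<dots> \<le> liminf (\<lambda>n. ennreal k * ?J (w n) t)" unfolding J[OF wm] by (rule nn_integral_liminf) measurable
    finally show ?thesis .
  qed
  have "heat_energy \<beta> F w0 \<le> (\<integral>\<^sup>+t. liminf (\<lambda>n. ennreal (t powr (- \<beta> - 1)) * indicator {0<..} t * ?J (w n) t) \<partial>lborel)"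
    unfolding heat_energy_def
  proof (rule nn_integral_mono)
    fix t :: real
    show "ennreal (t powr (- \<beta> - 1)) * indicator {0<..} t * ?J w0 t \<le> liminf (\<lambda>n. ennreal (t powr (- \<beta> - 1)) * indicator {0<..} t * ?J (w n) t)"
      using inner[of t "t powr (- \<beta> - 1)"] by (cases "t > 0") auto
  qed
  also have "\<dots> \<le> liminf (\<lambda>n. heat_energy \<beta> F (w n))"
    unfolding heat_energy_def by (rule nn_integral_liminf) measurable
  also have "\<dots> \<le> K" by (intro Liminf_le) (auto simp: K)
  finally show ?thesis .
qed

text \<open>The estimates for a layer require m > 0. A null superlevel set of the continuous
  function v is open, hence empty by this lemma, and the layer vanishes identically.\<close>

lemma open_emeasure_0_imp_empty:
  assumes "open S" "emeasure lborel S = 0"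
  shows "S = ({} :: 'a::euclidean_space set)"
proof (rule ccontr)
  assume "S \<noteq> {}"
  then have "\<not> negligible S" using open_not_negligible[OF assms(1)] by blast
  moreover have "S \<in> null_sets lborel" using assms by (intro null_setsI) auto
  ultimately show False using negligible_iff_null_sets null_sets_completionI by blast
qed

text \<open>Finite superlevel sets are the form of vanishing at infinity that makes each layer
  integrable and its support of finite measure. The condition is one-sided since only the positive
  part of v is cut into layers; the negative part is treated by passing to -v.\<close>

locale gradient_pair =
  fixes v :: "'a::euclidean_space \<Rightarrow> real" and V :: "'a \<Rightarrow> 'a"
  assumes v_deriv: "\<And>x. (v has_derivative (\<lambda>h. V x \<bullet> h)) (at x)"
    and V_cont: "continuous_on UNIV V"
    and level_finite: "\<And>c. c > 0 \<Longrightarrow> emeasure lborel {x. v x > c} < \<infinity>"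
    and V_int: "(\<integral>\<^sup>+x. ennreal (norm (V x)) \<partial>lborel) < \<infinity>"
    and dim2: "DIM('a) \<ge> 2"
begin

lemma v_cont: "continuous_on UNIV v"
  using v_deriv by (intro continuous_at_imp_continuous_on) (auto dest: has_derivative_continuous)

lemma v_meas [measurable]: "v \<in> borel_measurable borel"
  using v_cont by (rule borel_measurable_continuous_onI)

lemma V_meas [measurable]: "V \<in> borel_measurable borel"
  using V_cont by (rule borel_measurable_continuous_onI)

definition total :: real where
  "total = enn2real (\<integral>\<^sup>+x. ennreal (norm (V x)) \<partial>lborel)"

definition layer_total :: "real \<Rightarrow> real" where
  "layer_total a = enn2real (\<integral>\<^sup>+x. ennreal (layer_deriv a (v x) * norm (V x)) \<partial>lborel)"

lemma total: "(\<integral>\<^sup>+x. ennreal (norm (V x)) \<partial>lborel) = ennreal total" "total \<ge> 0"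
  using V_int by (auto simp: total_def)

lemma layer_total:
  assumes "a > 0"
  shows "(\<integral>\<^sup>+x. ennreal (layer_deriv a (v x) * norm (V x)) \<partial>lborel) = ennreal (layer_total a)" "layer_total a \<ge> 0"
proof -
  have "(\<integral>\<^sup>+x. ennreal (layer_deriv a (v x) * norm (V x)) \<partial>lborel) \<le> (\<integral>\<^sup>+x. ennreal (norm (V x)) \<partial>lborel)"
  proof (intro nn_integral_mono ennreal_leI)
    fix x show "layer_deriv a (v x) * norm (V x) \<le> norm (V x)"
      using mult_right_mono[OF layer_deriv_le norm_ge_zero, of a "v x" "V x"] by simp
  qed
  then have "(\<integral>\<^sup>+x. ennreal (layer_deriv a (v x) * norm (V x)) \<partial>lborel) < \<infinity>" using V_int by (rule le_less_trans)
  then show "(\<integral>\<^sup>+x. ennreal (layer_deriv a (v x) * norm (V x)) \<partial>lborel) = ennreal (layer_total a)" "layer_total a \<ge> 0"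
    by (auto simp: layer_total_def)
qed

lemma sum_layer_total_le:
  assumes e: "e > 0"
  shows "(\<Sum>j<J. layer_total (e * 2 ^ j)) \<le> total"
proof -
  have "ennreal (\<Sum>j<J. layer_total (e * 2 ^ j)) = (\<Sum>j<J. \<integral>\<^sup>+x. ennreal (layer_deriv (e * 2 ^ j) (v x) * norm (V x)) \<partial>lborel)"
    using e by (subst sum_ennreal[symmetric]) (auto simp: layer_total)
  also have "\<dots> = (\<integral>\<^sup>+x. (\<Sum>j<J. ennreal (layer_deriv (e * 2 ^ j) (v x) * norm (V x))) \<partial>lborel)"
    by (rule nn_integral_sum[symmetric]) measurable
  also have "\<dots> \<le> (\<integral>\<^sup>+x. ennreal (norm (V x)) \<partial>lborel)"
  proof (rule nn_integral_mono)
    fix x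
    have "(\<Sum>j<J. ennreal (layer_deriv (e * 2 ^ j) (v x) * norm (V x))) = ennreal ((\<Sum>j<J. layer_deriv (e * 2 ^ j) (v x)) * norm (V x))"
      using e by (subst sum_ennreal) (auto simp: layer_deriv_nonneg sum_distrib_right)
    also have "\<dots> \<le> ennreal (1 * norm (V x))"
      by (intro ennreal_leI mult_right_mono sum_layer_deriv_le) auto
    finally show "(\<Sum>j<J. ennreal (layer_deriv (e * 2 ^ j) (v x) * norm (V x))) \<le> ennreal (norm (V x))" by simp
  qed
  also have "\<dots> = ennreal total" by (rule total)
  finally show ?thesis using total(2) by (simp add: ennreal_le_iff)
qed

lemma layer_translation:
  assumes "a > 0"
  shows "(\<integral>\<^sup>+x. ennreal \<bar>layer a (v (x + h)) - layer a (v x)\<bar> \<partial>lborel) \<le> ennreal (norm h * layer_total a)"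
  using layer_translation_L1[OF v_deriv V_cont assms, of h] layer_total[OF assms] by (simp add: ennreal_mult')

lemma level_measure:
  assumes "c > 0"
  obtains m where "emeasure lborel {x. v x > c} = ennreal m" "m \<ge> 0"
  using level_finite[OF assms] by (metis ennreal_cases infinity_ennreal_def less_irrefl)

lemma level_sets [measurable]: "{x. v x > c} \<in> sets borel"
  by measurable

lemma layer_abs_le: "a > 0 \<Longrightarrow> \<bar>layer a t\<bar> \<le> 3/2 * a"
  using layer_nonneg[of a t] layer_le[of a t] by simp

text \<open>On {v > a} the layer at level a/4 stands on its plateau 3/2 * (a/4), so
  \<open>weak_sobolev\<close> applies to it with that value as \<mu>. Clearing the denominator 4
  turns the constant 5 into 20.\<close>

lemma layer_level_bound:
  assumes a: "a > 0" and m: "emeasure lborel {x. v x > a} = ennreal m" "m > 0"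
  shows "3/2 * a * m powr (1 - 1 / real DIM('a)) \<le> 20 * (real DIM('a) + 1) * layer_total (a / 4)"
proof -
  have a4: "a / 4 > 0" using a by simp
  obtain m' where m': "emeasure lborel {x. v x > a / 4} = ennreal m'" "m' \<ge> 0"
    using level_measure[OF a4] .
  have "3/2 * (a / 4) * m powr (1 - 1 / real DIM('a)) \<le> 5 * (real DIM('a) + 1) * layer_total (a / 4)"
  proof (rule weak_sobolev[where w="\<lambda>x. layer (a / 4) (v x)", OF _ layer_abs_le[OF a4] _ layer_total(2)[OF a4] layer_translation[OF a4] dim2 level_sets[of a] m])
    show "(\<integral>\<^sup>+x. ennreal \<bar>layer (a / 4) (v x)\<bar> \<partial>lborel) < \<infinity>"
    proof -
      have "(\<integral>\<^sup>+x. ennreal \<bar>layer (a / 4) (v x)\<bar> \<partial>lborel) \<le> (\<integral>\<^sup>+x. ennreal (3/2 * (a / 4)) * indicator {x. v x > a / 4} x \<partial>lborel)"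
      proof (rule nn_integral_mono)
        fix x
        show "ennreal \<bar>layer (a / 4) (v x)\<bar> \<le> ennreal (3/2 * (a / 4)) * indicator {x. v x > a / 4} x"
          using layer_abs_le[OF a4, of "v x"] layer_eq_0[OF a4, of "v x"]
          by (cases "v x > a / 4") (auto intro!: ennreal_leI)
      qed
      also have "\<dots> = ennreal (3/2 * (a / 4)) * ennreal m'"
        using m' by (simp add: nn_integral_cmult_indicator)
      also have "\<dots> < \<infinity>" by (simp add: ennreal_mult_less_top)
      finally show ?thesis .
    qed
    show "3/2 * (a / 4) \<le> layer (a / 4) (v x)" if "x \<in> {x. v x > a}" for x
      using layer_top[OF a4, of "v x"] that by simp
  qed (use a in auto)
  then show ?thesis by (simp add: algebra_simps)
qed

text \<open>Here \<Lambda> = 3/2 * a and the support of the layer lies in {v > a}; the term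
  \<Lambda> * m^(1-1/d) is traded for the gradient of a lower layer, so that only gradients remain
  to be summed.\<close>

lemma layer_energy:
  fixes f :: "'a \<Rightarrow> real"
  assumes a: "a > 0" and f[measurable]: "f \<in> borel_measurable borel"
    and nn: "\<And>x. 0 \<le> f x" and be: "0 < \<beta>" "\<beta> \<le> 1/4"
    and p: "p = real DIM('a) / (real DIM('a) - 1 + 2 * \<beta>)"
    and U: "U > 0" "(\<integral>\<^sup>+x. ennreal (f x powr p) \<partial>lborel) \<le> ennreal (U powr p)"
  shows "heat_energy \<beta> (\<lambda>x. f x powr (p - 1)) (\<lambda>x. layer a (v x))
    \<le> ennreal (U powr (p - 1) * (2 * (real DIM('a) + 1) / \<beta>) * (layer_total a + 20 * (real DIM('a) + 1) * layer_total (a / 4)))"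
proof -
  obtain m where m: "emeasure lborel {x. v x > a} = ennreal m" "m \<ge> 0"
    using level_measure[OF a] .
  show ?thesis
  proof (cases "m = 0")
    case True
    have "open {x. v x > a}" using v_cont by (intro open_Collect_less continuous_on_const)
    then have "{x. v x > a} = {}" using m True by (intro open_emeasure_0_imp_empty) auto
    then have "layer a (v x) = 0" for x using layer_eq_0[OF a, of "v x"] by (auto simp: not_less)
    then show ?thesis by (simp add: heat_energy_def heat_def)
  next
    case False
    then have m0: "m > 0" using m by simp
    have "heat_energy \<beta> (\<lambda>x. f x powr (p - 1)) (\<lambda>x. layer a (v x))
      \<le> ennreal (U powr (p - 1) * (2 * (real DIM('a) + 1) / \<beta> * (layer_total a + 3/2 * a * m powr (1 - 1 / real DIM('a)))))"
      unfolding heat_energy_def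
      by (rule heat_weighted_integral_bound[OF _ f nn layer_nonneg[OF a] layer_le[OF a] _ layer_total(2)[OF a]
            layer_translation[OF a] level_sets[of a] m(1) m0 _ dim2 be p U])
         (use a layer_eq_0[OF a] in auto)
    also have "\<dots> \<le> ennreal (U powr (p - 1) * (2 * (real DIM('a) + 1) / \<beta> * (layer_total a + 20 * (real DIM('a) + 1) * layer_total (a / 4))))"
      using be by (intro ennreal_leI mult_left_mono add_left_mono layer_level_bound[OF a m(1) m0]) auto
    finally show ?thesis by (simp add: mult.assoc)
  qed
qed

lemma positive_part_energy:
  fixes f :: "'a \<Rightarrow> real"
  assumes f[measurable]: "f \<in> borel_measurable borel" and vb: "\<And>x. \<bar>v x\<bar> \<le> M"
    and nn: "\<And>x. 0 \<le> f x" and be: "0 < \<beta>" "\<beta> \<le> 1/4"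
    and p: "p = real DIM('a) / (real DIM('a) - 1 + 2 * \<beta>)"
    and U: "U > 0" "(\<integral>\<^sup>+x. ennreal (f x powr p) \<partial>lborel) \<le> ennreal (U powr p)"
  shows "heat_energy \<beta> (\<lambda>x. f x powr (p - 1)) (\<lambda>x. max 0 (v x))
    \<le> ennreal (U powr (p - 1) * (2 * (real DIM('a) + 1) / \<beta>) * (1 + 20 * (real DIM('a) + 1)) * total)"
proof (rule heat_energy_Fatou[where w="\<lambda>N x. \<Sum>j<2 * N. layer ((1/2) ^ N * 2 ^ j) (v x)" and M=M])
  fix N :: nat
  define e :: real where "e = (1/2) ^ N"
  have e: "e > 0" by (simp add: e_def)
  define c where "c = U powr (p - 1) * (2 * (real DIM('a) + 1) / \<beta>)"
  have c: "c \<ge> 0" using be by (simp add: c_def)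
  define k where "k = 20 * (real DIM('a) + 1)"
  have k: "k \<ge> 0" by (simp add: k_def)
  have "heat_energy \<beta> (\<lambda>x. f x powr (p - 1)) (\<lambda>x. \<Sum>j<2 * N. layer (e * 2 ^ j) (v x))
     \<le> (\<Sum>j<2 * N. heat_energy \<beta> (\<lambda>x. f x powr (p - 1)) (\<lambda>x. layer (e * 2 ^ j) (v x)))"
  proof (rule heat_energy_sum_le[where M="\<lambda>j. 3/2 * (e * 2 ^ j)"])
    show "\<bar>layer (e * 2 ^ j) (v x)\<bar> \<le> 3/2 * (e * 2 ^ j)" for j x
      by (rule layer_abs_le) (use e in simp)
  qed auto
  also have "\<dots> \<le> (\<Sum>j<2 * N. ennreal (c * (layer_total (e * 2 ^ j) + k * layer_total (e * 2 ^ j / 4))))"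
    unfolding c_def k_def using e by (intro sum_mono layer_energy f nn be p U) auto
  also have "\<dots> = ennreal (\<Sum>j<2 * N. c * (layer_total (e * 2 ^ j) + k * layer_total (e * 2 ^ j / 4)))"
    using e c k by (intro sum_ennreal mult_nonneg_nonneg add_nonneg_nonneg layer_total) auto
  also have "\<dots> \<le> ennreal (c * (1 + k) * total)"
  proof (rule ennreal_leI)
    \<comment> \<open>Lowering every level by the factor 4 only changes the starting level from e to
      e/4. As \<open>sum_layer_total_le\<close> holds for every starting level, both sums are
      bounded by the same total.\<close>
    have "(\<Sum>j<2 * N. c * (layer_total (e * 2 ^ j) + k * layer_total (e * 2 ^ j / 4)))
      = c * ((\<Sum>j<2 * N. layer_total (e * 2 ^ j)) + k * (\<Sum>j<2 * N. layer_total (e / 4 * 2 ^ j)))"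
      by (simp add: sum_distrib_left[symmetric] sum.distrib)
    also have "\<dots> \<le> c * (total + k * total)"
      using e c k by (intro mult_left_mono add_mono sum_layer_total_le) auto
    finally show "(\<Sum>j<2 * N. c * (layer_total (e * 2 ^ j) + k * layer_total (e * 2 ^ j / 4))) \<le> c * (1 + k) * total"
      by (simp add: algebra_simps)
  qed
  finally show "heat_energy \<beta> (\<lambda>x. f x powr (p - 1)) (\<lambda>x. \<Sum>j<2 * N. layer ((1/2) ^ N * 2 ^ j) (v x))
     \<le> ennreal (U powr (p - 1) * (2 * (real DIM('a) + 1) / \<beta>) * (1 + 20 * (real DIM('a) + 1)) * total)"
    unfolding c_def k_def e_def .
next
  fix N x
  show "\<bar>\<Sum>j<2 * N. layer ((1/2) ^ N * 2 ^ j) (v x)\<bar> \<le> M"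
    using sum_layer_bounds[of "(1/2) ^ N" "v x" "2 * N"] vb[of x] by simp
  show "(\<lambda>N. \<Sum>j<2 * N. layer ((1/2) ^ N * 2 ^ j) (v x)) \<longlonglongrightarrow> max 0 (v x)"
    by (rule sum_layer_tendsto)
qed measurable

end

text \<open>v is the positive part of v minus the positive part of -v, and the energy is subadditive
  and invariant under sign change; each half contributes the same bound, which turns the factor 2
  into 4.\<close>

lemma gradient_energy_bound:
  fixes f v :: "'a::euclidean_space \<Rightarrow> real"
  assumes "gradient_pair v V" "gradient_pair (\<lambda>x. - v x) (\<lambda>x. - V x)"
    and f[measurable]: "f \<in> borel_measurable borel" and vb: "\<And>x. \<bar>v x\<bar> \<le> M"
    and nn: "\<And>x. 0 \<le> f x" and be: "0 < \<beta>" "\<beta> \<le> 1/4"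
    and p: "p = real DIM('a) / (real DIM('a) - 1 + 2 * \<beta>)"
    and U: "U > 0" "(\<integral>\<^sup>+x. ennreal (f x powr p) \<partial>lborel) \<le> ennreal (U powr p)"
    and I: "(\<integral>\<^sup>+x. ennreal (norm (V x)) \<partial>lborel) = ennreal I" "I \<ge> 0"
  shows "heat_energy \<beta> (\<lambda>x. f x powr (p - 1)) v
    \<le> ennreal (U powr (p - 1) * (4 * (real DIM('a) + 1) * (1 + 20 * (real DIM('a) + 1))) / \<beta> * I)"
proof -
  interpret A: gradient_pair v V by fact
  interpret B: gradient_pair "\<lambda>x. - v x" "\<lambda>x. - V x" by fact
  have tot: "A.total = I" "B.total = I" using I by (auto simp: A.total_def B.total_def)
  define K where "K = U powr (p - 1) * (2 * (real DIM('a) + 1) / \<beta>) * (1 + 20 * (real DIM('a) + 1)) * I"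
  have K: "K \<ge> 0" using be I by (simp add: K_def)
  let ?F = "\<lambda>x. f x powr (p - 1)"
  define w where "w b x = (if b then max 0 (v x) else - max 0 (- v x))" for b :: bool and x
  have wm[measurable]: "w b \<in> borel_measurable borel" for b by (cases b) (auto simp: w_def[abs_def])
  have wb: "\<bar>w b x\<bar> \<le> M" for b x using vb[of x] by (auto simp: w_def)
  have "heat_energy \<beta> ?F (\<lambda>x. \<Sum>b\<in>UNIV. w b x) \<le> (\<Sum>b\<in>UNIV. heat_energy \<beta> ?F (w b))"
    by (intro heat_energy_sum_le[where M="\<lambda>_. M"] wb) auto
  also have "\<dots> = heat_energy \<beta> ?F (\<lambda>x. max 0 (v x)) + heat_energy \<beta> ?F (\<lambda>x. max 0 (- v x))"
    by (simp add: UNIV_bool w_def[abs_def] heat_energy_minus add.commute)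
  also have "\<dots> \<le> ennreal K + ennreal K"
    using A.positive_part_energy[OF f vb nn be p U] B.positive_part_energy[OF f _ nn be p U, of M] vb
    by (intro add_mono) (auto simp: K_def tot)
  also have "\<dots> = ennreal (2 * K)"
    using K by (simp add: ennreal_plus[symmetric] del: ennreal_plus)
  also have "2 * K = U powr (p - 1) * (4 * (real DIM('a) + 1) * (1 + 20 * (real DIM('a) + 1))) / \<beta> * I"
    by (simp add: K_def)
  also have "(\<lambda>x. \<Sum>b\<in>UNIV. w b x) = v" by (auto simp: UNIV_bool w_def)
  finally show ?thesis .
qed

section \<open>Inversion in the time variable\<close>

lemma integral_norm_le_nn:
  fixes f :: "'a \<Rightarrow> 'b::{banach, second_countable_topology}"
  shows "ennreal (norm (integral\<^sup>L M f)) \<le> (\<integral>\<^sup>+x. ennreal (norm (f x)) \<partial>M)"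
  by (cases "integrable M f") (auto intro: integral_norm_bound_ennreal simp: not_integrable_integral_eq)

text \<open>The factor min 1 (1/t) is the envelope, up to a constant, of the heat evolution at a
  fixed point: bounded for small t, decaying for large t.\<close>

lemma nn_integral_powr_0_inf:
  assumes be: "0 < \<beta>" "\<beta> < 1"
  shows "(\<integral>\<^sup>+t. ennreal (indicator {0<..} t * (t powr (\<beta> - 1) * min 1 (1 / t))) \<partial>lborel) = ennreal (1 / \<beta> + 1 / (1 - \<beta>))"
proof -
  have "(\<integral>\<^sup>+t. ennreal (indicator {0<..} t * (t powr (\<beta> - 1) * min 1 (1 / t))) \<partial>lborel)
    = (\<integral>\<^sup>+t. ennreal (t powr (\<beta> - 1)) * indicator {0<..1} t + ennreal (t powr (- (1 - \<beta>) - 1)) * indicator {1<..} t \<partial>lborel)"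
  proof (rule nn_integral_cong)
    fix t :: real
    have "t > 0 \<Longrightarrow> t powr (\<beta> - 1) * (1 / t) = t powr (- (1 - \<beta>) - 1)"
      by (simp add: powr_diff power2_eq_square)
    then show "ennreal (indicator {0<..} t * (t powr (\<beta> - 1) * min 1 (1 / t)))
      = ennreal (t powr (\<beta> - 1)) * indicator {0<..1} t + ennreal (t powr (- (1 - \<beta>) - 1)) * indicator {1<..} t"
      by (auto simp: indicator_def min_def)
  qed
  also have "\<dots> = ennreal (1 / \<beta>) + ennreal (1 / (1 - \<beta>))"
    using be nn_integral_powr_0[of \<beta> 1] nn_integral_powr_inf[of "1 - \<beta>" 1] by (subst nn_integral_add) auto
  also have "\<dots> = ennreal (1 / \<beta> + 1 / (1 - \<beta>))"
    using be by (simp add: ennreal_plus[symmetric] del: ennreal_plus)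
  finally show ?thesis .
qed

text \<open>The integrand is ((\<sigma>-\<tau>)/\<tau>)^(\<beta>-1) / \<tau>^2. In the variable y =
  (\<sigma>-\<tau>)/\<tau> it becomes a pure power of y, which yields the explicit antiderivative
  F.\<close>

lemma nn_integral_beta_kernel:
  assumes be: "0 < \<beta>" "\<beta> < 1" and d: "0 < \<delta>" "\<delta> < \<sigma>"
  shows "(\<integral>\<^sup>+\<tau>. ennreal (\<tau> powr (- \<beta> - 1) * (\<sigma> - \<tau>) powr (\<beta> - 1)) * indicator {\<delta>..\<sigma>} \<tau> \<partial>lborel)
    = ennreal (((\<sigma> - \<delta>) / \<delta>) powr \<beta> / (\<beta> * \<sigma>))"
proof -
  define F where "F = (\<lambda>\<tau>. - (((\<sigma> - \<tau>) / \<tau>) powr \<beta> / (\<beta> * \<sigma>)))"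
  have "((\<lambda>\<tau>. \<tau> powr (- \<beta> - 1) * (\<sigma> - \<tau>) powr (\<beta> - 1)) has_integral (F \<sigma> - F \<delta>)) {\<delta>..\<sigma>}"
  \<comment> \<open>The integrand is singular at the right endpoint \<sigma>, but F is continuous
    there, so differentiability is required in the interior only.\<close>
  proof (rule fundamental_theorem_of_calculus_interior)
    show "continuous_on {\<delta>..\<sigma>} F"
      unfolding F_def using d be by (intro continuous_intros continuous_on_powr') auto
    fix \<tau> assume t: "\<tau> \<in> {\<delta><..<\<sigma>}"
    then have tp: "\<tau> > 0" "\<sigma> - \<tau> > 0" "\<sigma> > 0" using d by auto
    have "((\<lambda>\<tau>. (\<sigma> - \<tau>) / \<tau>) has_real_derivative (- \<sigma> / \<tau>\<^sup>2)) (at \<tau>)"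
      using tp by (auto intro!: derivative_eq_intros simp: field_simps power2_eq_square)
    then have "((\<lambda>\<tau>. ((\<sigma> - \<tau>) / \<tau>) powr \<beta>) has_real_derivative (\<beta> * ((\<sigma> - \<tau>) / \<tau>) powr (\<beta> - 1) * (- \<sigma> / \<tau>\<^sup>2))) (at \<tau>)"
      using tp by (intro DERIV_fun_powr[THEN DERIV_cong]) auto
    then have "(F has_real_derivative (- (\<beta> * ((\<sigma> - \<tau>) / \<tau>) powr (\<beta> - 1) * (- \<sigma> / \<tau>\<^sup>2) / (\<beta> * \<sigma>)))) (at \<tau>)"
      unfolding F_def by (intro DERIV_minus DERIV_cdivide)
    also have "- (\<beta> * ((\<sigma> - \<tau>) / \<tau>) powr (\<beta> - 1) * (- \<sigma> / \<tau>\<^sup>2) / (\<beta> * \<sigma>)) = ((\<sigma> - \<tau>) / \<tau>) powr (\<beta> - 1) / \<tau>\<^sup>2"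
      using tp be by (simp add: field_simps)
    also have "\<dots> = (\<sigma> - \<tau>) powr (\<beta> - 1) * (\<tau> powr (- (\<beta> - 1)) * \<tau> powr (- 2))"
    proof -
      have "\<tau> powr (- (\<beta> - 1)) = 1 / \<tau> powr (\<beta> - 1)" by (rule powr_minus_divide)
      moreover have "\<tau> powr (- 2) = 1 / \<tau>\<^sup>2" using tp by (simp add: powr_minus_divide)
      ultimately show ?thesis using tp by (simp only: powr_divide) simp
    qed
    also have "\<tau> powr (- (\<beta> - 1)) * \<tau> powr (- 2) = \<tau> powr (- (\<beta> - 1) + - 2)"
      by (rule powr_add[symmetric])
    also have "- (\<beta> - 1) + - 2 = - \<beta> - 1" by simp
    finally show "(F has_vector_derivative \<tau> powr (- \<beta> - 1) * (\<sigma> - \<tau>) powr (\<beta> - 1)) (at \<tau>)"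
      by (simp add: has_real_derivative_iff_has_vector_derivative mult.commute)
  qed (use d in auto)
  then have "((\<lambda>\<tau>. \<tau> powr (- \<beta> - 1) * (\<sigma> - \<tau>) powr (\<beta> - 1)) has_integral (((\<sigma> - \<delta>) / \<delta>) powr \<beta> / (\<beta> * \<sigma>))) {\<delta>..\<sigma>}"
    by (simp add: F_def)
  then show ?thesis by (intro nn_integral_has_integral_lebesgue') auto
qed

text \<open>Put \<open>g(t) = P\<^sub>t u(x)\<close>. Integrating \<open>\<tau>\<^bsup>-\<beta>-1\<^esup> (v - P\<^sub>\<tau> v)(x)\<close> over \<open>\<tau> > \<delta>\<close> yields the integral of \<open>g(\<delta>r)\<close> against
  the following kernel, which is nonnegative with mass at least \<open>\<beta>\<^sup>-\<^sup>2\<close>; letting \<open>\<delta> \<rightarrow> 0\<close> recovers \<open>u(x)\<close>.\<close>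

definition inv_kernel :: "real \<Rightarrow> real \<Rightarrow> real" where
  "inv_kernel \<beta> r = indicator {0<..} r * ((r powr \<beta> - (max 0 (r - 1)) powr \<beta>) / (\<beta> * r))"

lemma inv_kernel_measurable [measurable]: "inv_kernel \<beta> \<in> borel_measurable borel"
  unfolding inv_kernel_def[abs_def] by measurable

lemma inv_kernel_nonneg: "0 < \<beta> \<Longrightarrow> 0 \<le> inv_kernel \<beta> r"
  by (auto simp: inv_kernel_def indicator_def intro!: divide_nonneg_nonneg powr_mono2)

text \<open>For r > 1 the inequality x \<le> x^\<beta> on [0, 1], taken at x = 1 - 1/r, gives
  r^\<beta> - (r-1)^\<beta> \<le> r^(\<beta>-1). The difference thus gains one power of r, and the
  kernel decays like r^(\<beta>-2).\<close>

lemma inv_kernel_le: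
  assumes be: "0 < \<beta>" "\<beta> < 1"
  shows "inv_kernel \<beta> r \<le> 1 / \<beta> * (indicator {0<..} r * (r powr (\<beta> - 1) * min 1 (1 / r)))"
proof -
  consider "r \<le> 0" | "0 < r" "r \<le> 1" | "1 < r" by linarith
  then show ?thesis
  proof cases
    case 2
    then show ?thesis using be by (simp add: inv_kernel_def min_def powr_diff)
  next
    case 3
    have x: "0 \<le> 1 - 1 / r" "1 - 1 / r \<le> 1" using 3 by auto
    have "1 - 1 / r \<le> (1 - 1 / r) powr \<beta>"
    proof (cases "1 - 1 / r = 0")
      case False
      then have "(1 - 1 / r) powr 1 \<le> (1 - 1 / r) powr \<beta>" using x be by (intro powr_mono') auto
      then show ?thesis using x False by simp
    qed simp
    then have "r powr \<beta> * (1 - 1 / r) \<le> r powr \<beta> * (1 - 1 / r) powr \<beta>" by (intro mult_left_mono) auto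
    also have "\<dots> = (r * (1 - 1 / r)) powr \<beta>" using 3 x by (simp only: powr_mult)
    also have "r * (1 - 1 / r) = r - 1" using 3 by (simp add: right_diff_distrib)
    finally have *: "r powr \<beta> - (r - 1) powr \<beta> \<le> r powr \<beta> / r" by (simp add: right_diff_distrib)
    have "inv_kernel \<beta> r = (r powr \<beta> - (r - 1) powr \<beta>) / (\<beta> * r)" using 3 by (simp add: inv_kernel_def)
    also have "\<dots> \<le> (r powr \<beta> / r) / (\<beta> * r)" using 3 be by (intro divide_right_mono *) auto
    also have "\<dots> = 1 / \<beta> * (indicator {0<..} r * (r powr (\<beta> - 1) * min 1 (1 / r)))"
      using 3 be by (simp add: min_def powr_diff)
    finally show ?thesis .
  qed (simp add: inv_kernel_def)
qed

lemma inv_kernel_integrable: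
  assumes be: "0 < \<beta>" "\<beta> < 1"
  shows "integrable lborel (inv_kernel \<beta>)"
proof (rule integrableI_nonneg)
  have "(\<integral>\<^sup>+r. ennreal (inv_kernel \<beta> r) \<partial>lborel) \<le> (\<integral>\<^sup>+r. ennreal (1 / \<beta>) * ennreal (indicator {0<..} r * (r powr (\<beta> - 1) * min 1 (1 / r))) \<partial>lborel)"
    using be inv_kernel_le[OF be] by (intro nn_integral_mono) (simp add: ennreal_mult'[symmetric] ennreal_leI)
  also have "\<dots> = ennreal (1 / \<beta>) * ennreal (1 / \<beta> + 1 / (1 - \<beta>))"
    by (subst nn_integral_cmult) (auto simp: nn_integral_powr_0_inf[OF be])
  also have "\<dots> < \<infinity>" by (simp add: ennreal_mult_less_top)
  finally show "(\<integral>\<^sup>+r. ennreal (inv_kernel \<beta> r) \<partial>lborel) < \<infinity>" .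
qed (use be inv_kernel_nonneg in auto)

text \<open>Already the interval (0, 1], on which the kernel equals r^(\<beta>-1)/\<beta>,
  contributes exactly 1/\<beta>^2.\<close>

lemma integral_inv_kernel_ge:
  assumes be: "0 < \<beta>" "\<beta> < 1"
  shows "1 / \<beta>\<^sup>2 \<le> integral\<^sup>L lborel (inv_kernel \<beta>)"
proof -
  have "ennreal (1 / \<beta>\<^sup>2) = ennreal (1 / \<beta>) * ennreal (1 powr \<beta> / \<beta>)"
    using be by (simp add: ennreal_mult'[symmetric] power2_eq_square)
  also have "\<dots> = (\<integral>\<^sup>+r. ennreal (1 / \<beta>) * (ennreal (r powr (\<beta> - 1)) * indicator {0<..1} r) \<partial>lborel)"
    using be by (subst nn_integral_cmult) (auto simp: nn_integral_powr_0)
  also have "\<dots> \<le> (\<integral>\<^sup>+r. ennreal (inv_kernel \<beta> r) \<partial>lborel)"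
  proof (rule nn_integral_mono)
    fix r :: real
    show "ennreal (1 / \<beta>) * (ennreal (r powr (\<beta> - 1)) * indicator {0<..1} r) \<le> ennreal (inv_kernel \<beta> r)"
    proof (cases "r \<in> {0<..1}")
      case True
      then have "inv_kernel \<beta> r = 1 / \<beta> * r powr (\<beta> - 1)" by (simp add: inv_kernel_def powr_diff)
      then show ?thesis using True be by (simp add: ennreal_mult'[symmetric])
    qed simp
  qed
  also have "\<dots> = ennreal (integral\<^sup>L lborel (inv_kernel \<beta>))"
    using be by (intro nn_integral_eq_integral inv_kernel_integrable) (auto simp: inv_kernel_nonneg)
  finally show ?thesis
    by (subst (asm) ennreal_le_iff) (auto intro!: integral_nonneg_AE simp: inv_kernel_nonneg be)
qed

lemma nn_integral_time_weight_le:
  assumes be: "0 < \<beta>" "\<beta> < 1" and [measurable]: "g \<in> borel_measurable borel" and tau: "\<tau> \<ge> 0"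
    and g1: "\<And>t. t > 0 \<Longrightarrow> \<bar>g t\<bar> \<le> M" and g2: "\<And>t. t > 0 \<Longrightarrow> \<bar>g t\<bar> \<le> M / t"
  shows "(\<integral>\<^sup>+t. ennreal (norm (indicator {0<..} t * (t powr (\<beta> - 1) * g (t + \<tau>)))) \<partial>lborel) \<le> ennreal (M * (1 / \<beta> + 1 / (1 - \<beta>)))"
proof -
  have M: "M \<ge> 0" using g1[of 1] by linarith
  have "(\<integral>\<^sup>+t. ennreal (norm (indicator {0<..} t * (t powr (\<beta> - 1) * g (t + \<tau>)))) \<partial>lborel)
    \<le> (\<integral>\<^sup>+t. ennreal M * ennreal (indicator {0<..} t * (t powr (\<beta> - 1) * min 1 (1 / t))) \<partial>lborel)"
  proof (rule nn_integral_mono)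
    fix t :: real
    have "\<bar>g (t + \<tau>)\<bar> \<le> M * min 1 (1 / t)" if t: "t > 0"
    proof -
      have "M / (t + \<tau>) \<le> M / t" using M t tau by (intro divide_left_mono) auto
      then show ?thesis using g1[of "t + \<tau>"] g2[of "t + \<tau>"] t tau by (simp add: min_def)
    qed
    then have "t > 0 \<Longrightarrow> t powr (\<beta> - 1) * \<bar>g (t + \<tau>)\<bar> \<le> M * (t powr (\<beta> - 1) * min 1 (1 / t))"
      by (simp add: mult.left_commute[of M] mult_left_mono del: min_less_iff_conj)
    then show "ennreal (norm (indicator {0<..} t * (t powr (\<beta> - 1) * g (t + \<tau>)))) \<le> ennreal M * ennreal (indicator {0<..} t * (t powr (\<beta> - 1) * min 1 (1 / t)))"
      using M by (cases "t > 0") (auto simp: ennreal_mult'[symmetric] abs_mult intro!: ennreal_leI)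
  qed
  also have "\<dots> = ennreal M * ennreal (1 / \<beta> + 1 / (1 - \<beta>))"
    by (subst nn_integral_cmult) (auto simp: nn_integral_powr_0_inf[OF be])
  finally show ?thesis using M by (simp add: ennreal_mult')
qed

text \<open>Up to a Gamma factor, \<open>vv\<close> is the Weyl fractional integral of g of order
  \<beta>, and integrating the difference \<open>vv 0 - vv \<tau>\<close> against
  \<tau>^(-\<beta>-1) is its Marchaud derivative at 0, which inverts it. Only a lower bound is kept,
  with the absolute value inside the integral.\<close>

lemma fractional_inversion_1d:
  fixes g :: "real \<Rightarrow> real" and \<beta> M g0 :: real
  defines "vv \<equiv> \<lambda>\<tau>. \<integral>t. indicator {0<..} t * (t powr (\<beta> - 1) * g (t + \<tau>)) \<partial>lborel"
  assumes be: "0 < \<beta>" "\<beta> < 1" and g[measurable]: "g \<in> borel_measurable borel"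
    and g1: "\<And>t. t > 0 \<Longrightarrow> \<bar>g t\<bar> \<le> M" and g2: "\<And>t. t > 0 \<Longrightarrow> \<bar>g t\<bar> \<le> M / t"
    and lim: "(g \<longlongrightarrow> g0) (at_right 0)"
  shows "ennreal (\<bar>g0\<bar> / \<beta>\<^sup>2) \<le> (\<integral>\<^sup>+\<tau>. ennreal (\<tau> powr (- \<beta> - 1)) * indicator {0<..} \<tau> * ennreal \<bar>vv 0 - vv \<tau>\<bar> \<partial>lborel)"
    (is "_ \<le> ?R")
proof -
  have M: "M \<ge> 0" using g1[of 1] by linarith
  define C0 where "C0 = M * (1 / \<beta> + 1 / (1 - \<beta>))"
  have C0: "C0 \<ge> 0" using M be by (simp add: C0_def)
  note wi = nn_integral_time_weight_le[OF be g _ g1 g2, folded C0_def]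
  have wint: "integrable lborel (\<lambda>t. indicator {0<..} t * (t powr (\<beta> - 1) * g (t + \<tau>)))" if "\<tau> \<ge> 0" for \<tau>
    using le_less_trans[OF wi[OF that]] by (intro integrableI_bounded) auto
  have vv_meas[measurable]: "vv \<in> borel_measurable borel"
    unfolding vv_def by measurable
  have vv_le: "\<bar>vv \<tau>\<bar> \<le> C0" if "\<tau> \<ge> 0" for \<tau>
  proof -
    have "ennreal \<bar>vv \<tau>\<bar> \<le> ennreal C0"
      unfolding vv_def using order_trans[OF integral_norm_le_nn wi[OF that]] by simp
    then show ?thesis using C0 by simp
  qed
  have key: "ennreal \<bar>\<integral>r. g (\<delta> * r) * inv_kernel \<beta> r \<partial>lborel\<bar> \<le> ?R" if \<delta>: "\<delta> > 0" for \<delta>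
  proof -
    \<comment> \<open>Cutting off \<tau> \<le> \<delta> makes the weight integrable, so that the
      contributions of \<open>vv 0\<close> and of \<open>vv \<tau>\<close> may be integrated
      separately.\<close>
    define k where "k = (\<lambda>\<tau>. indicator {\<delta><..} \<tau> * \<tau> powr (- \<beta> - 1) :: real)"
    have k_meas[measurable]: "k \<in> borel_measurable borel" unfolding k_def by measurable
    have k0: "k \<tau> \<ge> 0" for \<tau> by (simp add: k_def)
    have k_nn: "(\<integral>\<^sup>+\<tau>. ennreal (k \<tau>) \<partial>lborel) = ennreal (\<delta> powr (- \<beta>) / \<beta>)"
    proof -
      have "(\<integral>\<^sup>+\<tau>. ennreal (k \<tau>) \<partial>lborel) = (\<integral>\<^sup>+\<tau>. ennreal (\<tau> powr (- \<beta> - 1)) * indicator {\<delta><..} \<tau> \<partial>lborel)"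
        by (intro nn_integral_cong) (auto simp: k_def indicator_def)
      then show ?thesis using be \<delta> by (simp add: nn_integral_powr_inf)
    qed
    have k_int: "integrable lborel k"
      using k_nn k0 by (intro integrableI_nonneg) auto
    have k_val: "integral\<^sup>L lborel k = \<delta> powr (- \<beta>) / \<beta>"
      using be k_nn k0 by (subst integral_eq_nn_integral) auto
    \<comment> \<open>In the variable \<sigma> = t + \<tau> the value g \<sigma> no longer depends
      on \<tau>; exchanging the integrals leaves a \<tau>-integral of explicit powers.\<close>
    define h where "h = (\<lambda>\<tau> \<sigma>. k \<tau> * (indicator {0<..} (\<sigma> - \<tau>) * ((\<sigma> - \<tau>) powr (\<beta> - 1) * g \<sigma>)))"
    have h_meas[measurable]: "case_prod h \<in> borel_measurable (borel \<Otimes>\<^sub>M borel)"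
      unfolding h_def by measurable
    have h_shift: "h \<tau> (\<tau> + t) = k \<tau> * (indicator {0<..} t * (t powr (\<beta> - 1) * g (t + \<tau>)))" for \<tau> t
      by (simp add: h_def add.commute)
    have h_vv: "(\<integral>\<sigma>. h \<tau> \<sigma> \<partial>lborel) = k \<tau> * vv \<tau>" for \<tau>
      using integral_translate[of "h \<tau>" \<tau>] unfolding h_shift vv_def by simp
    have h_nn: "(\<integral>\<^sup>+\<tau>. \<integral>\<^sup>+\<sigma>. ennreal (norm (h \<tau> \<sigma>)) \<partial>lborel \<partial>lborel) < \<infinity>"
    proof -
      have "(\<integral>\<^sup>+\<sigma>. ennreal (norm (h \<tau> \<sigma>)) \<partial>lborel) \<le> ennreal (k \<tau>) * ennreal C0" for \<tau>
      proof (cases "\<tau> > \<delta>")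
        case True
        have "(\<integral>\<^sup>+\<sigma>. ennreal (norm (h \<tau> \<sigma>)) \<partial>lborel) = (\<integral>\<^sup>+t. ennreal (norm (h \<tau> (\<tau> + t))) \<partial>lborel)"
          by (rule nn_integral_translate[symmetric]) measurable
        also have "\<dots> = (\<integral>\<^sup>+t. ennreal (k \<tau>) * ennreal (norm (indicator {0<..} t * (t powr (\<beta> - 1) * g (t + \<tau>)))) \<partial>lborel)"
          unfolding h_shift norm_mult[of "k \<tau>"] using k0 by (intro nn_integral_cong) (simp add: ennreal_mult')
        also have "\<dots> = ennreal (k \<tau>) * (\<integral>\<^sup>+t. ennreal (norm (indicator {0<..} t * (t powr (\<beta> - 1) * g (t + \<tau>)))) \<partial>lborel)"
          by (rule nn_integral_cmult) measurable
        also have "\<dots> \<le> ennreal (k \<tau>) * ennreal C0"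
          using True \<delta> by (intro mult_left_mono wi) auto
        finally show ?thesis .
      qed (simp add: h_def k_def)
      then have "(\<integral>\<^sup>+\<tau>. \<integral>\<^sup>+\<sigma>. ennreal (norm (h \<tau> \<sigma>)) \<partial>lborel \<partial>lborel) \<le> (\<integral>\<^sup>+\<tau>. ennreal (k \<tau>) * ennreal C0 \<partial>lborel)"
        by (intro nn_integral_mono)
      also have "\<dots> = ennreal (\<delta> powr (- \<beta>) / \<beta>) * ennreal C0"
        by (simp add: nn_integral_multc k_nn)
      also have "\<dots> < \<infinity>" by (simp add: ennreal_mult_less_top)
      finally show ?thesis .
    qed
    \<comment> \<open>This is the value of that \<tau>-integral by
      \<open>nn_integral_beta_kernel\<close>; for \<sigma> \<le> \<delta> the range of integration
      is empty.\<close>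
    define q where "q = (\<lambda>\<sigma>. indicator {\<delta><..} \<sigma> * (((\<sigma> - \<delta>) / \<delta>) powr \<beta> / (\<beta> * \<sigma>)) :: real)"
    have q_meas[measurable]: "q \<in> borel_measurable borel" unfolding q_def by measurable
    have inner: "(\<integral>\<tau>. h \<tau> \<sigma> \<partial>lborel) = q \<sigma> * g \<sigma>" for \<sigma>
    proof -
      have "(\<integral>\<tau>. k \<tau> * (indicator {0<..} (\<sigma> - \<tau>) * (\<sigma> - \<tau>) powr (\<beta> - 1)) \<partial>lborel) = q \<sigma>"
      proof (cases "\<delta> < \<sigma>")
        case True
        have "(\<integral>\<^sup>+\<tau>. ennreal (k \<tau> * (indicator {0<..} (\<sigma> - \<tau>) * (\<sigma> - \<tau>) powr (\<beta> - 1))) \<partial>lborel)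
          = (\<integral>\<^sup>+\<tau>. ennreal (\<tau> powr (- \<beta> - 1) * (\<sigma> - \<tau>) powr (\<beta> - 1)) * indicator {\<delta>..\<sigma>} \<tau> \<partial>lborel)"
          by (intro nn_integral_cong_AE, rule AE_mp[OF AE_lborel_singleton[of \<delta>]], rule AE_mp[OF AE_lborel_singleton[of \<sigma>]])
             (auto simp: k_def indicator_def)
        also have "\<dots> = ennreal (q \<sigma>)"
          using True by (simp add: nn_integral_beta_kernel[OF be \<delta> True] q_def)
        finally show ?thesis
          using True \<delta> be k0 by (subst integral_eq_nn_integral) (auto simp: q_def)
      next
        case False
        then have z: "k \<tau> * (indicator {0<..} (\<sigma> - \<tau>) * (\<sigma> - \<tau>) powr (\<beta> - 1)) = 0" for \<tau>
          by (auto simp: k_def indicator_def)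
        show ?thesis unfolding z using False by (simp add: q_def)
      qed
      then show ?thesis
        by (simp add: h_def mult.assoc[symmetric])
    qed
    have i1: "integrable lborel (\<lambda>\<tau>. k \<tau> * vv \<tau>)"
    proof (rule Bochner_Integration.integrable_bound)
      show "integrable lborel (\<lambda>\<tau>. C0 * k \<tau>)" using k_int by simp
      have "\<bar>k \<tau>\<bar> * \<bar>vv \<tau>\<bar> \<le> \<bar>C0 * k \<tau>\<bar>" for \<tau>
        using vv_le[of \<tau>] C0 \<delta> by (cases "\<tau> > \<delta>") (auto simp: k_def abs_mult mult.commute[of C0] mult_left_mono)
      then show "AE \<tau> in lborel. norm (k \<tau> * vv \<tau>) \<le> norm (C0 * k \<tau>)" by (simp add: abs_mult)
    qed measurable
    let ?w = "\<lambda>\<sigma>. indicator {0<..} \<sigma> * (\<sigma> powr (\<beta> - 1) * g \<sigma>)"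
    have w0: "integrable lborel ?w" using wint[of 0] by simp
    have qle: "q \<sigma> \<le> \<delta> powr (- \<beta>) / \<beta> * (indicator {0<..} \<sigma> * \<sigma> powr (\<beta> - 1))" for \<sigma>
    proof (cases "\<delta> < \<sigma>")
      case True
      have "((\<sigma> - \<delta>) / \<delta>) powr \<beta> \<le> (\<sigma> / \<delta>) powr \<beta>"
        using True \<delta> be by (intro powr_mono2 divide_right_mono) auto
      also have "\<dots> = \<sigma> powr \<beta> * \<delta> powr (- \<beta>)" using True \<delta> by (simp add: powr_divide powr_minus_divide)
      finally have "((\<sigma> - \<delta>) / \<delta>) powr \<beta> / (\<beta> * \<sigma>) \<le> \<sigma> powr \<beta> * \<delta> powr (- \<beta>) / (\<beta> * \<sigma>)"
        using True \<delta> be by (intro divide_right_mono) auto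
      then show ?thesis using True \<delta> be by (simp add: q_def powr_diff mult_ac)
    qed (use be in \<open>simp add: q_def\<close>)
    have q0: "0 \<le> q \<sigma>" for \<sigma> using \<delta> be by (auto simp: q_def indicator_def)
    have i2: "integrable lborel (\<lambda>\<sigma>. q \<sigma> * g \<sigma>)"
    proof (rule Bochner_Integration.integrable_bound)
      show "integrable lborel (\<lambda>\<sigma>. \<delta> powr (- \<beta>) / \<beta> * ?w \<sigma>)" using w0 by simp
      have "norm (q \<sigma> * g \<sigma>) \<le> norm (\<delta> powr (- \<beta>) / \<beta> * ?w \<sigma>)" for \<sigma>
      proof -
        have "norm (q \<sigma> * g \<sigma>) = q \<sigma> * \<bar>g \<sigma>\<bar>" using q0 by (simp add: abs_mult)
        also have "\<dots> \<le> (\<delta> powr (- \<beta>) / \<beta> * (indicator {0<..} \<sigma> * \<sigma> powr (\<beta> - 1))) * \<bar>g \<sigma>\<bar>"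
          by (intro mult_right_mono qle) auto
        also have "\<dots> = norm (\<delta> powr (- \<beta>) / \<beta> * ?w \<sigma>)" using be by (simp add: abs_mult mult.assoc)
        finally show ?thesis .
      qed
      then show "AE \<sigma> in lborel. norm (q \<sigma> * g \<sigma>) \<le> norm (\<delta> powr (- \<beta>) / \<beta> * ?w \<sigma>)" by simp
    qed measurable
    have vv0: "vv 0 = integral\<^sup>L lborel ?w" by (simp add: vv_def)
    have "(\<integral>\<tau>. k \<tau> * (vv 0 - vv \<tau>) \<partial>lborel) = (\<integral>\<tau>. k \<tau> * vv 0 - k \<tau> * vv \<tau> \<partial>lborel)"
      by (simp add: right_diff_distrib)
    also have "\<dots> = \<delta> powr (- \<beta>) / \<beta> * vv 0 - (\<integral>\<tau>. k \<tau> * vv \<tau> \<partial>lborel)"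
      using k_int i1 by (subst Bochner_Integration.integral_diff) (auto simp: k_val)
    also have "(\<integral>\<tau>. k \<tau> * vv \<tau> \<partial>lborel) = (\<integral>\<tau>. \<integral>\<sigma>. h \<tau> \<sigma> \<partial>lborel \<partial>lborel)" by (simp add: h_vv)
    also have "\<dots> = (\<integral>\<sigma>. \<integral>\<tau>. h \<tau> \<sigma> \<partial>lborel \<partial>lborel)" by (rule lborel_Fubini[OF h_meas h_nn])
    also have "\<dots> = (\<integral>\<sigma>. q \<sigma> * g \<sigma> \<partial>lborel)" by (simp add: inner)
    also have "\<delta> powr (- \<beta>) / \<beta> * vv 0 - (\<integral>\<sigma>. q \<sigma> * g \<sigma> \<partial>lborel) = (\<integral>\<sigma>. \<delta> powr (- \<beta>) / \<beta> * ?w \<sigma> - q \<sigma> * g \<sigma> \<partial>lborel)"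
      unfolding vv0 using w0 i2 by (subst Bochner_Integration.integral_diff) auto
    \<comment> \<open>The scaling \<sigma> = \<delta> * r moves all dependence on \<delta> into the
      argument of g and leaves the fixed kernel \<open>inv_kernel\<close>.\<close>
    also have "\<dots> = \<bar>\<delta>\<bar> *\<^sub>R (\<integral>r. \<delta> powr (- \<beta>) / \<beta> * ?w (0 + \<delta> * r) - q (0 + \<delta> * r) * g (0 + \<delta> * r) \<partial>lborel)"
      using \<delta> by (intro lborel_integral_real_affine) auto
    also have "\<dots> = (\<integral>r. g (\<delta> * r) * inv_kernel \<beta> r \<partial>lborel)"
    proof -
      have "\<delta> * (\<delta> powr (- \<beta>) / \<beta> * ?w (0 + \<delta> * r) - q (0 + \<delta> * r) * g (0 + \<delta> * r)) = g (\<delta> * r) * inv_kernel \<beta> r" for r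
      proof -
        consider "r \<le> 0" | "0 < r" "r \<le> 1" | "1 < r" by linarith
        then show ?thesis
        proof cases
          case 1
          then have "\<delta> * r \<le> 0" using \<delta> by (simp add: mult_le_0_iff)
          then show ?thesis using 1 \<delta> by (simp add: inv_kernel_def q_def)
        next
          case 2
          have "\<delta> * \<delta> powr (- \<beta>) * (\<delta> * r) powr (\<beta> - 1) = r powr \<beta> / r"
            using 2 \<delta> by (simp add: powr_mult powr_diff powr_minus field_simps)
          then show ?thesis using 2 \<delta> be by (simp add: inv_kernel_def q_def field_simps)
        next
          case 3
          have a: "\<delta> * \<delta> powr (- \<beta>) * (\<delta> * r) powr (\<beta> - 1) = r powr \<beta> / r"
            using 3 \<delta> by (simp add: powr_mult powr_diff powr_minus field_simps)
          have b: "(\<delta> * r - \<delta>) / \<delta> = r - 1" using \<delta> by (simp add: field_simps)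
          have q: "q (\<delta> * r) = (r - 1) powr \<beta> / (\<beta> * (\<delta> * r))"
            using 3 \<delta> by (simp add: q_def b)
          have "\<delta> * (\<delta> powr (- \<beta>) / \<beta> * ?w (0 + \<delta> * r) - q (0 + \<delta> * r) * g (0 + \<delta> * r))
            = (\<delta> * \<delta> powr (- \<beta>) * (\<delta> * r) powr (\<beta> - 1)) * g (\<delta> * r) / \<beta> - \<delta> * q (\<delta> * r) * g (\<delta> * r)"
            using 3 \<delta> by (simp add: right_diff_distrib mult_ac)
          also have "\<dots> = g (\<delta> * r) * inv_kernel \<beta> r"
            unfolding a q using 3 \<delta> be by (simp add: inv_kernel_def field_simps)
          finally show ?thesis .
        qed
      qed
      then show ?thesis using \<delta> by (simp del: integral_mult_right_zero integral_mult_right add: integral_mult_right_zero[symmetric])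
    qed
    finally have eq: "(\<integral>r. g (\<delta> * r) * inv_kernel \<beta> r \<partial>lborel) = (\<integral>\<tau>. k \<tau> * (vv 0 - vv \<tau>) \<partial>lborel)" by simp
    have "ennreal \<bar>\<integral>r. g (\<delta> * r) * inv_kernel \<beta> r \<partial>lborel\<bar> \<le> (\<integral>\<^sup>+\<tau>. ennreal (norm (k \<tau> * (vv 0 - vv \<tau>))) \<partial>lborel)"
      unfolding eq using integral_norm_le_nn[of lborel "\<lambda>\<tau>. k \<tau> * (vv 0 - vv \<tau>)"] by simp
    also have "\<dots> \<le> ?R"
    proof (rule nn_integral_mono)
      fix \<tau>
      show "ennreal (norm (k \<tau> * (vv 0 - vv \<tau>))) \<le> ennreal (\<tau> powr (- \<beta> - 1)) * indicator {0<..} \<tau> * ennreal \<bar>vv 0 - vv \<tau>\<bar>"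
        using \<delta> by (cases "\<tau> > \<delta>") (auto simp: k_def abs_mult ennreal_mult')
    qed
    finally show ?thesis .
  qed
  have ik: "integrable lborel (\<lambda>r. M * inv_kernel \<beta> r)" using inv_kernel_integrable[OF be] by simp
  define \<delta> where "\<delta> n = inverse (real (Suc n))" for n
  have \<delta>0: "\<delta> n > 0" for n by (simp add: \<delta>_def)
  have "(\<lambda>n. \<integral>r. g (\<delta> n * r) * inv_kernel \<beta> r \<partial>lborel) \<longlonglongrightarrow> (\<integral>r. g0 * inv_kernel \<beta> r \<partial>lborel)"
  proof (rule integral_dominated_convergence[OF _ _ ik])
    show "AE r in lborel. (\<lambda>n. g (\<delta> n * r) * inv_kernel \<beta> r) \<longlonglongrightarrow> g0 * inv_kernel \<beta> r"
    proof (rule AE_I2)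
      fix r :: real
      show "(\<lambda>n. g (\<delta> n * r) * inv_kernel \<beta> r) \<longlonglongrightarrow> g0 * inv_kernel \<beta> r"
      proof (cases "r > 0")
        case True
        have "(\<lambda>n. \<delta> n * r) \<longlonglongrightarrow> 0 * r"
          unfolding \<delta>_def by (intro tendsto_mult LIMSEQ_inverse_real_of_nat tendsto_const)
        then have "filterlim (\<lambda>n. \<delta> n * r) (at_right 0) sequentially"
          unfolding filterlim_at using mult_pos_pos[OF \<delta>0 True] by (auto intro!: always_eventually simp: less_le)
        from filterlim_compose[OF lim this] show ?thesis by (intro tendsto_mult tendsto_const)
      qed (simp add: inv_kernel_def)
    qed
    show "AE r in lborel. norm (g (\<delta> n * r) * inv_kernel \<beta> r) \<le> M * inv_kernel \<beta> r" for n
    proof (rule AE_I2)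
      fix r :: real
      show "norm (g (\<delta> n * r) * inv_kernel \<beta> r) \<le> M * inv_kernel \<beta> r"
      proof (cases "r > 0")
        case True
        then show ?thesis
          using g1[of "\<delta> n * r"] \<delta>0[of n] inv_kernel_nonneg[OF be(1), of r] by (simp add: abs_mult mult_right_mono)
      qed (simp add: inv_kernel_def)
    qed
  qed measurable
  then have L: "(\<lambda>n. \<bar>\<integral>r. g (\<delta> n * r) * inv_kernel \<beta> r \<partial>lborel\<bar>) \<longlonglongrightarrow> \<bar>g0 * integral\<^sup>L lborel (inv_kernel \<beta>)\<bar>"
    by (intro tendsto_rabs) simp
  have "ennreal \<bar>g0 * integral\<^sup>L lborel (inv_kernel \<beta>)\<bar> \<le> ?R"
    by (rule LIMSEQ_le_const2[OF tendsto_ennrealI[OF L]]) (use key[OF \<delta>0] in blast)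
  moreover have "\<bar>g0\<bar> / \<beta>\<^sup>2 \<le> \<bar>g0 * integral\<^sup>L lborel (inv_kernel \<beta>)\<bar>"
  proof -
    have "\<bar>g0\<bar> * (1 / \<beta>\<^sup>2) \<le> \<bar>g0\<bar> * \<bar>integral\<^sup>L lborel (inv_kernel \<beta>)\<bar>"
      using integral_inv_kernel_ge[OF be] by (intro mult_left_mono) auto
    then show ?thesis by (simp add: abs_mult)
  qed
  ultimately show ?thesis by (meson ennreal_leI order_trans)
qed

section \<open>The potential of a Lipschitz function\<close>

lemma nn_integral_norm_cmult:
  fixes f :: "'a \<Rightarrow> real"
  assumes [measurable]: "f \<in> borel_measurable M"
  shows "(\<integral>\<^sup>+t. ennreal (norm (c * f t)) \<partial>M) = ennreal \<bar>c\<bar> * (\<integral>\<^sup>+t. ennreal (norm (f t)) \<partial>M)"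
  by (simp add: abs_mult ennreal_mult' nn_integral_cmult)

text \<open>The value of t^(\<beta>-2) * \<open>gauss t z\<close> at t = r for a vector z of norm
  one in dimension d; its integral is the constant left after scaling out |z|.\<close>

definition unit_kernel :: "nat \<Rightarrow> real \<Rightarrow> real \<Rightarrow> real" where
  "unit_kernel d \<beta> r = indicator {0<..} r * (r powr (\<beta> - 2) * ((2 * pi * r) powr (- real d / 2) * exp (- 1 / (2 * r))))"

definition kernel_const :: "nat \<Rightarrow> real \<Rightarrow> real" where
  "kernel_const d \<beta> = enn2real (\<integral>\<^sup>+r. ennreal (unit_kernel d \<beta> r) \<partial>lborel)"

lemma unit_kernel_measurable [measurable]: "unit_kernel d \<beta> \<in> borel_measurable borel"
  unfolding unit_kernel_def[abs_def] by measurable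

text \<open>A single term of the exponential series bounds exp x from below. It is used to absorb
  the negative powers of r in \<open>unit_kernel\<close> near 0.\<close>

lemma exp_minus_le_fact_power:
  fixes x :: real
  assumes "x > 0"
  shows "exp (- x) \<le> fact n / x ^ n"
proof -
  have "(\<Sum>k\<in>{n}. x ^ k /\<^sub>R fact k) \<le> (\<Sum>k. x ^ k /\<^sub>R fact k)"
    using assms by (intro sum_le_suminf summable_exp_generic) auto
  then have "x ^ n / fact n \<le> exp x" by (simp add: exp_def field_simps)
  then show ?thesis using assms by (simp add: exp_minus field_simps)
qed

lemma unit_kernel_le:
  assumes be: "\<beta> \<le> 1/4" "0 < \<beta>" and d: "d \<ge> 2"
  shows "unit_kernel d \<beta> r \<le> indicator {0..1} r * (fact (d + 2) * 2 ^ (d + 2)) + indicator {1<..} r * r powr (- 1 - 1)"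
proof -
  consider "r \<le> 0" | "0 < r" "r \<le> 1" | "1 < r" by linarith
  then show ?thesis
  proof cases
    case 1 then show ?thesis by (auto simp: unit_kernel_def indicator_def)
  next
    case 2
    have "(2 * pi * r) powr (- real d / 2) \<le> r powr (- real d / 2)"
      using 2 pi_gt3 by (intro powr_mono2') auto
    also have "\<dots> \<le> r powr (- real d)" using 2 by (intro powr_mono') auto
    finally have a: "(2 * pi * r) powr (- real d / 2) \<le> r powr (- real d)" .
    have b: "r powr (\<beta> - 2) \<le> r powr (- 2)" using 2 be by (intro powr_mono') auto
    \<comment> \<open>The order d + 2 is chosen to cancel r^(-2), which bounds r^(\<beta>-2), and
      r^(-d), which bounds the Gaussian prefactor on (0, 1]. The resulting constant is independent
      of \<beta>.\<close>
    have c: "exp (- 1 / (2 * r)) \<le> fact (d + 2) * 2 ^ (d + 2) * r powr (real (d + 2))"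
    proof -
      define x where "x = 1 / (2 * r)"
      have x: "x > 0" using 2 by (simp add: x_def)
      have "exp (- x) \<le> fact (d + 2) / x ^ (d + 2)"
        by (rule exp_minus_le_fact_power) (rule x)
      also have "\<dots> = fact (d + 2) * (2 * r) ^ (d + 2)" by (simp add: x_def power_one_over)
      also have "\<dots> = fact (d + 2) * 2 ^ (d + 2) * r powr (real (d + 2))"
        unfolding powr_realpow[OF 2(1)] by (simp only: power_mult_distrib mult.assoc)
      finally show ?thesis by (simp add: x_def)
    qed
    have "unit_kernel d \<beta> r = r powr (\<beta> - 2) * ((2 * pi * r) powr (- real d / 2) * exp (- 1 / (2 * r)))"
      using 2 by (simp add: unit_kernel_def)
    also have "\<dots> \<le> r powr (- 2) * (r powr (- real d) * (fact (d + 2) * 2 ^ (d + 2) * r powr (real (d + 2))))"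
      by (intro mult_mono a b c) auto
    also have "\<dots> = (r powr (- 2) * r powr (- real d) * r powr (real (d + 2))) * (fact (d + 2) * 2 ^ (d + 2))"
      by (simp only: mult_ac)
    also have "r powr (- 2) * r powr (- real d) * r powr (real (d + 2)) = 1"
      unfolding powr_add[symmetric] using 2 by simp
    finally show ?thesis using 2 by simp
  next
    case 3
    have "(2 * pi * r) powr (- real d / 2) \<le> r powr (- real d / 2)"
      using 3 pi_gt3 by (intro powr_mono2') auto
    also have "\<dots> \<le> r powr (- 1)" using 3 d by (intro powr_mono) auto
    finally have a: "(2 * pi * r) powr (- real d / 2) \<le> r powr (- 1)" .
    have b: "r powr (\<beta> - 2) \<le> r powr (- 1)" using 3 be by (intro powr_mono) auto
    have "unit_kernel d \<beta> r = r powr (\<beta> - 2) * ((2 * pi * r) powr (- real d / 2) * exp (- 1 / (2 * r)))"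
      using 3 by (simp add: unit_kernel_def)
    also have "\<dots> \<le> r powr (- 1) * (r powr (- 1) * 1)"
      using 3 by (intro mult_mono a b) auto
    also have "\<dots> = r powr (- 1 - 1)" unfolding mult_1_right powr_add[symmetric] by simp
    finally show ?thesis using 3 by simp
  qed
qed

lemma unit_kernel_nonneg: "0 \<le> unit_kernel d \<beta> r"
  by (simp add: unit_kernel_def)

lemma nn_integral_unit_kernel_le:
  assumes be: "0 < \<beta>" "\<beta> \<le> 1/4" and d: "d \<ge> 2"
  shows "(\<integral>\<^sup>+r. ennreal (unit_kernel d \<beta> r) \<partial>lborel) \<le> ennreal (fact (d + 2) * 2 ^ (d + 2) + 1)"
proof -
  have "(\<integral>\<^sup>+r. ennreal (unit_kernel d \<beta> r) \<partial>lborel)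
    \<le> (\<integral>\<^sup>+r. ennreal (fact (d + 2) * 2 ^ (d + 2)) * indicator {0..1} r + ennreal (r powr (- 1 - 1)) * indicator {1<..} r \<partial>lborel)"
  proof (rule nn_integral_mono)
    fix r :: real
    have "ennreal (unit_kernel d \<beta> r) \<le> ennreal (indicator {0..1} r * (fact (d + 2) * 2 ^ (d + 2)) + indicator {1<..} r * r powr (- 1 - 1))"
      by (intro ennreal_leI unit_kernel_le be d)
    also have "\<dots> = ennreal (fact (d + 2) * 2 ^ (d + 2)) * indicator {0..1} r + ennreal (r powr (- 1 - 1)) * indicator {1<..} r"
      by (simp only: indicator_def) auto
    finally show "ennreal (unit_kernel d \<beta> r) \<le> \<dots>" .
  qed
  also have "\<dots> = ennreal (fact (d + 2) * 2 ^ (d + 2)) + ennreal 1"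
    using nn_integral_powr_inf[of 1 1]
    by (subst nn_integral_add) (auto simp: nn_integral_cmult_indicator)
  also have "\<dots> = ennreal (fact (d + 2) * 2 ^ (d + 2) + 1)"
    by (rule ennreal_plus[symmetric]) auto
  finally show ?thesis .
qed

lemma kernel_const:
  assumes be: "0 < \<beta>" "\<beta> \<le> 1/4" and d: "d \<ge> 2"
  shows "(\<integral>\<^sup>+r. ennreal (unit_kernel d \<beta> r) \<partial>lborel) = ennreal (kernel_const d \<beta>)"
    and "0 \<le> kernel_const d \<beta>" and "kernel_const d \<beta> \<le> fact (d + 2) * 2 ^ (d + 2) + 1"
proof -
  note le = nn_integral_unit_kernel_le[OF assms]
  then have "(\<integral>\<^sup>+r. ennreal (unit_kernel d \<beta> r) \<partial>lborel) < \<infinity>" by (rule le_less_trans) simp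
  then show eq: "(\<integral>\<^sup>+r. ennreal (unit_kernel d \<beta> r) \<partial>lborel) = ennreal (kernel_const d \<beta>)"
    by (simp add: kernel_const_def)
  show "0 \<le> kernel_const d \<beta>" by (simp add: kernel_const_def)
  show "kernel_const d \<beta> \<le> fact (d + 2) * 2 ^ (d + 2) + 1"
    using le unfolding eq by (subst (asm) ennreal_le_iff) auto
qed

text \<open>With s = 1 - 2\<beta> the exponent is d + s + 1. Multiplied by the vector z this is, up
  to \<open>kernel_const\<close>, the kernel of the fractional gradient.\<close>

definition riesz_kernel :: "real \<Rightarrow> 'a::euclidean_space \<Rightarrow> real" where
  "riesz_kernel \<beta> z = kernel_const DIM('a) \<beta> / norm z powr (real DIM('a) + 2 - 2 * \<beta>)"

lemma riesz_kernel_measurable [measurable]: "riesz_kernel \<beta> \<in> borel_measurable borel"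
  unfolding riesz_kernel_def[abs_def] by measurable

text \<open>The substitution t = |z|^2 * r separates |z| from a one-dimensional integral. The weight
  has one power of t less than the one in \<open>pot\<close> because differentiating the Gaussian
  contributes z/t.\<close>

lemma nn_integral_gauss_time:
  fixes z :: "'a::euclidean_space"
  assumes be: "0 < \<beta>" "\<beta> \<le> 1/4" and d: "DIM('a) \<ge> 2" and z: "z \<noteq> 0"
  shows "(\<integral>\<^sup>+t. ennreal (indicator {0<..} t * (t powr (\<beta> - 2) * gauss t z)) \<partial>lborel) = ennreal (riesz_kernel \<beta> z)"
proof -
  define c where "c = (norm z)\<^sup>2"
  have c: "c > 0" using z by (simp add: c_def)
  define D where "D = real DIM('a)"
  have "(\<integral>\<^sup>+t. ennreal (indicator {0<..} t * (t powr (\<beta> - 2) * gauss t z)) \<partial>lborel)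
    = ennreal \<bar>c\<bar> * (\<integral>\<^sup>+r. ennreal (indicator {0<..} (0 + c * r) * ((0 + c * r) powr (\<beta> - 2) * gauss (0 + c * r) z)) \<partial>lborel)"
    using c by (intro nn_integral_real_affine) auto
  also have "\<dots> = ennreal c * (\<integral>\<^sup>+r. ennreal (c powr (\<beta> - 2 - D / 2)) * ennreal (unit_kernel DIM('a) \<beta> r) \<partial>lborel)"
  proof -
    have "indicator {0<..} (0 + c * r) * ((0 + c * r) powr (\<beta> - 2) * gauss (0 + c * r) z) = c powr (\<beta> - 2 - D / 2) * unit_kernel DIM('a) \<beta> r" for r
    proof (cases "r > 0")
      case True
      have "(2 * pi * (c * r)) powr (- D / 2) = c powr (- D / 2) * (2 * pi * r) powr (- D / 2)"
        using True c powr_mult[of c "2 * pi * r" "- D / 2"] by (simp add: mult_ac)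
      moreover have "(c * r) powr (\<beta> - 2) = c powr (\<beta> - 2) * r powr (\<beta> - 2)"
        using True c by (simp add: powr_mult)
      moreover have "c powr (\<beta> - 2) * c powr (- D / 2) = c powr (\<beta> - 2 - D / 2)"
        by (simp add: powr_add[symmetric])
      moreover have "- (norm z)\<^sup>2 / (2 * (c * r)) = - 1 / (2 * r)" using c by (simp add: c_def[symmetric])
      ultimately show ?thesis using True c
        by (simp add: unit_kernel_def gauss_def D_def mult_ac)
    next
      case False
      then have "\<not> 0 < c * r" using c by (simp add: zero_less_mult_iff)
      then show ?thesis using False by (simp add: unit_kernel_def)
    qed
    then show ?thesis using c by (simp add: ennreal_mult' unit_kernel_nonneg)
  qed
  also have "\<dots> = ennreal c * (ennreal (c powr (\<beta> - 2 - D / 2)) * ennreal (kernel_const DIM('a) \<beta>))"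
    by (simp add: nn_integral_cmult kernel_const(1)[OF be d])
  also have "\<dots> = ennreal (c powr 1 * c powr (\<beta> - 2 - D / 2) * kernel_const DIM('a) \<beta>)"
    using c kernel_const(2)[OF be d] by (simp add: ennreal_mult' mult.assoc)
  also have "c powr 1 * c powr (\<beta> - 2 - D / 2) = norm z powr (- (D + 2 - 2 * \<beta>))"
  proof -
    have n2: "c = norm z powr 2" using z by (simp add: c_def)
    show ?thesis unfolding n2 powr_powr powr_add[symmetric] by (simp add: algebra_simps)
  qed
  finally show ?thesis unfolding D_def powr_minus_divide by (simp add: riesz_kernel_def)
qed

text \<open>What is extracted from a test function. The numbers L, M and N1 serve absolute
  convergence and the existence of limits; they do not appear in the final estimate.\<close>

locale lipschitz_data =
  fixes u :: "'a::euclidean_space \<Rightarrow> real" and M L N1 \<beta> :: real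
  assumes u_lip: "\<And>x y. \<bar>u x - u y\<bar> \<le> L * norm (x - y)" and L: "L \<ge> 0"
    and u_bd: "\<And>x. \<bar>u x\<bar> \<le> M"
    and u_L1: "(\<integral>\<^sup>+x. ennreal \<bar>u x\<bar> \<partial>lborel) \<le> ennreal N1" and N1: "N1 \<ge> 0"
    and dim2: "DIM('a) \<ge> 2" and be: "0 < \<beta>" "\<beta> \<le> 1/4"
begin

lemma be1: "\<beta> < 1" using be by simp

lemma M: "M \<ge> 0" using u_bd[of 0] by linarith

lemma u_cont: "continuous_on UNIV u"
proof (rule lipschitz_on_continuous_on)
  show "L-lipschitz_on UNIV u"
    using u_lip L by (auto simp: lipschitz_on_def dist_norm)
qed

lemma u_meas [measurable]: "u \<in> borel_measurable borel"
  using u_cont by (rule borel_measurable_continuous_onI)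

text \<open>For t > 1 the L^1 smoothing rate t^(-d/2) is at most 1/t because d \<ge> 2; for t \<le>
  1 boundedness of u suffices. One constant for both bounds fits
  \<open>nn_integral_time_weight_le\<close>.\<close>

lemma heat_u_bounds:
  assumes t: "t > 0"
  shows "\<bar>heat t u x\<bar> \<le> M + N1" "\<bar>heat t u x\<bar> \<le> (M + N1) / t"
proof -
  have a: "\<bar>heat t u x\<bar> \<le> M" by (rule heat_bound[OF u_meas u_bd t])
  then show "\<bar>heat t u x\<bar> \<le> M + N1" using N1 by simp
  show "\<bar>heat t u x\<bar> \<le> (M + N1) / t"
  proof (cases "t \<le> 1")
    case True
    have "\<bar>heat t u x\<bar> \<le> (M + N1) / 1" using a N1 by simp
    also have "\<dots> \<le> (M + N1) / t" using True t M N1 by (intro divide_left_mono) auto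
    finally show ?thesis .
  next
    case False
    have "ennreal \<bar>heat t u x\<bar> \<le> ennreal (t powr (- real DIM('a) / 2)) * (\<integral>\<^sup>+y. ennreal \<bar>u y\<bar> \<partial>lborel)"
      by (rule heat_sup_L1[OF u_meas t])
    also have "\<dots> \<le> ennreal (t powr (- real DIM('a) / 2)) * ennreal N1"
      by (intro mult_left_mono u_L1) auto
    also have "\<dots> = ennreal (t powr (- real DIM('a) / 2) * N1)" by (simp add: ennreal_mult')
    finally have "\<bar>heat t u x\<bar> \<le> t powr (- real DIM('a) / 2) * N1" using N1 by (subst (asm) ennreal_le_iff) auto
    also have "\<dots> \<le> t powr (- 1) * N1"
      using False dim2 N1 by (intro mult_right_mono powr_mono) auto
    also have "\<dots> \<le> (M + N1) / t" using t M by (simp add: powr_minus_divide divide_right_mono)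
    finally show ?thesis .
  qed
qed

lemma heat_u_tendsto: "((\<lambda>t. heat t u x) \<longlongrightarrow> u x) (at_right 0)"
proof -
  have b: "\<bar>heat t u x - u x\<bar> \<le> L * ((real DIM('a) + 1) * sqrt t)" if t: "t > 0" for t
  proof -
    have "ennreal \<bar>u x - heat t u x\<bar> \<le> (\<integral>\<^sup>+z. ennreal (gauss t z) * ennreal \<bar>u (x + z) - u x\<bar> \<partial>lborel)"
      by (rule heat_diff_le_nn[OF u_meas u_bd t])
    also have "\<dots> \<le> (\<integral>\<^sup>+z. ennreal L * ennreal (gauss t (z::'a) * norm z) \<partial>lborel)"
    proof (rule nn_integral_mono)
      fix z :: 'a
      have "gauss t z * \<bar>u (x + z) - u x\<bar> \<le> gauss t z * (L * norm z)"
        using u_lip[of "x + z" x] by (intro mult_left_mono) auto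
      also have "\<dots> = L * (gauss t z * norm z)" by simp
      finally show "ennreal (gauss t z) * ennreal \<bar>u (x + z) - u x\<bar> \<le> ennreal L * ennreal (gauss t z * norm z)"
        using L by (simp add: ennreal_mult'[symmetric] ennreal_leI)
    qed
    also have "\<dots> = ennreal L * (\<integral>\<^sup>+z. ennreal (gauss t (z::'a) * norm z) \<partial>lborel)"
      by (rule nn_integral_cmult) measurable
    also have "\<dots> \<le> ennreal L * ennreal ((real (DIM('a) + 1)) * sqrt t)"
      by (intro mult_left_mono nn_integral_gauss_norm t) auto
    also have "\<dots> = ennreal (L * ((real DIM('a) + 1) * sqrt t))"
      using L by (simp add: ennreal_mult' add.commute)
    finally have "\<bar>u x - heat t u x\<bar> \<le> L * ((real DIM('a) + 1) * sqrt t)"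
      using L t by (subst (asm) ennreal_le_iff) auto
    then show ?thesis by (simp add: abs_minus_commute)
  qed
  have "((\<lambda>t. L * ((real DIM('a) + 1) * sqrt t)) \<longlongrightarrow> L * ((real DIM('a) + 1) * sqrt 0)) (at_right 0)"
    by (intro tendsto_intros)
  then have l0: "((\<lambda>t. L * ((real DIM('a) + 1) * sqrt t)) \<longlongrightarrow> 0) (at_right 0)" by simp
  have "\<forall>\<^sub>F t in at_right 0. norm (heat t u x - u x) \<le> L * ((real DIM('a) + 1) * sqrt t)"
    using eventually_at_right_less[of 0] by eventually_elim (simp only: real_norm_def b)
  from Lim_null_comparison[OF this l0]
  have "((\<lambda>t. heat t u x - u x) \<longlongrightarrow> 0) (at_right 0)" .
  then show ?thesis by (simp add: LIM_zero_iff)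
qed

definition pot :: "'a \<Rightarrow> real" where
  "pot x = (\<integral>t. indicator {0<..} t * (t powr (\<beta> - 1) * heat t u x) \<partial>lborel)"

lemma pot_measurable [measurable]: "pot \<in> borel_measurable borel"
  unfolding pot_def[abs_def] by measurable

lemma heat_time_measurable [measurable]: "(\<lambda>t. heat t u x) \<in> borel_measurable borel"
  by measurable

lemma nn_pot:
  assumes "\<tau> \<ge> 0"
  shows "(\<integral>\<^sup>+t. ennreal (norm (indicator {0<..} t * (t powr (\<beta> - 1) * heat (t + \<tau>) u x))) \<partial>lborel)
    \<le> ennreal ((M + N1) * (1 / \<beta> + 1 / (1 - \<beta>)))"
  by (rule nn_integral_time_weight_le[OF be(1) be1 heat_time_measurable assms heat_u_bounds])

lemma pot_integrable: "integrable lborel (\<lambda>t. indicator {0<..} t * (t powr (\<beta> - 1) * heat t u x))"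
  using le_less_trans[OF nn_pot[of 0 x]] by (intro integrableI_bounded) auto

lemma pot_bound: "\<bar>pot x\<bar> \<le> (M + N1) * (1 / \<beta> + 1 / (1 - \<beta>))"
proof -
  have "ennreal \<bar>pot x\<bar> \<le> ennreal ((M + N1) * (1 / \<beta> + 1 / (1 - \<beta>)))"
    unfolding pot_def using order_trans[OF integral_norm_le_nn nn_pot[of 0 x]] by simp
  then show ?thesis using M N1 be by (subst (asm) ennreal_le_iff) auto
qed

text \<open>By the semigroup law, P_\<tau> acts on the potential as a shift of the time argument.
  This reduces \<open>pot_inversion\<close> to the one-dimensional inversion with g t =
  \<open>heat t u x\<close>.\<close>

lemma heat_pot:
  assumes tau: "\<tau> > 0"
  shows "heat \<tau> pot x = (\<integral>t. indicator {0<..} t * (t powr (\<beta> - 1) * heat (t + \<tau>) u x) \<partial>lborel)"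
proof -
  let ?h = "\<lambda>z t. gauss \<tau> z * (indicator {0<..} t * (t powr (\<beta> - 1) * heat t u (x + z)))"
  have "heat \<tau> pot x = (\<integral>z. \<integral>t. ?h z t \<partial>lborel \<partial>lborel)"
    by (simp add: heat_def[of \<tau> pot] pot_def)
  also have "\<dots> = (\<integral>t. \<integral>z. ?h z t \<partial>lborel \<partial>lborel)"
  proof (rule lborel_Fubini)
    have "(\<integral>\<^sup>+z. \<integral>\<^sup>+t. ennreal (norm (?h z t)) \<partial>lborel \<partial>lborel)
      = (\<integral>\<^sup>+z. ennreal (gauss \<tau> z) * (\<integral>\<^sup>+t. ennreal (norm (indicator {0<..} t * (t powr (\<beta> - 1) * heat t u (x + z)))) \<partial>lborel) \<partial>lborel)"
      by (subst nn_integral_norm_cmult) auto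
    also have "\<dots> \<le> (\<integral>\<^sup>+z. ennreal (gauss \<tau> (z::'a)) * ennreal ((M + N1) * (1 / \<beta> + 1 / (1 - \<beta>))) \<partial>lborel)"
      using nn_pot[of 0] by (intro nn_integral_mono mult_left_mono) auto
    also have "\<dots> = ennreal ((M + N1) * (1 / \<beta> + 1 / (1 - \<beta>)))"
      by (simp add: nn_integral_multc nn_integral_gauss tau)
    finally show "(\<integral>\<^sup>+z. \<integral>\<^sup>+t. ennreal (norm (?h z t)) \<partial>lborel \<partial>lborel) < \<infinity>" by (simp add: le_less_trans)
  qed measurable
  also have "\<dots> = (\<integral>t. indicator {0<..} t * (t powr (\<beta> - 1) * heat (t + \<tau>) u x) \<partial>lborel)"
  proof (rule Bochner_Integration.integral_cong[OF refl])
    fix t :: real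
    show "(\<integral>z. ?h z t \<partial>lborel) = indicator {0<..} t * (t powr (\<beta> - 1) * heat (t + \<tau>) u x)"
    proof (cases "t > 0")
      case True
      have "(\<integral>z. ?h z t \<partial>lborel) = (\<integral>z. t powr (\<beta> - 1) * (gauss \<tau> z * heat t u (x + z)) \<partial>lborel)"
        using True by (simp add: mult_ac)
      also have "\<dots> = t powr (\<beta> - 1) * heat \<tau> (heat t u) x" by (simp add: heat_def[of \<tau>])
      also have "heat \<tau> (heat t u) x = heat (t + \<tau>) u x"
        using heat_heat[OF u_meas u_bd tau True] by (simp add: add.commute)
      finally show ?thesis using True by simp
    qed simp
  qed
  finally show ?thesis .
qed

lemma pot_inversion:
  "ennreal (\<bar>u x\<bar> / \<beta>\<^sup>2) \<le> (\<integral>\<^sup>+\<tau>. ennreal (\<tau> powr (- \<beta> - 1)) * indicator {0<..} \<tau> * ennreal \<bar>pot x - heat \<tau> pot x\<bar> \<partial>lborel)"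
proof -
  have "ennreal (\<bar>u x\<bar> / \<beta>\<^sup>2) \<le> (\<integral>\<^sup>+\<tau>. ennreal (\<tau> powr (- \<beta> - 1)) * indicator {0<..} \<tau> *
     ennreal \<bar>(\<integral>t. indicator {0<..} t * (t powr (\<beta> - 1) * heat (t + 0) u x) \<partial>lborel)
       - (\<integral>t. indicator {0<..} t * (t powr (\<beta> - 1) * heat (t + \<tau>) u x) \<partial>lborel)\<bar> \<partial>lborel)"
    by (rule fractional_inversion_1d[OF be(1) be1 heat_time_measurable heat_u_bounds heat_u_tendsto])
  also have "\<dots> = (\<integral>\<^sup>+\<tau>. ennreal (\<tau> powr (- \<beta> - 1)) * indicator {0<..} \<tau> * ennreal \<bar>pot x - heat \<tau> pot x\<bar> \<partial>lborel)"
    by (intro nn_integral_cong) (auto simp: indicator_def heat_pot pot_def)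
  finally show ?thesis .
qed

text \<open>The times t > T contribute at most c/2 at every point, while the part W from t \<le> T
  is integrable over space. Hence W \<ge> c/2 wherever |pot| > c, and Markov's inequality
  applies.\<close>

lemma pot_level_finite:
  assumes c: "c > 0"
  shows "emeasure lborel {x. \<bar>pot x\<bar> > c} < \<infinity>"
proof -
  define K where "K = M + N1"
  have K: "K \<ge> 0" using M N1 by (simp add: K_def)
  \<comment> \<open>T solves (K + 1) * T^(\<beta>-1) / (1-\<beta>) = c/2; K + 1 instead of K avoids
    dividing by zero when K = 0.\<close>
  define T where "T = (c * (1 - \<beta>) / (2 * (K + 1))) powr (1 / (\<beta> - 1))"
  have T: "T > 0" using c K be by (simp add: T_def)
  have Tc: "K * (T powr (- (1 - \<beta>)) / (1 - \<beta>)) \<le> c / 2"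
  proof -
    have "T powr (- (1 - \<beta>)) = c * (1 - \<beta>) / (2 * (K + 1))"
      using c K be by (simp add: T_def powr_powr)
    then have "K * (T powr (- (1 - \<beta>)) / (1 - \<beta>)) = K * (c * (1 - \<beta>) / (2 * (K + 1)) / (1 - \<beta>))"
      by (simp only:)
    also have "\<dots> = (c / 2) * (K / (K + 1))" using be K by simp
    finally have "K * (T powr (- (1 - \<beta>)) / (1 - \<beta>)) = (c / 2) * (K / (K + 1))" .
    also have "\<dots> \<le> (c / 2) * 1" using c K by (intro mult_left_mono) auto
    finally show ?thesis by simp
  qed
  define W where "W x = (\<integral>\<^sup>+t. ennreal (t powr (\<beta> - 1)) * indicator {0<..T} t * ennreal \<bar>heat t u x\<bar> \<partial>lborel)" for x
  have W_meas[measurable]: "W \<in> borel_measurable borel" unfolding W_def[abs_def] by measurable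
  have pW: "ennreal \<bar>pot x\<bar> \<le> W x + ennreal (c / 2)" for x
  proof -
    have "ennreal \<bar>pot x\<bar> \<le> (\<integral>\<^sup>+t. ennreal (norm (indicator {0<..} t * (t powr (\<beta> - 1) * heat t u x))) \<partial>lborel)"
      unfolding pot_def using integral_norm_le_nn[of lborel "\<lambda>t. indicator {0<..} t * (t powr (\<beta> - 1) * heat t u x)"] by simp
    also have "\<dots> \<le> (\<integral>\<^sup>+t. ennreal (t powr (\<beta> - 1)) * indicator {0<..T} t * ennreal \<bar>heat t u x\<bar>
       + ennreal K * (ennreal (t powr (- (1 - \<beta>) - 1)) * indicator {T<..} t) \<partial>lborel)"
    proof (rule nn_integral_mono)
      fix t :: real
      consider "t \<le> 0" | "0 < t" "t \<le> T" | "T < t" by linarith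
      then show "ennreal (norm (indicator {0<..} t * (t powr (\<beta> - 1) * heat t u x))) \<le>
        ennreal (t powr (\<beta> - 1)) * indicator {0<..T} t * ennreal \<bar>heat t u x\<bar> + ennreal K * (ennreal (t powr (- (1 - \<beta>) - 1)) * indicator {T<..} t)"
      proof cases
        case 2 then show ?thesis by (simp add: abs_mult ennreal_mult')
      next
        case 3
        then have t: "t > 0" using T by simp
        have "t powr (\<beta> - 1) * \<bar>heat t u x\<bar> \<le> t powr (\<beta> - 1) * (K / t)"
          using heat_u_bounds(2)[OF t] by (intro mult_left_mono) (auto simp: K_def)
        also have "\<dots> = K * (t powr (\<beta> - 1) / t powr 1)" using t by simp
        also have "t powr (\<beta> - 1) / t powr 1 = t powr (- (1 - \<beta>) - 1)"
          unfolding powr_diff[symmetric] by simp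
        finally show ?thesis using 3 t K by (simp add: abs_mult ennreal_mult'[symmetric] ennreal_leI)
      qed simp
    qed
    also have "\<dots> = W x + ennreal K * ennreal (T powr (- (1 - \<beta>)) / (1 - \<beta>))"
    proof -
      have "(\<integral>\<^sup>+t. ennreal K * (ennreal (t powr (- (1 - \<beta>) - 1)) * indicator {T<..} t) \<partial>lborel)
        = ennreal K * ennreal (T powr (- (1 - \<beta>)) / (1 - \<beta>))"
        unfolding nn_integral_powr_inf[OF diff_gt_0_iff_gt[THEN iffD2, OF be1] T, symmetric]
        by (rule nn_integral_cmult) measurable
      note eq = this
      show ?thesis unfolding W_def eq[symmetric] by (rule nn_integral_add) measurable
    qed
    also have "\<dots> \<le> W x + ennreal (c / 2)"
      using K Tc by (intro add_left_mono) (simp add: ennreal_mult'[symmetric] ennreal_leI)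
    finally show ?thesis .
  qed
  have intW: "(\<integral>\<^sup>+x. W x \<partial>lborel) \<le> ennreal (T powr \<beta> / \<beta>) * ennreal N1"
  proof -
    have "(\<integral>\<^sup>+x. W x \<partial>lborel) = (\<integral>\<^sup>+t. \<integral>\<^sup>+x. ennreal (t powr (\<beta> - 1)) * indicator {0<..T} t * ennreal \<bar>heat t u x\<bar> \<partial>lborel \<partial>lborel)"
      unfolding W_def by (rule lborel_Tonelli) measurable
    also have "\<dots> = (\<integral>\<^sup>+t. ennreal (t powr (\<beta> - 1)) * indicator {0<..T} t * (\<integral>\<^sup>+x. ennreal \<bar>heat t u x\<bar> \<partial>lborel) \<partial>lborel)"
      by (intro nn_integral_cong nn_integral_cmult) measurable
    also have "\<dots> \<le> (\<integral>\<^sup>+t. ennreal (t powr (\<beta> - 1)) * indicator {0<..T} t * ennreal N1 \<partial>lborel)"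
    proof (rule nn_integral_mono)
      fix t :: real
      show "ennreal (t powr (\<beta> - 1)) * indicator {0<..T} t * (\<integral>\<^sup>+x. ennreal \<bar>heat t u x\<bar> \<partial>lborel) \<le> ennreal (t powr (\<beta> - 1)) * indicator {0<..T} t * ennreal N1"
      proof (cases "t > 0")
        case True
        have "(\<integral>\<^sup>+x. ennreal (1 * \<bar>u (x + z)\<bar>) \<partial>lborel) \<le> ennreal N1" for z
          using nn_integral_translate[of "\<lambda>x. ennreal \<bar>u x\<bar>" z] u_L1 by (simp add: add.commute)
        from nn_integral_weighted_heat_le[OF u_meas _ True _ this]
        have "(\<integral>\<^sup>+x. ennreal \<bar>heat t u x\<bar> \<partial>lborel) \<le> ennreal N1" by simp
        then show ?thesis by (intro mult_left_mono) auto
      qed simp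
    qed
    also have "\<dots> = ennreal (T powr \<beta> / \<beta>) * ennreal N1"
      using be T by (simp add: nn_integral_multc nn_integral_powr_0)
    finally show ?thesis .
  qed
  have "emeasure lborel {x. \<bar>pot x\<bar> > c} \<le> emeasure lborel {x \<in> space lborel. 1 \<le> ennreal (2 / c) * W x}"
  proof (rule emeasure_mono)
    show "{x. \<bar>pot x\<bar> > c} \<subseteq> {x \<in> space lborel. 1 \<le> ennreal (2 / c) * W x}"
    proof
      fix x assume "x \<in> {x. \<bar>pot x\<bar> > c}"
      then have "ennreal c \<le> ennreal \<bar>pot x\<bar>" using c by (intro ennreal_leI) auto
      also note pW[of x]
      also have "W x + ennreal (c / 2) = ennreal (c / 2) + W x" by (rule add.commute)
      finally have "ennreal (c / 2) + ennreal (c / 2) \<le> ennreal (c / 2) + W x"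
        using c by (simp add: ennreal_plus[symmetric] del: ennreal_plus)
      then have "ennreal (c / 2) \<le> W x"
        unfolding ennreal_add_left_cancel_le by simp
      then have "ennreal (2 / c) * ennreal (c / 2) \<le> ennreal (2 / c) * W x" by (intro mult_left_mono) auto
      then show "x \<in> {x \<in> space lborel. 1 \<le> ennreal (2 / c) * W x}"
        using c by (simp add: ennreal_mult'[symmetric])
    qed
  qed measurable
  also have "\<dots> \<le> ennreal (2 / c) * (\<integral>\<^sup>+x. W x * indicator (space lborel) x \<partial>lborel)"
    by (rule nn_integral_Markov_inequality) auto
  also have "\<dots> \<le> ennreal (2 / c) * (ennreal (T powr \<beta> / \<beta>) * ennreal N1)"
    using intW by (intro mult_left_mono) auto
  also have "\<dots> < \<infinity>" by (simp add: ennreal_mult_less_top)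
  finally show ?thesis .
qed

end

section \<open>The gradient of the potential\<close>

text \<open>Along a line the exponent is a quadratic polynomial in s. Moving in direction -h cancels
  the minus sign of the gradient of the Gaussian.\<close>

lemma heat_kernel_line_derivative:
  fixes w h :: "'a::euclidean_space"
  assumes t: "t > 0"
  shows "((\<lambda>s. gauss t (w - s *\<^sub>R h)) has_real_derivative ((w - s *\<^sub>R h) \<bullet> h) / t * gauss t (w - s *\<^sub>R h)) (at s)"
proof -
  define c where "c = (2 * pi * t) powr (- real DIM('a) / 2)"
  have e: "gauss t (w - s *\<^sub>R h) = c * exp (- (w \<bullet> w - 2 * s * (w \<bullet> h) + s\<^sup>2 * (h \<bullet> h)) / (2 * t))" for s
  proof -
    have "(norm (w - s *\<^sub>R h))\<^sup>2 = w \<bullet> w - 2 * s * (w \<bullet> h) + s\<^sup>2 * (h \<bullet> h)"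
      unfolding power2_norm_eq_inner
      by (simp add: inner_diff_left inner_diff_right inner_commute power2_eq_square algebra_simps)
    then show ?thesis by (simp only: gauss_def c_def)
  qed
  let ?E = "\<lambda>s. - (w \<bullet> w - 2 * s * (w \<bullet> h) + s\<^sup>2 * (h \<bullet> h)) / (2 * t)"
  have "(?E has_real_derivative (- (- 2 * (w \<bullet> h) + 2 * s * (h \<bullet> h)) / (2 * t))) (at s)"
    by (rule DERIV_cdivide) (auto intro!: derivative_eq_intros)
  from DERIV_cmult[OF DERIV_chain'[OF this DERIV_exp]]
  have "((\<lambda>s. c * exp (?E s)) has_real_derivative c * (exp (?E s) * (- (- 2 * (w \<bullet> h) + 2 * s * (h \<bullet> h)) / (2 * t)))) (at s)" .
  also have "c * (exp (?E s) * (- (- 2 * (w \<bullet> h) + 2 * s * (h \<bullet> h)) / (2 * t))) = ((w - s *\<^sub>R h) \<bullet> h) / t * (c * exp (?E s))"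
  proof -
    have "- (- 2 * (w \<bullet> h) + 2 * s * (h \<bullet> h)) / (2 * t) = ((w - s *\<^sub>R h) \<bullet> h) / t"
      using t by (simp add: inner_diff_left field_simps)
    then show ?thesis by (simp only: mult_ac)
  qed
  finally show ?thesis unfolding e .
qed

lemma heat_kernel_line_integral:
  fixes w h :: "'a::euclidean_space"
  assumes t: "t > 0"
  shows "(\<integral>s. indicator {0..1} s * (((w - s *\<^sub>R h) \<bullet> h) / t * gauss t (w - s *\<^sub>R h)) \<partial>lborel) = gauss t (w - h) - gauss t w"
proof -
  have "(\<integral>s. indicator {0..1} s *\<^sub>R (((w - s *\<^sub>R h) \<bullet> h) / t * gauss t (w - s *\<^sub>R h)) \<partial>lborel) = gauss t (w - 1 *\<^sub>R h) - gauss t (w - 0 *\<^sub>R h)"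
  proof (rule integral_FTC_atLeastAtMost)
    show "((\<lambda>s. gauss t (w - s *\<^sub>R h)) has_vector_derivative ((w - s *\<^sub>R h) \<bullet> h) / t * gauss t (w - s *\<^sub>R h)) (at s within {0..1})" for s
      using heat_kernel_line_derivative[OF t, of w h s]
      unfolding has_real_derivative_iff_has_vector_derivative by (rule has_vector_derivative_at_within)
    show "continuous_on {0..1} (\<lambda>s. ((w - s *\<^sub>R h) \<bullet> h) / t * gauss t (w - s *\<^sub>R h))"
      unfolding gauss_def using t by (intro continuous_intros) auto
  qed simp
  then show ?thesis by simp
qed

lemma gauss_first_moment_integrable:
  assumes t: "t > 0"
  shows "integrable lborel (\<lambda>z::'a::euclidean_space. (z \<bullet> h) / t * gauss t z)"
proof (rule integrableI_bounded)
  have "(\<integral>\<^sup>+z. ennreal (norm ((z \<bullet> h) / t * gauss t (z::'a))) \<partial>lborel) \<le> (\<integral>\<^sup>+z. ennreal (norm h / t) * ennreal (gauss t (z::'a) * norm z) \<partial>lborel)"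
  proof (rule nn_integral_mono)
    fix z :: 'a
    have "norm ((z \<bullet> h) / t * gauss t z) \<le> (norm z * norm h) / t * gauss t z"
      using t Cauchy_Schwarz_ineq2[of z h] by (auto simp: abs_mult intro!: mult_right_mono divide_right_mono)
    also have "\<dots> = norm h / t * (gauss t z * norm z)" by simp
    finally show "ennreal (norm ((z \<bullet> h) / t * gauss t z)) \<le> ennreal (norm h / t) * ennreal (gauss t z * norm z)"
      using t by (subst ennreal_mult'[symmetric]) (auto intro!: ennreal_leI)
  qed
  also have "\<dots> = ennreal (norm h / t) * (\<integral>\<^sup>+z. ennreal (gauss t (z::'a) * norm z) \<partial>lborel)"
    by (rule nn_integral_cmult) measurable
  also have "\<dots> \<le> ennreal (norm h / t) * ennreal ((DIM('a) + 1) * sqrt t)"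
    by (intro mult_left_mono nn_integral_gauss_norm t) auto
  also have "\<dots> < \<infinity>" by (simp add: ennreal_mult_less_top)
  finally show "(\<integral>\<^sup>+z. ennreal (norm ((z \<bullet> h) / t * gauss t (z::'a))) \<partial>lborel) < \<infinity>" .
qed measurable

text \<open>The integrand is odd. This permits subtracting u y in \<open>heat_slope\<close>, and the
  gain from the subtraction is what makes the time integral converge at 0.\<close>

lemma gauss_first_moment_0:
  "(\<integral>z. ((z::'a::euclidean_space) \<bullet> h) / t * gauss t z \<partial>lborel) = 0"
proof -
  have "(\<integral>z. ((z::'a) \<bullet> h) / t * gauss t z \<partial>lborel) = (\<integral>z. ((0 + (-1) *\<^sub>R z) \<bullet> h) / t * gauss t (0 + (-1) *\<^sub>R (z::'a)) \<partial>lborel)"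
    by (rule integral_reflect_translate[symmetric]) auto
  also have "\<dots> = - (\<integral>z. ((z::'a) \<bullet> h) / t * gauss t z \<partial>lborel)" by simp
  finally show ?thesis by simp
qed

section \<open>Absolute convergence and the derivative of the potential\<close>

context lipschitz_data
begin

text \<open>A modulus of continuity of u, uniform in the base point. The Lipschitz branch controls
  the kernel near z = 0, the bounded branch controls it at infinity.\<close>

definition osc :: "'a \<Rightarrow> real" where
  "osc z = min (L * norm z) (2 * M)"

definition osc_const :: real where
  "osc_const = L * real DIM('a) + 2 * M * (real DIM('a) + 1)"

lemma osc_measurable [measurable]: "osc \<in> borel_measurable borel"
  unfolding osc_def[abs_def] by measurable

lemma osc_nonneg: "0 \<le> osc z"
  using L M by (simp add: osc_def)

lemma osc_const_nonneg: "0 \<le> osc_const"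
  using L M by (simp add: osc_const_def)

lemma u_osc: "\<bar>u (x + z) - u x\<bar> \<le> osc z"
proof -
  have "\<bar>u (x + z) - u x\<bar> \<le> L * norm z" using u_lip[of "x + z" x] by simp
  moreover have "\<bar>u (x + z) - u x\<bar> \<le> 2 * M" using u_bd[of "x + z"] u_bd[of x] by simp
  ultimately show ?thesis by (simp add: osc_def)
qed

text \<open>The Lipschitz branch meets the second moment of the Gaussian and gives t, the bounded
  branch meets the first moment and gives sqrt t; \<open>osc_const\<close> dominates both
  constants.\<close>

lemma nn_gauss_osc:
  assumes t: "t > 0"
  shows "(\<integral>\<^sup>+z. ennreal (gauss t z * (norm z * osc z)) \<partial>lborel) \<le> ennreal (osc_const * min t (sqrt t))"
proof -
  have 1: "(\<integral>\<^sup>+z. ennreal (gauss t z * (norm z * osc z)) \<partial>lborel) \<le> ennreal (osc_const * t)"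
  proof -
    have "(\<integral>\<^sup>+z. ennreal (gauss t z * (norm z * osc z)) \<partial>lborel) \<le> (\<integral>\<^sup>+z. ennreal L * ennreal (gauss t (z::'a) * (norm z)\<^sup>2) \<partial>lborel)"
    proof (rule nn_integral_mono)
      fix z :: 'a
      have "gauss t z * (norm z * osc z) \<le> gauss t z * (norm z * (L * norm z))"
        by (intro mult_left_mono) (auto simp: osc_def)
      also have "\<dots> = L * (gauss t z * (norm z)\<^sup>2)" by (simp add: power2_eq_square)
      finally show "ennreal (gauss t z * (norm z * osc z)) \<le> ennreal L * ennreal (gauss t z * (norm z)\<^sup>2)"
        using L by (subst ennreal_mult'[symmetric]) (auto intro!: ennreal_leI)
    qed
    also have "\<dots> = ennreal L * ennreal (real DIM('a) * t)"
      by (simp add: nn_integral_cmult nn_integral_gauss_sq[OF t])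
    also have "\<dots> = ennreal (L * (real DIM('a) * t))" using L by (subst ennreal_mult') auto
    also have "\<dots> \<le> ennreal (osc_const * t)"
    proof (rule ennreal_leI)
      have "(L * real DIM('a)) * t \<le> osc_const * t"
        using t M by (intro mult_right_mono) (auto simp: osc_const_def)
      then show "L * (real DIM('a) * t) \<le> osc_const * t" by (simp add: mult.assoc)
    qed
    finally show ?thesis .
  qed
  have 2: "(\<integral>\<^sup>+z. ennreal (gauss t z * (norm z * osc z)) \<partial>lborel) \<le> ennreal (osc_const * sqrt t)"
  proof -
    have "(\<integral>\<^sup>+z. ennreal (gauss t z * (norm z * osc z)) \<partial>lborel) \<le> (\<integral>\<^sup>+z. ennreal (2 * M) * ennreal (gauss t (z::'a) * norm z) \<partial>lborel)"
    proof (rule nn_integral_mono)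
      fix z :: 'a
      have "gauss t z * (norm z * osc z) \<le> gauss t z * (norm z * (2 * M))"
        by (intro mult_left_mono) (auto simp: osc_def)
      also have "\<dots> = (2 * M) * (gauss t z * norm z)" by simp
      finally show "ennreal (gauss t z * (norm z * osc z)) \<le> ennreal (2 * M) * ennreal (gauss t z * norm z)"
        using M by (subst ennreal_mult'[symmetric]) (auto intro!: ennreal_leI)
    qed
    also have "\<dots> = ennreal (2 * M) * (\<integral>\<^sup>+z. ennreal (gauss t (z::'a) * norm z) \<partial>lborel)"
      by (rule nn_integral_cmult) measurable
    also have "\<dots> \<le> ennreal (2 * M) * ennreal ((DIM('a) + 1) * sqrt t)"
      by (intro mult_left_mono nn_integral_gauss_norm t) auto
    also have "\<dots> = ennreal (2 * M * ((DIM('a) + 1) * sqrt t))" using M by (subst ennreal_mult') auto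
    also have "\<dots> \<le> ennreal (osc_const * sqrt t)"
    proof (rule ennreal_leI)
      have "(2 * M * (real DIM('a) + 1)) * sqrt t \<le> osc_const * sqrt t"
        using t L by (intro mult_right_mono) (auto simp: osc_const_def)
      then show "2 * M * (real (DIM('a) + 1) * sqrt t) \<le> osc_const * sqrt t" by (simp add: mult.assoc add.commute)
    qed
    finally show ?thesis .
  qed
  show ?thesis using 1 2 by (cases "t \<le> sqrt t") (auto simp: min_def)
qed

definition osc_total :: real where
  "osc_total = osc_const * (1 / \<beta> + 1 / (1/2 - \<beta>))"

text \<open>The integrand behaves like t^(\<beta>-1) near 0 and like t^(\<beta>-3/2) at infinity;
  the latter is integrable because \<beta> < 1/2.\<close>

lemma nn_time_osc:
  "(\<integral>\<^sup>+t. ennreal (indicator {0<..} t * t powr (\<beta> - 2)) * (\<integral>\<^sup>+z. ennreal (gauss t z * (norm z * osc z)) \<partial>lborel) \<partial>lborel) \<le> ennreal osc_total"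
proof -
  have "(\<integral>\<^sup>+t. ennreal (indicator {0<..} t * t powr (\<beta> - 2)) * (\<integral>\<^sup>+z. ennreal (gauss t z * (norm z * osc z)) \<partial>lborel) \<partial>lborel)
    \<le> (\<integral>\<^sup>+t. ennreal osc_const * (ennreal (t powr (\<beta> - 1)) * indicator {0<..1} t + ennreal (t powr (- (1/2 - \<beta>) - 1)) * indicator {1<..} t) \<partial>lborel)"
  proof (rule nn_integral_mono)
    fix t :: real
    let ?I = "\<integral>\<^sup>+z. ennreal (gauss t z * (norm z * osc z)) \<partial>lborel"
    show "ennreal (indicator {0<..} t * t powr (\<beta> - 2)) * ?I \<le> ennreal osc_const * (ennreal (t powr (\<beta> - 1)) * indicator {0<..1} t + ennreal (t powr (- (1/2 - \<beta>) - 1)) * indicator {1<..} t)"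
    proof (cases "t > 0")
      case t: True
      have le: "ennreal (indicator {0<..} t * t powr (\<beta> - 2)) * ?I \<le> ennreal (t powr (\<beta> - 2)) * ennreal (osc_const * min t (sqrt t))"
        using t nn_gauss_osc[OF t] by (simp add: mult_left_mono)
      also have "\<dots> = ennreal osc_const * ennreal (t powr (\<beta> - 2) * min t (sqrt t))"
        using osc_const_nonneg by (simp add: ennreal_mult'[symmetric] mult_ac)
      also have "\<dots> \<le> ennreal osc_const * (ennreal (t powr (\<beta> - 1)) * indicator {0<..1} t + ennreal (t powr (- (1/2 - \<beta>) - 1)) * indicator {1<..} t)"
      proof (intro mult_left_mono)
        show "ennreal (t powr (\<beta> - 2) * min t (sqrt t)) \<le> ennreal (t powr (\<beta> - 1)) * indicator {0<..1} t + ennreal (t powr (- (1/2 - \<beta>) - 1)) * indicator {1<..} t"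
        proof (cases "t \<le> 1")
          case True
          have "t powr (\<beta> - 2) * min t (sqrt t) \<le> t powr (\<beta> - 2) * t powr 1"
            using t by (intro mult_left_mono) auto
          also have "\<dots> = t powr (\<beta> - 1)" unfolding powr_add[symmetric] by simp
          finally show ?thesis using True t by (simp add: ennreal_leI)
        next
          case False
          have "t powr (\<beta> - 2) * min t (sqrt t) \<le> t powr (\<beta> - 2) * t powr (1/2)"
            using t by (intro mult_left_mono) (auto simp: powr_half_sqrt)
          also have "\<dots> = t powr (\<beta> - 2 + 1/2)" by (rule powr_add[symmetric])
          also have "\<beta> - 2 + 1/2 = - (1/2 - \<beta>) - 1" by simp
          finally show ?thesis using False t by (simp add: ennreal_leI)
        qed
      qed simp
      finally show ?thesis .
    qed simp
  qed
  also have "\<dots> = ennreal osc_const * (ennreal (1 / \<beta>) + ennreal (1 / (1/2 - \<beta>)))"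
    using be nn_integral_powr_0[of \<beta> 1] nn_integral_powr_inf[of "1/2 - \<beta>" 1]
    by (subst nn_integral_cmult) (auto simp: nn_integral_add)
  also have "\<dots> = ennreal osc_total"
    using be osc_const_nonneg unfolding osc_total_def
    by (subst ennreal_mult', simp) (subst ennreal_plus, auto)
  finally show ?thesis .
qed

text \<open>Writing the kernel as a time integral of Gaussians and exchanging the order reduces its
  integrability to moments of the Gaussian, so no polar coordinates are needed.\<close>

lemma nn_kernel_osc:
  "(\<integral>\<^sup>+z. ennreal (riesz_kernel \<beta> z * (norm z * osc z)) \<partial>lborel) \<le> ennreal osc_total"
proof -
  have "(\<integral>\<^sup>+z. ennreal (riesz_kernel \<beta> z * (norm z * osc z)) \<partial>lborel)
    = (\<integral>\<^sup>+z. \<integral>\<^sup>+t. ennreal (indicator {0<..} t * t powr (\<beta> - 2)) * ennreal (gauss t z * (norm z * osc z)) \<partial>lborel \<partial>lborel)"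
  proof (rule nn_integral_cong)
    fix z :: 'a
    show "ennreal (riesz_kernel \<beta> z * (norm z * osc z)) = (\<integral>\<^sup>+t. ennreal (indicator {0<..} t * t powr (\<beta> - 2)) * ennreal (gauss t z * (norm z * osc z)) \<partial>lborel)"
    proof (cases "z = 0")
      case False
      have nz: "0 \<le> norm z * osc z" using osc_nonneg by simp
      have "(\<integral>\<^sup>+t. ennreal (indicator {0<..} t * t powr (\<beta> - 2)) * ennreal (gauss t z * (norm z * osc z)) \<partial>lborel)
        = (\<integral>\<^sup>+t. ennreal (norm z * osc z) * ennreal (indicator {0<..} t * (t powr (\<beta> - 2) * gauss t z)) \<partial>lborel)"
      proof (rule nn_integral_cong)
        fix t :: real
        have "ennreal (indicator {0<..} t * t powr (\<beta> - 2)) * ennreal (gauss t z * (norm z * osc z))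
          = ennreal ((indicator {0<..} t * t powr (\<beta> - 2)) * (gauss t z * (norm z * osc z)))"
          by (rule ennreal_mult'[symmetric]) simp
        also have "(indicator {0<..} t * t powr (\<beta> - 2)) * (gauss t z * (norm z * osc z)) = (norm z * osc z) * (indicator {0<..} t * (t powr (\<beta> - 2) * gauss t z))"
          by (simp only: mult_ac)
        also have "ennreal \<dots> = ennreal (norm z * osc z) * ennreal (indicator {0<..} t * (t powr (\<beta> - 2) * gauss t z))"
          by (rule ennreal_mult'[OF nz])
        finally show "ennreal (indicator {0<..} t * t powr (\<beta> - 2)) * ennreal (gauss t z * (norm z * osc z)) = \<dots>" .
      qed
      also have "\<dots> = ennreal (norm z * osc z) * ennreal (riesz_kernel \<beta> z)"
        by (subst nn_integral_cmult) (auto simp: nn_integral_gauss_time[OF be dim2 False])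
      also have "\<dots> = ennreal ((norm z * osc z) * riesz_kernel \<beta> z)" by (rule ennreal_mult'[OF nz, symmetric])
      also have "(norm z * osc z) * riesz_kernel \<beta> z = riesz_kernel \<beta> z * (norm z * osc z)" by (rule mult.commute)
      finally show ?thesis by (rule sym)
    qed simp
  qed
  also have "\<dots> = (\<integral>\<^sup>+t. \<integral>\<^sup>+z. ennreal (indicator {0<..} t * t powr (\<beta> - 2)) * ennreal (gauss t z * (norm z * osc z)) \<partial>lborel \<partial>lborel)"
    by (rule lborel_Tonelli) measurable
  also have "\<dots> = (\<integral>\<^sup>+t. ennreal (indicator {0<..} t * t powr (\<beta> - 2)) * (\<integral>\<^sup>+z. ennreal (gauss t z * (norm z * osc z)) \<partial>lborel) \<partial>lborel)"
    by (intro nn_integral_cong nn_integral_cmult) measurable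
  also have "\<dots> \<le> ennreal osc_total" by (rule nn_time_osc)
  finally show ?thesis .
qed

lemma riesz_kernel_nonneg: "0 \<le> riesz_kernel \<beta> (z::'a)"
  using kernel_const(2)[OF be dim2] by (simp add: riesz_kernel_def)

lemma kernel_osc_integrable: "integrable lborel (\<lambda>z. riesz_kernel \<beta> z * (norm z * osc z))"
  using riesz_kernel_nonneg osc_nonneg le_less_trans[OF nn_kernel_osc]
  by (intro integrableI_nonneg) auto

definition pot_grad :: "'a \<Rightarrow> 'a" where
  "pot_grad x = (\<integral>z. (riesz_kernel \<beta> z * (u (x + z) - u x)) *\<^sub>R z \<partial>lborel)"

lemma pot_grad_integrand_le: "norm ((riesz_kernel \<beta> z * (u (x + z) - u x)) *\<^sub>R z) \<le> riesz_kernel \<beta> z * (norm z * osc z)"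
proof -
  have "norm ((riesz_kernel \<beta> z * (u (x + z) - u x)) *\<^sub>R z) = (riesz_kernel \<beta> z * norm z) * \<bar>u (x + z) - u x\<bar>"
    using riesz_kernel_nonneg[of z] by (simp add: abs_mult)
  also have "\<dots> \<le> (riesz_kernel \<beta> z * norm z) * osc z"
    using riesz_kernel_nonneg[of z] by (intro mult_left_mono u_osc) auto
  finally show ?thesis by (simp add: mult.assoc)
qed

lemma pot_grad_integrable: "integrable lborel (\<lambda>z. (riesz_kernel \<beta> z * (u (x + z) - u x)) *\<^sub>R z)"
  by (rule Bochner_Integration.integrable_bound[OF kernel_osc_integrable])
     (use pot_grad_integrand_le in \<open>auto intro: order_trans[OF _ abs_ge_self]\<close>)

text \<open>After the translation y = x + z, the sign of u x - u y and the sign of x - y both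
  change, so the product keeps its sign.\<close>

lemma pot_grad_eq: "pot_grad x = kernel_const DIM('a) \<beta> *\<^sub>R riesz_grad (1 - 2 * \<beta>) u x"
proof -
  let ?N = "real DIM('a) + 2 - 2 * \<beta>"
  have N: "real DIM('a) + (1 - 2 * \<beta>) + 1 = ?N" by simp
  have "riesz_grad (1 - 2 * \<beta>) u x = (\<integral>z. ((u x - u (x + z)) / norm (x - (x + z)) powr ?N) *\<^sub>R (x - (x + z)) \<partial>lborel)"
    unfolding riesz_grad_def N by (rule integral_translate[symmetric]) measurable
  then have "kernel_const DIM('a) \<beta> *\<^sub>R riesz_grad (1 - 2 * \<beta>) u x
    = (\<integral>z. kernel_const DIM('a) \<beta> *\<^sub>R (((u x - u (x + z)) / norm (x - (x + z)) powr ?N) *\<^sub>R (x - (x + z))) \<partial>lborel)"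
    by (simp only: integral_scaleR_right)
  also have "\<dots> = pot_grad x"
    unfolding pot_grad_def
  proof (rule Bochner_Integration.integral_cong[OF refl])
    fix z :: 'a
    have "((u x - u (x + z)) / norm (x - (x + z)) powr ?N) *\<^sub>R (x - (x + z)) = ((u (x + z) - u x) / norm z powr ?N) *\<^sub>R z"
      by (simp add: scaleR_minus_left[symmetric] minus_divide_left del: scaleR_minus_left)
    then show "kernel_const DIM('a) \<beta> *\<^sub>R (((u x - u (x + z)) / norm (x - (x + z)) powr ?N) *\<^sub>R (x - (x + z))) = (riesz_kernel \<beta> z * (u (x + z) - u x)) *\<^sub>R z"
      by (simp add: riesz_kernel_def)
  qed
  finally show ?thesis by simp
qed

text \<open>The majorant built from \<open>osc\<close> does not depend on x, so dominated
  convergence applies along every convergent sequence.\<close>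

lemma pot_grad_cont: "continuous_on UNIV pot_grad"
proof (rule continuous_on_sequentiallyI)
  fix X :: "nat \<Rightarrow> 'a" and a assume X: "X \<longlonglongrightarrow> a"
  show "(\<lambda>n. pot_grad (X n)) \<longlonglongrightarrow> pot_grad a"
    unfolding pot_grad_def
  proof (rule integral_dominated_convergence[OF _ _ kernel_osc_integrable])
    have ut: "(\<lambda>n. u (X n + c)) \<longlonglongrightarrow> u (a + c)" for c
      using u_cont by (intro continuous_on_tendsto_compose[of UNIV u] tendsto_add X tendsto_const) auto
    have "(\<lambda>n. u (X n)) \<longlonglongrightarrow> u a" using ut[of 0] by simp
    then show "AE z in lborel. (\<lambda>n. (riesz_kernel \<beta> z * (u (X n + z) - u (X n))) *\<^sub>R z) \<longlonglongrightarrow> (riesz_kernel \<beta> z * (u (a + z) - u a)) *\<^sub>R z"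
      by (intro AE_I2 tendsto_intros ut)
    show "AE z in lborel. norm ((riesz_kernel \<beta> z * (u (X n + z) - u (X n))) *\<^sub>R z) \<le> riesz_kernel \<beta> z * (norm z * osc z)" for n
      by (intro AE_I2 pot_grad_integrand_le)
  qed measurable
qed

text \<open>The derivative of \<open>heat t u\<close> at y in direction h, with the derivative
  placed on the Gaussian and u y subtracted.\<close>

definition heat_slope :: "'a \<Rightarrow> real \<Rightarrow> 'a \<Rightarrow> real" where
  "heat_slope h t y = (\<integral>z. (z \<bullet> h) / t * gauss t z * (u (y + z) - u y) \<partial>lborel)"

lemma heat_slope_measurable [measurable]:
  "(\<lambda>(t, y). heat_slope h t y) \<in> borel_measurable (borel \<Otimes>\<^sub>M borel)"
  unfolding heat_slope_def by measurable

lemma heat_slope_integrand_nn: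
  assumes t: "t > 0"
  shows "(\<integral>\<^sup>+z. ennreal (norm ((z \<bullet> h) / t * gauss t z * (u (y + z) - u y))) \<partial>lborel)
    \<le> ennreal (norm h / t) * (\<integral>\<^sup>+z. ennreal (gauss t z * (norm z * osc z)) \<partial>lborel)"
proof -
  have "(\<integral>\<^sup>+z. ennreal (norm ((z \<bullet> h) / t * gauss t z * (u (y + z) - u y))) \<partial>lborel)
    \<le> (\<integral>\<^sup>+z. ennreal (norm h / t) * ennreal (gauss t z * (norm z * osc z)) \<partial>lborel)"
  proof (rule nn_integral_mono)
    fix z :: 'a
    have "norm ((z \<bullet> h) / t * gauss t z * (u (y + z) - u y)) = \<bar>z \<bullet> h\<bar> / t * gauss t z * \<bar>u (y + z) - u y\<bar>"
      using t by (simp add: abs_mult)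
    also have "\<dots> \<le> (norm z * norm h) / t * gauss t z * osc z"
      using t osc_nonneg by (intro mult_mono u_osc divide_right_mono Cauchy_Schwarz_ineq2) auto
    also have "\<dots> = norm h / t * (gauss t z * (norm z * osc z))" by simp
    finally show "ennreal (norm ((z \<bullet> h) / t * gauss t z * (u (y + z) - u y))) \<le> ennreal (norm h / t) * ennreal (gauss t z * (norm z * osc z))"
      using t by (subst ennreal_mult'[symmetric]) (auto intro!: ennreal_leI)
  qed
  also have "\<dots> = ennreal (norm h / t) * (\<integral>\<^sup>+z. ennreal (gauss t z * (norm z * osc z)) \<partial>lborel)"
    by (rule nn_integral_cmult) measurable
  finally show ?thesis .
qed

text \<open>The identity holds for the Gaussian itself by \<open>heat_kernel_line_integral\<close>;
  integrating it against u and exchanging the order gives the claim without differentiating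
  u.\<close>

lemma heat_line_increment:
  assumes t: "t > 0"
  shows "heat t u (x + h) - heat t u x = (\<integral>s. indicator {0..1} s * heat_slope h t (x + s *\<^sub>R h) \<partial>lborel)"
proof -
  \<comment> \<open>Integrating G over y and translating by x + s h produces
    \<open>heat_slope\<close>; integrating over s first produces the increment of the Gaussian times
    u y.\<close>
  define G where "G s y = indicator {0..1} s * (u y * (((y - x - s *\<^sub>R h) \<bullet> h) / t * gauss t (y - x - s *\<^sub>R h)))" for s :: real and y :: 'a
  have Gm[measurable]: "case_prod G \<in> borel_measurable (borel \<Otimes>\<^sub>M borel)"
    unfolding G_def by measurable
  note fm = gauss_first_moment_integrable[OF t, where 'a='a and h=h]
  define m1 where "m1 = (\<integral>\<^sup>+z. ennreal (norm ((z \<bullet> h) / t * gauss t (z::'a))) \<partial>lborel)"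
  have m1: "m1 < \<infinity>" using fm unfolding m1_def integrable_iff_bounded by blast
  have shift: "G s (x + s *\<^sub>R h + z) = indicator {0..1} s * (u (x + s *\<^sub>R h + z) * ((z \<bullet> h) / t * gauss t z))" for s z
    by (simp add: G_def)
  have Gy: "(\<integral>y. G s y \<partial>lborel) = indicator {0..1} s * heat_slope h t (x + s *\<^sub>R h)" for s
  proof -
    define y where "y = x + s *\<^sub>R h"
    have i1: "integrable lborel (\<lambda>z. (z \<bullet> h) / t * gauss t z * u (y + z))"
    proof (rule Bochner_Integration.integrable_bound)
      show "integrable lborel (\<lambda>z. M * ((z \<bullet> h) / t * gauss t z))" using fm by (rule integrable_mult_right)
      show "AE z in lborel. norm ((z \<bullet> h) / t * gauss t z * u (y + z)) \<le> norm (M * ((z \<bullet> h) / t * gauss t z))"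
      proof (rule AE_I2)
        fix z :: 'a
        have "norm ((z \<bullet> h) / t * gauss t z * u (y + z)) = \<bar>u (y + z)\<bar> * \<bar>(z \<bullet> h) / t * gauss t z\<bar>"
          by (simp only: real_norm_def abs_mult mult.commute)
        also have "\<dots> \<le> M * \<bar>(z \<bullet> h) / t * gauss t z\<bar>" by (intro mult_right_mono u_bd) auto
        also have "\<dots> = norm (M * ((z \<bullet> h) / t * gauss t z))" using M by (simp only: real_norm_def abs_mult abs_of_nonneg)
        finally show "norm ((z \<bullet> h) / t * gauss t z * u (y + z)) \<le> norm (M * ((z \<bullet> h) / t * gauss t z))" .
      qed
    qed measurable
    have i2: "integrable lborel (\<lambda>z. (z \<bullet> h) / t * gauss t z * u y)" using fm by (rule integrable_mult_left)
    have "heat_slope h t y = (\<integral>z. (z \<bullet> h) / t * gauss t z * u (y + z) - (z \<bullet> h) / t * gauss t z * u y \<partial>lborel)"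
      by (simp only: heat_slope_def right_diff_distrib)
    also have "\<dots> = (\<integral>z. (z \<bullet> h) / t * gauss t z * u (y + z) \<partial>lborel) - (\<integral>z. (z \<bullet> h) / t * gauss t z * u y \<partial>lborel)"
      by (rule Bochner_Integration.integral_diff[OF i1 i2])
    also have "(\<integral>z. (z \<bullet> h) / t * gauss t z * u y \<partial>lborel) = 0"
      unfolding integral_mult_left_zero gauss_first_moment_0 by simp
    finally have hs: "heat_slope h t y = (\<integral>z. (z \<bullet> h) / t * gauss t z * u (y + z) \<partial>lborel)" by simp
    have "(\<integral>y. G s y \<partial>lborel) = (\<integral>z. G s (y + z) \<partial>lborel)"
      by (rule integral_translate[symmetric]) measurable
    also have "\<dots> = (\<integral>z. indicator {0..1} s * ((z \<bullet> h) / t * gauss t z * u (y + z)) \<partial>lborel)"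
      unfolding y_def shift by (simp only: mult_ac)
    also have "\<dots> = indicator {0..1} s * heat_slope h t y" unfolding hs by (rule integral_mult_right_zero)
    finally show ?thesis by (simp add: y_def)
  qed
  have "(\<integral>s. indicator {0..1} s * heat_slope h t (x + s *\<^sub>R h) \<partial>lborel) = (\<integral>s. \<integral>y. G s y \<partial>lborel \<partial>lborel)"
    by (simp only: Gy)
  also have "\<dots> = (\<integral>y. \<integral>s. G s y \<partial>lborel \<partial>lborel)"
  proof (rule lborel_Fubini[OF Gm])
    have "(\<integral>\<^sup>+s. \<integral>\<^sup>+y. ennreal (norm (G s y)) \<partial>lborel \<partial>lborel) \<le> (\<integral>\<^sup>+s. ennreal M * m1 * indicator {0..1::real} s \<partial>lborel)"
    proof (rule nn_integral_mono)
      fix s :: real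
      show "(\<integral>\<^sup>+y. ennreal (norm (G s y)) \<partial>lborel) \<le> ennreal M * m1 * indicator {0..1} s"
      proof (cases "s \<in> {0..1}")
        case True
        have "(\<integral>\<^sup>+y. ennreal (norm (G s y)) \<partial>lborel) = (\<integral>\<^sup>+z. ennreal (norm (G s (x + s *\<^sub>R h + z))) \<partial>lborel)"
          by (rule nn_integral_translate[symmetric]) measurable
        also have "\<dots> \<le> (\<integral>\<^sup>+z. ennreal M * ennreal (norm ((z \<bullet> h) / t * gauss t z)) \<partial>lborel)"
        proof (rule nn_integral_mono)
          fix z :: 'a
          have "norm (G s (x + s *\<^sub>R h + z)) = \<bar>u (x + s *\<^sub>R h + z)\<bar> * norm ((z \<bullet> h) / t * gauss t z)"
            unfolding shift using True by (simp only: real_norm_def abs_mult) simp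
          also have "\<dots> \<le> M * norm ((z \<bullet> h) / t * gauss t z)" by (intro mult_right_mono u_bd) auto
          finally show "ennreal (norm (G s (x + s *\<^sub>R h + z))) \<le> ennreal M * ennreal (norm ((z \<bullet> h) / t * gauss t z))"
            using M by (subst ennreal_mult'[symmetric]) (auto intro!: ennreal_leI)
        qed
        also have "\<dots> = ennreal M * m1" unfolding m1_def by (rule nn_integral_cmult) measurable
        finally show ?thesis using True by simp
      qed (simp add: G_def)
    qed
    also have "\<dots> = ennreal M * m1" by (simp add: nn_integral_cmult_indicator)
    also have "\<dots> < \<infinity>" using m1 by (simp add: ennreal_mult_less_top)
    finally show "(\<integral>\<^sup>+s. \<integral>\<^sup>+y. ennreal (norm (G s y)) \<partial>lborel \<partial>lborel) < \<infinity>" .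
  qed
  also have "\<dots> = (\<integral>y. gauss t (y - (x + h)) * u y - gauss t (y - x) * u y \<partial>lborel)"
  proof (rule Bochner_Integration.integral_cong[OF refl])
    fix y :: 'a
    have "(\<integral>s. G s y \<partial>lborel) = (\<integral>s. u y * (indicator {0..1} s * (((y - x - s *\<^sub>R h) \<bullet> h) / t * gauss t (y - x - s *\<^sub>R h))) \<partial>lborel)"
      by (simp only: G_def mult.left_commute)
    also have "\<dots> = u y * (gauss t (y - x - h) - gauss t (y - x))"
      unfolding heat_kernel_line_integral[OF t, symmetric] by (rule integral_mult_right_zero)
    finally show "(\<integral>s. G s y \<partial>lborel) = gauss t (y - (x + h)) * u y - gauss t (y - x) * u y"
      by (simp add: algebra_simps)
  qed
  also have "\<dots> = heat t u (x + h) - heat t u x"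
  proof -
    have "integrable lborel (\<lambda>y. gauss t (y - c) * u y)" for c
    proof -
      have "integrable lborel (\<lambda>z. gauss t z * u (c + z))" by (rule heat_integrable[OF u_meas u_bd t])
      then have "integrable (distr lborel borel (\<lambda>z. c + 1 *\<^sub>R z)) (\<lambda>y. gauss t (y - c) * u y)"
        by (subst integrable_distr_eq) auto
      then show ?thesis by (subst (asm) lborel_reflect_translate) auto
    qed
    then show ?thesis by (subst Bochner_Integration.integral_diff) (auto simp: heat_eq)
  qed
  finally show ?thesis by simp
qed

text \<open>The increment formula for \<open>heat t u\<close> is integrated in time. One exchange
  brings the time integral inside the segment integral, a second one inside the integral over z,
  where \<open>nn_integral_gauss_time\<close> evaluates it. The integral form avoids differentiating
  under the time integral.\<close>

lemma pot_line_increment: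
  "pot (x + h) - pot x = (\<integral>s. indicator {0..1} s * (pot_grad (x + s *\<^sub>R h) \<bullet> h) \<partial>lborel)"
proof -
  let ?k = "\<lambda>t. indicator {0<..} t * t powr (\<beta> - 1) :: real"
  let ?J = "\<lambda>t. \<integral>\<^sup>+z. ennreal (gauss t z * (norm z * osc z)) \<partial>lborel"
  \<comment> \<open>The factor 1/t of \<open>heat_slope\<close> lowers t^(\<beta>-1) to
    t^(\<beta>-2), the weight of \<open>nn_time_osc\<close>; this one majorant justifies both
    exchanges.\<close>
  have kJ: "ennreal (?k t) * (ennreal (norm h / t) * ?J t) = ennreal (norm h) * (ennreal (indicator {0<..} t * t powr (\<beta> - 2)) * ?J t)" for t
  proof (cases "t > 0")
    case True
    have "t powr (\<beta> - 1) * (norm h / t) = norm h * (t powr (\<beta> - 1) / t powr 1)" using True by simp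
    also have "t powr (\<beta> - 1) / t powr 1 = t powr (\<beta> - 2)" unfolding powr_diff[symmetric] by simp
    finally show ?thesis using True by (simp add: mult.assoc[symmetric] ennreal_mult'[symmetric])
  qed simp
  have kJ_int: "(\<integral>\<^sup>+t. ennreal (?k t) * (ennreal (norm h / t) * ?J t) \<partial>lborel) < \<infinity>"
  proof -
    have "(\<integral>\<^sup>+t. ennreal (?k t) * (ennreal (norm h / t) * ?J t) \<partial>lborel) = ennreal (norm h) * (\<integral>\<^sup>+t. ennreal (indicator {0<..} t * t powr (\<beta> - 2)) * ?J t \<partial>lborel)"
      unfolding kJ by (rule nn_integral_cmult) measurable
    also have "\<dots> \<le> ennreal (norm h) * ennreal osc_total"
      by (intro mult_left_mono nn_time_osc) auto
    also have "\<dots> < \<infinity>" by (simp add: ennreal_mult_less_top)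
    finally show ?thesis .
  qed
  have "pot (x + h) - pot x = (\<integral>t. indicator {0<..} t * (t powr (\<beta> - 1) * heat t u (x + h)) - indicator {0<..} t * (t powr (\<beta> - 1) * heat t u x) \<partial>lborel)"
    unfolding pot_def by (rule Bochner_Integration.integral_diff[OF pot_integrable pot_integrable, symmetric])
  also have "\<dots> = (\<integral>t. \<integral>s. ?k t * (indicator {0..1} s * heat_slope h t (x + s *\<^sub>R h)) \<partial>lborel \<partial>lborel)"
  proof (rule Bochner_Integration.integral_cong[OF refl])
    fix t :: real
    show "indicator {0<..} t * (t powr (\<beta> - 1) * heat t u (x + h)) - indicator {0<..} t * (t powr (\<beta> - 1) * heat t u x)
      = (\<integral>s. ?k t * (indicator {0..1} s * heat_slope h t (x + s *\<^sub>R h)) \<partial>lborel)"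
    proof (cases "t > 0")
      case True
      then show ?thesis
        unfolding integral_mult_right_zero heat_line_increment[OF True, symmetric] by (simp add: right_diff_distrib)
    qed simp
  qed
  also have "\<dots> = (\<integral>s. \<integral>t. ?k t * (indicator {0..1} s * heat_slope h t (x + s *\<^sub>R h)) \<partial>lborel \<partial>lborel)"
  proof (rule lborel_Fubini)
    have "(\<integral>\<^sup>+t. \<integral>\<^sup>+s. ennreal (norm (?k t * (indicator {0..1} s * heat_slope h t (x + s *\<^sub>R h)))) \<partial>lborel \<partial>lborel)
      \<le> (\<integral>\<^sup>+t. ennreal (?k t) * (ennreal (norm h / t) * ?J t) \<partial>lborel)"
    proof (rule nn_integral_mono)
      fix t :: real
      show "(\<integral>\<^sup>+s. ennreal (norm (?k t * (indicator {0..1} s * heat_slope h t (x + s *\<^sub>R h)))) \<partial>lborel) \<le> ennreal (?k t) * (ennreal (norm h / t) * ?J t)"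
      proof (cases "t > 0")
        case True
        have "(\<integral>\<^sup>+s. ennreal (norm (?k t * (indicator {0..1} s * heat_slope h t (x + s *\<^sub>R h)))) \<partial>lborel)
          \<le> (\<integral>\<^sup>+s. ennreal (?k t) * (ennreal (norm h / t) * ?J t) * indicator {0..1::real} s \<partial>lborel)"
        proof (rule nn_integral_mono)
          fix s :: real
          have "ennreal (norm (heat_slope h t (x + s *\<^sub>R h))) \<le> ennreal (norm h / t) * ?J t"
            unfolding heat_slope_def by (rule order_trans[OF integral_norm_le_nn heat_slope_integrand_nn[OF True]])
          then have "ennreal (?k t) * ennreal (norm (heat_slope h t (x + s *\<^sub>R h))) \<le> ennreal (?k t) * (ennreal (norm h / t) * ?J t)"
            by (rule mult_left_mono) simp
          then show "ennreal (norm (?k t * (indicator {0..1} s * heat_slope h t (x + s *\<^sub>R h)))) \<le> ennreal (?k t) * (ennreal (norm h / t) * ?J t) * indicator {0..1} s"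
            by (cases "s \<in> {0..1}") (auto simp: abs_mult ennreal_mult')
        qed
        also have "\<dots> = ennreal (?k t) * (ennreal (norm h / t) * ?J t)"
          by (simp add: nn_integral_cmult_indicator)
        finally show ?thesis .
      qed simp
    qed
    then show "(\<integral>\<^sup>+t. \<integral>\<^sup>+s. ennreal (norm (?k t * (indicator {0..1} s * heat_slope h t (x + s *\<^sub>R h)))) \<partial>lborel \<partial>lborel) < \<infinity>"
      using kJ_int by (rule le_less_trans)
  qed measurable
  also have "\<dots> = (\<integral>s. indicator {0..1} s * (pot_grad (x + s *\<^sub>R h) \<bullet> h) \<partial>lborel)"
  proof (rule Bochner_Integration.integral_cong[OF refl])
    fix s :: real
    define y where "y = x + s *\<^sub>R h"
    let ?H = "\<lambda>t z. ?k t * ((z \<bullet> h) / t * gauss t z * (u (y + z) - u y))"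
    have "(\<integral>t. ?k t * heat_slope h t y \<partial>lborel) = (\<integral>t. \<integral>z. ?H t z \<partial>lborel \<partial>lborel)"
      by (simp only: heat_slope_def integral_mult_right_zero)
    also have "\<dots> = (\<integral>z. \<integral>t. ?H t z \<partial>lborel \<partial>lborel)"
    proof (rule lborel_Fubini)
      have "(\<integral>\<^sup>+t. \<integral>\<^sup>+z. ennreal (norm (?H t z)) \<partial>lborel \<partial>lborel) \<le> (\<integral>\<^sup>+t. ennreal (?k t) * (ennreal (norm h / t) * ?J t) \<partial>lborel)"
      proof (rule nn_integral_mono)
        fix t :: real
        show "(\<integral>\<^sup>+z. ennreal (norm (?H t z)) \<partial>lborel) \<le> ennreal (?k t) * (ennreal (norm h / t) * ?J t)"
        proof (cases "t > 0")
          case True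
          have "(\<integral>\<^sup>+z. ennreal (norm (?H t z)) \<partial>lborel) = ennreal \<bar>?k t\<bar> * (\<integral>\<^sup>+z. ennreal (norm ((z \<bullet> h) / t * gauss t z * (u (y + z) - u y))) \<partial>lborel)"
            by (rule nn_integral_norm_cmult) measurable
          also have "\<dots> \<le> ennreal \<bar>?k t\<bar> * (ennreal (norm h / t) * ?J t)"
            by (intro mult_left_mono heat_slope_integrand_nn True) auto
          finally show ?thesis by simp
        qed simp
      qed
      then show "(\<integral>\<^sup>+t. \<integral>\<^sup>+z. ennreal (norm (?H t z)) \<partial>lborel \<partial>lborel) < \<infinity>"
        using kJ_int by (rule le_less_trans)
    qed measurable
    also have "\<dots> = (\<integral>z. ((riesz_kernel \<beta> z * (u (y + z) - u y)) *\<^sub>R z) \<bullet> h \<partial>lborel)"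
    proof (rule Bochner_Integration.integral_cong[OF refl])
      fix z :: 'a
      show "(\<integral>t. ?H t z \<partial>lborel) = ((riesz_kernel \<beta> z * (u (y + z) - u y)) *\<^sub>R z) \<bullet> h"
      proof (cases "z = 0")
        case False
        have "?H t z = ((z \<bullet> h) * (u (y + z) - u y)) * (indicator {0<..} t * (t powr (\<beta> - 2) * gauss t z))" for t
        proof (cases "t > 0")
          case True
          have "t powr (\<beta> - 1) / t powr 1 = t powr (\<beta> - 2)" unfolding powr_diff[symmetric] by simp
          then have "t powr (\<beta> - 1) / t = t powr (\<beta> - 2)" using True by simp
          then show ?thesis using True by (simp add: divide_inverse mult_ac flip: \<open>t powr (\<beta> - 1) / t = t powr (\<beta> - 2)\<close>)
        qed simp
        then have "(\<integral>t. ?H t z \<partial>lborel) = ((z \<bullet> h) * (u (y + z) - u y)) * (\<integral>t. indicator {0<..} t * (t powr (\<beta> - 2) * gauss t z) \<partial>lborel)"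
          by (simp only: integral_mult_right_zero)
        also have "(\<integral>t. indicator {0<..} t * (t powr (\<beta> - 2) * gauss t z) \<partial>lborel) = riesz_kernel \<beta> z"
          by (subst integral_eq_nn_integral) (auto simp: nn_integral_gauss_time[OF be dim2 False] riesz_kernel_nonneg)
        finally show ?thesis by simp
      qed simp
    qed
    also have "\<dots> = pot_grad y \<bullet> h"
      unfolding pot_grad_def by (rule integral_inner_left[OF pot_grad_integrable])
    finally have "(\<integral>t. ?k t * heat_slope h t y \<partial>lborel) = pot_grad y \<bullet> h" .
    moreover have "(\<integral>t. ?k t * (indicator {0..1} s * heat_slope h t y) \<partial>lborel) = indicator {0..1} s * (\<integral>t. ?k t * heat_slope h t y \<partial>lborel)"
      unfolding mult.left_commute[of "?k _" "indicator {0..1} s"] by (rule integral_mult_right_zero)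
    ultimately show "(\<integral>t. ?k t * (indicator {0..1} s * heat_slope h t (x + s *\<^sub>R h)) \<partial>lborel) = indicator {0..1} s * (pot_grad (x + s *\<^sub>R h) \<bullet> h)"
      by (simp only: y_def)
  qed
  finally show ?thesis .
qed

text \<open>The increment is h paired with the average of \<open>pot_grad\<close> over the segment.
  By continuity this average is within e of the value at x once h is small.\<close>

lemma pot_has_derivative: "(pot has_derivative (\<lambda>h. pot_grad x \<bullet> h)) (at x)"
  unfolding has_derivative_at_alt
proof (intro conjI allI impI)
  show "bounded_linear ((\<bullet>) (pot_grad x))" by (rule bounded_linear_inner_right)
  fix e :: real assume e: "e > 0"
  obtain d where d: "d > 0" "\<And>y. dist y x < d \<Longrightarrow> dist (pot_grad y) (pot_grad x) < e"
    using pot_grad_cont e unfolding continuous_on_iff by (metis UNIV_I)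
  show "\<exists>d>0. \<forall>y. norm (y - x) < d \<longrightarrow> norm (pot y - pot x - pot_grad x \<bullet> (y - x)) \<le> e * norm (y - x)"
  proof (intro exI[of _ d] conjI allI impI d)
    fix y assume y: "norm (y - x) < d"
    define h where "h = y - x"
    have gc: "continuous_on {0..1} (\<lambda>s. pot_grad (x + s *\<^sub>R h) \<bullet> h)"
      by (intro continuous_intros continuous_on_compose2[OF pot_grad_cont]) auto
    have gi: "integrable lborel (\<lambda>s. indicator {0..1} s * (pot_grad (x + s *\<^sub>R h) \<bullet> h))"
      using borel_integrable_atLeastAtMost'[OF gc] by (simp add: set_integrable_def)
    have c1: "integrable lborel (\<lambda>s::real. indicator {0..1} s * (pot_grad x \<bullet> h))" by simp
    have "pot y - pot x - pot_grad x \<bullet> h = (\<integral>s. indicator {0..1} s * (pot_grad (x + s *\<^sub>R h) \<bullet> h) \<partial>lborel) - (\<integral>s. indicator {0..1::real} s * (pot_grad x \<bullet> h) \<partial>lborel)"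
      using pot_line_increment[of x h] by (simp add: h_def)
    also have "\<dots> = (\<integral>s. indicator {0..1} s * (pot_grad (x + s *\<^sub>R h) \<bullet> h) - indicator {0..1} s * (pot_grad x \<bullet> h) \<partial>lborel)"
      by (rule Bochner_Integration.integral_diff[OF gi c1, symmetric])
    finally have eq: "pot y - pot x - pot_grad x \<bullet> h = (\<integral>s. indicator {0..1} s * (pot_grad (x + s *\<^sub>R h) \<bullet> h) - indicator {0..1} s * (pot_grad x \<bullet> h) \<partial>lborel)" .
    have "norm (pot y - pot x - pot_grad x \<bullet> h) \<le> (\<integral>s. indicator {0..1::real} s * (e * norm h) \<partial>lborel)"
      unfolding eq
    proof (rule Bochner_Integration.integral_norm_bound_integral)
      show "integrable lborel (\<lambda>s. indicator {0..1} s * (pot_grad (x + s *\<^sub>R h) \<bullet> h) - indicator {0..1} s * (pot_grad x \<bullet> h))"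
        by (rule Bochner_Integration.integrable_diff[OF gi c1])
      show "integrable lborel (\<lambda>s::real. indicator {0..1} s * (e * norm h))" by simp
      fix s :: real
      show "norm (indicator {0..1} s * (pot_grad (x + s *\<^sub>R h) \<bullet> h) - indicator {0..1} s * (pot_grad x \<bullet> h)) \<le> indicator {0..1} s * (e * norm h)"
      proof (cases "s \<in> {0..1}")
        case True
        have "norm (s *\<^sub>R h) \<le> norm h" using True by (simp add: mult_left_le_one_le)
        then have "dist (x + s *\<^sub>R h) x < d" using y by (simp add: dist_norm h_def)
        then have "norm (pot_grad (x + s *\<^sub>R h) - pot_grad x) \<le> e" using d(2) by (simp add: dist_norm less_imp_le)
        then have "norm (pot_grad (x + s *\<^sub>R h) - pot_grad x) * norm h \<le> e * norm h" by (intro mult_right_mono) auto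
        then have "norm ((pot_grad (x + s *\<^sub>R h) - pot_grad x) \<bullet> h) \<le> e * norm h"
          using Cauchy_Schwarz_ineq2[of "pot_grad (x + s *\<^sub>R h) - pot_grad x" h] by simp
        then show ?thesis using True by (simp add: inner_diff_left)
      qed simp
    qed
    also have "\<dots> = e * norm h" by simp
    finally show "norm (pot y - pot x - pot_grad x \<bullet> (y - x)) \<le> e * norm (y - x)" by (simp add: h_def)
  qed
qed

end

section \<open>The fractional Sobolev inequality\<close>

lemma test_function_lipschitz:
  fixes u :: "'a::euclidean_space \<Rightarrow> real"
  assumes u: "u \<in> test_functions"
  obtains M L N where "\<And>x y. \<bar>u x - u y\<bar> \<le> L * norm (x - y)" "L \<ge> 0" "\<And>x. \<bar>u x\<bar> \<le> M"
    "(\<integral>\<^sup>+x. ennreal \<bar>u x\<bar> \<partial>lborel) \<le> ennreal N" "N \<ge> 0"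
proof -
  define K where "K = closure (support_on UNIV u)"
  have K: "compact K" using u by (simp add: test_functions_def K_def)
  have "ck 0 u" "ck (Suc 0) u" using u by (auto simp: test_functions_def)
  then have cont: "continuous_on UNIV u" and diff: "\<And>x. u differentiable at x"
    and dcont: "\<And>b. continuous_on UNIV (\<lambda>x. frechet_derivative u (at x) b)"
    by (auto simp: differentiable_on_def)
  have out: "u x = 0" if "x \<notin> K" for x
    using that closure_subset[of "support_on UNIV u"] by (auto simp: K_def support_on_def)
  have bdd: "\<exists>B\<ge>0. \<forall>x. \<bar>g x\<bar> \<le> B" if g: "continuous_on UNIV g" and g0: "\<And>x. x \<notin> K \<Longrightarrow> g x = 0" for g :: "'a \<Rightarrow> real"
  proof -
    have "bounded (g ` K)"
      using K continuous_on_subset[OF g subset_UNIV] by (intro compact_imp_bounded compact_continuous_image)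
    then obtain B where B: "B > 0" "\<And>x. x \<in> K \<Longrightarrow> \<bar>g x\<bar> \<le> B" unfolding bounded_pos by auto
    then have "\<bar>g x\<bar> \<le> B" for x using g0[of x] by (cases "x \<in> K") auto
    then show ?thesis using B(1) by (intro exI[of _ B]) auto
  qed
  obtain M where M: "M \<ge> 0" "\<And>x. \<bar>u x\<bar> \<le> M" using bdd[OF cont out] by blast
  \<comment> \<open>Outside the compact set u vanishes on an open neighbourhood of the point, so the
    derivative vanishes there too and its bound on the compact set is global.\<close>
  have D0: "frechet_derivative u (at x) b = 0" if x: "x \<notin> K" for x b
  proof -
    have "(u has_derivative (\<lambda>_. 0)) (at x)"
    proof (rule has_derivative_transform_within_open)
      show "((\<lambda>_. 0) has_derivative (\<lambda>_. 0)) (at x)" by (rule has_derivative_const)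
      show "open (- K)" using K by (simp add: compact_imp_closed open_Compl)
    qed (use x out in auto)
    then show ?thesis by (simp add: frechet_derivative_at[symmetric])
  qed
  have "\<exists>B. \<forall>b. B b \<ge> 0 \<and> (\<forall>x. \<bar>frechet_derivative u (at x) b\<bar> \<le> B b)"
    using bdd[OF dcont D0] by (intro choice) blast
  then obtain B where B: "\<And>b. B b \<ge> 0" "\<And>b x. \<bar>frechet_derivative u (at x) b\<bar> \<le> B b" by blast
  \<comment> \<open>Summing the bounds of the partial derivatives over the basis bounds the operator
    norm, because each coordinate of a vector is at most its norm.\<close>
  define L where "L = (\<Sum>b\<in>(Basis::'a set). B b)"
  have L: "L \<ge> 0" using B(1) by (auto simp: L_def intro: sum_nonneg)
  have on: "onorm (frechet_derivative u (at x)) \<le> L" for x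
  proof (rule onorm_bound[OF L])
    fix v :: 'a
    have lin: "linear (frechet_derivative u (at x))" using diff by (rule linear_frechet_derivative)
    have "frechet_derivative u (at x) v = frechet_derivative u (at x) (\<Sum>b\<in>Basis. (v \<bullet> b) *\<^sub>R b)"
      by (simp add: euclidean_representation)
    also have "\<dots> = (\<Sum>b\<in>Basis. (v \<bullet> b) * frechet_derivative u (at x) b)"
      using lin by (simp add: linear_sum linear_scale)
    finally have "norm (frechet_derivative u (at x) v) \<le> (\<Sum>b\<in>Basis. \<bar>(v \<bullet> b) * frechet_derivative u (at x) b\<bar>)"
      using sum_abs by (metis real_norm_def)
    also have "\<dots> \<le> (\<Sum>b\<in>Basis. norm v * B b)"
      unfolding abs_mult by (intro sum_mono mult_mono B Basis_le_norm) auto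
    also have "\<dots> = L * norm v" by (simp add: L_def sum_distrib_left mult.commute)
    finally show "norm (frechet_derivative u (at x) v) \<le> L * norm v" .
  qed
  have lip: "\<bar>u x - u y\<bar> \<le> L * norm (x - y)" for x y
  proof -
    have "norm (u x - u y) \<le> L * norm (x - y)"
      by (rule differentiable_bound[of UNIV u "\<lambda>x. frechet_derivative u (at x)"])
         (use diff on in \<open>auto simp: frechet_derivative_works[symmetric]\<close>)
    then show ?thesis by simp
  qed
  have "emeasure lborel K < \<infinity>" using K by (rule emeasure_compact_finite)
  then obtain m where m: "emeasure lborel K = ennreal m" "m \<ge> 0"
    by (metis ennreal_cases infinity_ennreal_def less_irrefl)
  have "(\<integral>\<^sup>+x. ennreal \<bar>u x\<bar> \<partial>lborel) \<le> (\<integral>\<^sup>+x. ennreal M * indicator K x \<partial>lborel)"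
  proof (rule nn_integral_mono)
    fix x show "ennreal \<bar>u x\<bar> \<le> ennreal M * indicator K x"
      using M(2)[of x] out[of x] by (cases "x \<in> K") (auto intro: ennreal_leI)
  qed
  also have "\<dots> = ennreal (M * m)"
    using K M m by (subst nn_integral_cmult_indicator) (auto simp: ennreal_mult' compact_imp_closed borel_closed)
  finally have "(\<integral>\<^sup>+x. ennreal \<bar>u x\<bar> \<partial>lborel) \<le> ennreal (M * m)" .
  from that[OF lip L M(2) this] M m show ?thesis by simp
qed

section \<open>The inversion formula tested against a weight\<close>

context lipschitz_data
begin

lemma weighted_inversion:
  assumes F[measurable]: "F \<in> borel_measurable borel" and F0: "\<And>x. 0 \<le> F x"
  shows "(\<integral>\<^sup>+x. ennreal (F x * (\<bar>u x\<bar> / \<beta>\<^sup>2)) \<partial>lborel) \<le> heat_energy \<beta> F pot"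
proof -
  let ?k = "\<lambda>\<tau>. ennreal (\<tau> powr (- \<beta> - 1)) * indicator {0<..} \<tau>"
  have "(\<integral>\<^sup>+x. ennreal (F x * (\<bar>u x\<bar> / \<beta>\<^sup>2)) \<partial>lborel)
    \<le> (\<integral>\<^sup>+x. \<integral>\<^sup>+\<tau>. ?k \<tau> * ennreal (F x * \<bar>pot x - heat \<tau> pot x\<bar>) \<partial>lborel \<partial>lborel)"
  proof (rule nn_integral_mono)
    fix x
    have "ennreal (F x * (\<bar>u x\<bar> / \<beta>\<^sup>2)) = ennreal (F x) * ennreal (\<bar>u x\<bar> / \<beta>\<^sup>2)"
      by (rule ennreal_mult'[OF F0])
    also have "\<dots> \<le> ennreal (F x) * (\<integral>\<^sup>+\<tau>. ?k \<tau> * ennreal \<bar>pot x - heat \<tau> pot x\<bar> \<partial>lborel)"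
      by (intro mult_left_mono pot_inversion) auto
    also have "\<dots> = (\<integral>\<^sup>+\<tau>. ennreal (F x) * (?k \<tau> * ennreal \<bar>pot x - heat \<tau> pot x\<bar>) \<partial>lborel)"
      by (rule nn_integral_cmult[symmetric]) measurable
    also have "\<dots> = (\<integral>\<^sup>+\<tau>. ?k \<tau> * ennreal (F x * \<bar>pot x - heat \<tau> pot x\<bar>) \<partial>lborel)"
      unfolding ennreal_mult'[OF F0] by (simp only: mult_ac)
    finally show "ennreal (F x * (\<bar>u x\<bar> / \<beta>\<^sup>2)) \<le> \<dots>" .
  qed
  also have "\<dots> = (\<integral>\<^sup>+\<tau>. \<integral>\<^sup>+x. ?k \<tau> * ennreal (F x * \<bar>pot x - heat \<tau> pot x\<bar>) \<partial>lborel \<partial>lborel)"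
    by (rule lborel_Tonelli) measurable
  also have "\<dots> = heat_energy \<beta> F pot"
    unfolding heat_energy_def by (intro nn_integral_cong nn_integral_cmult) measurable
  finally show ?thesis .
qed

lemma pot_gradient_pair:
  assumes I: "(\<integral>\<^sup>+x. ennreal (norm (pot_grad x)) \<partial>lborel) < \<infinity>"
  shows "gradient_pair pot pot_grad" "gradient_pair (\<lambda>x. - pot x) (\<lambda>x. - pot_grad x)"
proof -
  \<comment> \<open>The sign \<open>sg\<close> covers at once the one-sided level conditions for the
    potential and for its negative.\<close>
  have lev: "emeasure lborel {x. sg * pot x > c} < \<infinity>" if "c > 0" "\<bar>sg\<bar> = 1" for c sg :: real
  proof -
    have "emeasure lborel {x. sg * pot x > c} \<le> emeasure lborel {x. \<bar>pot x\<bar> > c}"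
    proof (rule emeasure_mono)
      have "sg * pot x \<le> \<bar>pot x\<bar>" for x using abs_ge_self[of "sg * pot x"] that(2) by (simp add: abs_mult)
      then show "{x. sg * pot x > c} \<subseteq> {x. \<bar>pot x\<bar> > c}" by (auto intro: less_le_trans)
    qed measurable
    then show ?thesis using pot_level_finite[OF that(1)] by (rule le_less_trans)
  qed
  show "gradient_pair pot pot_grad"
    using pot_has_derivative pot_grad_cont lev[of _ 1] I dim2 by unfold_locales auto
  show "gradient_pair (\<lambda>x. - pot x) (\<lambda>x. - pot_grad x)"
    using has_derivative_minus[OF pot_has_derivative] pot_grad_cont lev[of _ "-1"] I dim2
    by unfold_locales (auto intro!: continuous_intros simp: inner_minus_left)
qed

end

text \<open>The last factor is the uniform bound on \<open>kernel_const\<close>, which relates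
  \<open>pot_grad\<close> to the fractional gradient; the factors before it are the constant of
  \<open>gradient_energy_bound\<close>.\<close>

definition sobolev_const :: "nat \<Rightarrow> real" where
  "sobolev_const d = 4 * (real d + 1) * (1 + 20 * (real d + 1)) * (fact (d + 2) * 2 ^ (d + 2) + 1)"

theorem fractional_gradient_sobolev:
  fixes u :: "'a::euclidean_space \<Rightarrow> real"
  assumes u: "u \<in> test_functions" and d: "DIM('a) \<ge> 2" and s: "1 / 2 \<le> s" "s < 1"
  shows "lp_norm (real DIM('a) / (real DIM('a) - s)) u
    \<le> ennreal (sobolev_const DIM('a) * (1 - s)) * lp_norm 1 (riesz_grad s u)"
proof -
  define \<beta> where "\<beta> = (1 - s) / 2"
  have be: "0 < \<beta>" "\<beta> \<le> 1/4" using s by (auto simp: \<beta>_def)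
  have sb: "1 - 2 * \<beta> = s" by (simp add: \<beta>_def field_simps)
  define p where "p = real DIM('a) / (real DIM('a) - s)"
  have p: "p = real DIM('a) / (real DIM('a) - 1 + 2 * \<beta>)"
    unfolding p_def sb[symmetric] by (simp add: algebra_simps)
  have p1: "p > 1" using s d by (simp add: p_def field_simps)
  obtain M L N where ul: "\<And>x y. \<bar>u x - u y\<bar> \<le> L * norm (x - y)" "L \<ge> 0" "\<And>x. \<bar>u x\<bar> \<le> M"
    "(\<integral>\<^sup>+x. ennreal \<bar>u x\<bar> \<partial>lborel) \<le> ennreal N" "N \<ge> 0"
    by (rule test_function_lipschitz[OF u]) blast
  interpret lipschitz_data u M L N \<beta>
    by unfold_locales (use ul d be in auto)
  define c0 where "c0 = kernel_const DIM('a) \<beta>"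
  note c0 = kernel_const(2,3)[OF be d, folded c0_def]
  define R where "R = (\<integral>\<^sup>+x. ennreal (norm (riesz_grad s u x)) \<partial>lborel)"
  have pg: "pot_grad x = c0 *\<^sub>R riesz_grad s u x" for x
    using pot_grad_eq[of x] by (simp only: sb c0_def)
  have pgm: "pot_grad \<in> borel_measurable borel"
    by (rule borel_measurable_continuous_onI[OF pot_grad_cont])
  have lpR: "lp_norm 1 (riesz_grad s u) = R"
    by (cases "R = \<infinity>") (auto simp: lp_norm_def R_def Let_def ennreal_enn2real_if)
  show ?thesis
  proof (cases "R = \<infinity>")
    case True
    \<comment> \<open>Positivity matters because 0 times infinity is 0 in
      \<open>ennreal\<close>.\<close>
    have "sobolev_const DIM('a) * (1 - s) > 0" using s by (simp add: sobolev_const_def add_pos_pos)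
    then have "ennreal (sobolev_const DIM('a) * (1 - s)) \<noteq> 0" by (metis ennreal_eq_0_iff not_le)
    then have "ennreal (sobolev_const DIM('a) * (1 - s)) * R = \<infinity>"
      unfolding True infinity_ennreal_def by (simp only: ennreal_mult_top if_False)
    then show ?thesis unfolding lpR by simp
  next
    case False
    then obtain r where r: "R = ennreal r" "r \<ge> 0" by (metis ennreal_cases infinity_ennreal_def)
    have I: "(\<integral>\<^sup>+x. ennreal (norm (pot_grad x)) \<partial>lborel) = ennreal (c0 * r)"
    \<comment> \<open>Measurability of the fractional gradient is inherited from the continuous
      field \<open>pot_grad\<close> through division by c0.\<close>
    proof (cases "c0 = 0")
      case True then show ?thesis by (simp add: pg)
    next
      case False
      have "(\<lambda>x. (1 / c0) *\<^sub>R pot_grad x) \<in> borel_measurable borel" using pgm by measurable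
      then have rm[measurable]: "riesz_grad s u \<in> borel_measurable borel" using False by (simp add: pg)
      have "(\<integral>\<^sup>+x. ennreal (norm (pot_grad x)) \<partial>lborel) = (\<integral>\<^sup>+x. ennreal c0 * ennreal (norm (riesz_grad s u x)) \<partial>lborel)"
        using c0 by (simp add: pg ennreal_mult')
      also have "\<dots> = ennreal c0 * R" unfolding R_def by (rule nn_integral_cmult) measurable
      also have "\<dots> = ennreal (c0 * r)" unfolding r(1) by (rule ennreal_mult'[OF c0(1), symmetric])
      finally show ?thesis .
    qed
    then have Ifin: "(\<integral>\<^sup>+x. ennreal (norm (pot_grad x)) \<partial>lborel) < \<infinity>" by simp
    define Wp where "Wp = (\<integral>\<^sup>+x. ennreal (norm (u x) powr p) \<partial>lborel)"
    \<comment> \<open>Finiteness of the p-th power integral is what later permits cancelling a power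
      of the norm; it follows from u being bounded and integrable.\<close>
    have "Wp \<le> (\<integral>\<^sup>+x. ennreal (M powr (p - 1)) * ennreal \<bar>u x\<bar> \<partial>lborel)"
      unfolding Wp_def
    proof (rule nn_integral_mono)
      fix x
      have "norm (u x) powr p = \<bar>u x\<bar> powr (p - 1) * \<bar>u x\<bar>" by (cases "u x = 0") (auto simp: powr_diff)
      also have "\<dots> \<le> M powr (p - 1) * \<bar>u x\<bar>" using p1 by (intro mult_right_mono powr_mono2 u_bd) auto
      finally show "ennreal (norm (u x) powr p) \<le> ennreal (M powr (p - 1)) * ennreal \<bar>u x\<bar>"
        by (subst ennreal_mult'[symmetric]) (auto intro!: ennreal_leI)
    qed
    also have "\<dots> = ennreal (M powr (p - 1)) * (\<integral>\<^sup>+x. ennreal \<bar>u x\<bar> \<partial>lborel)"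
      by (rule nn_integral_cmult) measurable
    also have "\<dots> \<le> ennreal (M powr (p - 1)) * ennreal N" by (intro mult_left_mono u_L1) auto
    also have "\<dots> < \<infinity>" by (simp add: ennreal_mult_less_top)
    finally obtain W where W: "Wp = ennreal W" "W \<ge> 0" by (metis ennreal_cases infinity_ennreal_def less_irrefl)
    have lpu: "lp_norm p u = ennreal (W powr (1 / p))"
      unfolding lp_norm_def Wp_def[symmetric] Let_def W(1) using W(2) by simp
    show ?thesis
    proof (cases "W = 0")
      case True
      then show ?thesis using lpu by (simp add: p_def)
    next
      case False
      then have W0: "W > 0" using W by simp
      define U where "U = W powr (1 / p)"
      have U: "U > 0" using W0 by (simp add: U_def)
      have Up: "U powr p = W" using W0 p1 by (simp add: U_def powr_powr)
      define c1 where "c1 = 4 * (real DIM('a) + 1) * (1 + 20 * (real DIM('a) + 1))"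
      have c1: "c1 \<ge> 0" by (simp add: c1_def)
      have "ennreal (1 / \<beta>\<^sup>2 * W) = ennreal (1 / \<beta>\<^sup>2) * Wp"
        unfolding W(1) by (rule ennreal_mult') simp
      also have "\<dots> = (\<integral>\<^sup>+x. ennreal (1 / \<beta>\<^sup>2) * ennreal (norm (u x) powr p) \<partial>lborel)"
        unfolding Wp_def by (rule nn_integral_cmult[symmetric]) measurable
      also have "\<dots> = (\<integral>\<^sup>+x. ennreal (\<bar>u x\<bar> powr (p - 1) * (\<bar>u x\<bar> / \<beta>\<^sup>2)) \<partial>lborel)"
      proof (rule nn_integral_cong)
        fix x
        have "norm (u x) powr p = \<bar>u x\<bar> powr (p - 1) * \<bar>u x\<bar>" by (cases "u x = 0") (auto simp: powr_diff)
        then show "ennreal (1 / \<beta>\<^sup>2) * ennreal (norm (u x) powr p) = ennreal (\<bar>u x\<bar> powr (p - 1) * (\<bar>u x\<bar> / \<beta>\<^sup>2))"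
          by (subst ennreal_mult'[symmetric]) auto
      qed
      also have "\<dots> \<le> heat_energy \<beta> (\<lambda>x. \<bar>u x\<bar> powr (p - 1)) pot"
        by (rule weighted_inversion) auto
      also have "\<dots> \<le> ennreal (U powr (p - 1) * c1 / \<beta> * (c0 * r))"
        unfolding c1_def
        by (rule gradient_energy_bound[OF pot_gradient_pair[OF Ifin] _ pot_bound _ be p U _ I])
           (use W Up c0 r in \<open>auto simp: Wp_def\<close>)
      finally have "1 / \<beta>\<^sup>2 * W \<le> U powr (p - 1) * c1 / \<beta> * (c0 * r)"
        using be c0 c1 r by (subst (asm) ennreal_le_iff) auto
      then have "\<beta>\<^sup>2 * (1 / \<beta>\<^sup>2 * W) \<le> \<beta>\<^sup>2 * (U powr (p - 1) * c1 / \<beta> * (c0 * r))"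
        by (rule mult_left_mono) simp
      \<comment> \<open>The \<beta>^2 of the inversion against the 1/\<beta> of the energy leaves
        the single factor \<beta>, which is at most 1 - s. As W = U^(p-1) * U with U positive, the
        power U^(p-1) then cancels.\<close>
      then have "W \<le> U powr (p - 1) * (\<beta> * c1 * c0 * r)"
        using be by (simp add: power2_eq_square mult_ac)
      also have "W = U powr (p - 1) * U" unfolding Up[symmetric] using U by (simp add: powr_diff)
      finally have "U \<le> \<beta> * c1 * c0 * r" using U by simp
      also have "\<dots> \<le> (1 - s) * c1 * (fact (DIM('a) + 2) * 2 ^ (DIM('a) + 2) + 1) * r"
        using be c0 c1 r s by (intro mult_mono) (auto simp: \<beta>_def)
      also have "\<dots> = sobolev_const DIM('a) * (1 - s) * r" by (simp only: sobolev_const_def c1_def mult_ac)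
      finally have "ennreal U \<le> ennreal (sobolev_const DIM('a) * (1 - s) * r)" by (rule ennreal_leI)
      also have "\<dots> = ennreal (sobolev_const DIM('a) * (1 - s)) * ennreal r"
        using s by (intro ennreal_mult') (simp add: sobolev_const_def)
      finally show ?thesis using lpu by (simp only: lpR r(1) U_def p_def)
    qed
  qed
qed

theorem theorem2:
  assumes "CARD('n::finite) \<ge> 2"
  shows "\<exists>C::real. C > 0 \<and>
    (\<forall>u \<in> (test_functions :: (real ^ 'n \<Rightarrow> real) set). \<forall>s::real. 1 / 2 \<le> s \<and> s < 1 \<longrightarrow>
      lp_norm (real CARD('n) / (real CARD('n) - s)) u
        \<le> ennreal (C * (1 - s)) * lp_norm 1 (riesz_grad s u))"
proof (intro exI conjI ballI allI impI)
  show "sobolev_const CARD('n) > 0" by (simp add: sobolev_const_def add_pos_pos)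
  fix u :: "real ^ 'n \<Rightarrow> real" and s :: real
  assume "u \<in> test_functions" "1 / 2 \<le> s \<and> s < 1"
  then show "lp_norm (real CARD('n) / (real CARD('n) - s)) u \<le> ennreal (sobolev_const CARD('n) * (1 - s)) * lp_norm 1 (riesz_grad s u)"
    using fractional_gradient_sobolev[of u s] assms by simp
qed

end
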